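(* Let $k$ be an algebraically closed field, $A$ a $k$-algebra, and $G$ a finite abelian group with $\operatorname{char}(k)\nmid|G|$ acting on $A$ by $k$-algebra automorphisms; fix an isomorphism $G\to G^\vee$, $g\mapsto\chi_g$, and a normalised 2-cocycle $\mu$ of $G$ with values in $k^\times$. Then $\operatorname{rgldim}A=\operatorname{rgldim}A^{G,\mu}$ and $\operatorname{lgldim}A=\operatorname{lgldim}A^{G,\mu}$.
   Context: Algebras are associative, unital and finitely generated over $k$. $\operatorname{rgldim}$ and $\operatorname{lgldim}$ denote right and left global dimension. A normalised 2-cocycle is $\mu:G\times G\to k^\times$ with $\mu(g,h)\mu(gh,l)=\mu(g,hl)\mu(h,l)$ and $\mu(e,g)=\mu(g,e)=1$. The action $a\mapsto a^g$ induces a $G$-grading $A_g=\{a\in A:a^h=\chi_{g^{-1}}(h)a\ \forall h\in G\}$, and the cocycle twist $A^{G,\mu}$ is the vector space $A$ with multiplication $a\ast_\mu b=\mu(g,h)ab$ for $a\in A_g$, $b\in A_h$. *)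

theory Defs
  imports "HOL-Algebra.Algebra" "HOL-Library.Extended_Nat"
begin

section \<open>Modules over noncommutative rings and global dimension\<close>

text \<open>The library's locale \<open>module\<close> requires a commutative base ring; this is the same list
  of axioms over an arbitrary unital ring. As in the library, the fields \<open>mult\<close> and \<open>one\<close>
  of the record \<open>M\<close> carry no information.\<close>

locale left_module = R?: ring R + M?: abelian_group M
  for R :: "('a, 'r) ring_scheme" (structure) and M :: "('a, 'm, 'n) module_scheme" (structure) +
  assumes smult_closed:
      "\<lbrakk>a \<in> carrier R; x \<in> carrier M\<rbrakk> \<Longrightarrow> a \<odot>\<^bsub>M\<^esub> x \<in> carrier M"
    and smult_l_distr:
      "\<lbrakk>a \<in> carrier R; b \<in> carrier R; x \<in> carrier M\<rbrakk> \<Longrightarrow>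
        (a \<oplus> b) \<odot>\<^bsub>M\<^esub> x = a \<odot>\<^bsub>M\<^esub> x \<oplus>\<^bsub>M\<^esub> b \<odot>\<^bsub>M\<^esub> x"
    and smult_r_distr:
      "\<lbrakk>a \<in> carrier R; x \<in> carrier M; y \<in> carrier M\<rbrakk> \<Longrightarrow>
        a \<odot>\<^bsub>M\<^esub> (x \<oplus>\<^bsub>M\<^esub> y) = a \<odot>\<^bsub>M\<^esub> x \<oplus>\<^bsub>M\<^esub> a \<odot>\<^bsub>M\<^esub> y"
    and smult_assoc1:
      "\<lbrakk>a \<in> carrier R; b \<in> carrier R; x \<in> carrier M\<rbrakk> \<Longrightarrow>
        (a \<otimes> b) \<odot>\<^bsub>M\<^esub> x = a \<odot>\<^bsub>M\<^esub> (b \<odot>\<^bsub>M\<^esub> x)"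
    and smult_one:
      "x \<in> carrier M \<Longrightarrow> \<one> \<odot>\<^bsub>M\<^esub> x = x"

definition module_homs ::
    "('a, 'r) ring_scheme \<Rightarrow> ('a, 'm) module \<Rightarrow> ('a, 'n) module \<Rightarrow> ('m \<Rightarrow> 'n) set" where
  "module_homs R M N = {f \<in> hom (add_monoid M) (add_monoid N).
     \<forall>a\<in>carrier R. \<forall>x\<in>carrier M. f (a \<odot>\<^bsub>M\<^esub> x) = a \<odot>\<^bsub>N\<^esub> f x}"

definition projective_module :: "('a, 'r) ring_scheme \<Rightarrow> ('a, 'm) module \<Rightarrow> bool" where
  "projective_module R P \<longleftrightarrow> left_module R P \<and>
     (\<forall>(L :: ('a, 'm) module) (N :: ('a, 'm) module) f g.
        left_module R L \<and> left_module R N \<and>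
        f \<in> module_homs R L N \<and> f ` carrier L = carrier N \<and> g \<in> module_homs R P N \<longrightarrow>
        (\<exists>h\<in>module_homs R P L. \<forall>p\<in>carrier P. f (h p) = g p))"

text \<open>\<open>\<dots> \<rightarrow> P 2 \<rightarrow> P 1 \<rightarrow> P 0 \<rightarrow> M \<rightarrow> 0\<close> with differentials
  \<open>d i : P (i + 1) \<rightarrow> P i\<close> and augmentation \<open>\<epsilon>\<close>.\<close>

definition projective_resolution ::
    "('a, 'r) ring_scheme \<Rightarrow> ('a, 'm) module \<Rightarrow> (nat \<Rightarrow> ('a, 'm) module) \<Rightarrow>
      (nat \<Rightarrow> 'm \<Rightarrow> 'm) \<Rightarrow> ('m \<Rightarrow> 'm) \<Rightarrow> bool" where
  "projective_resolution R M P d \<epsilon> \<longleftrightarrow>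
     (\<forall>i. projective_module R (P i)) \<and>
     (\<forall>i. d i \<in> module_homs R (P (Suc i)) (P i)) \<and>
     \<epsilon> \<in> module_homs R (P 0) M \<and>
     \<epsilon> ` carrier (P 0) = carrier M \<and>
     a_kernel (P 0) M \<epsilon> = d 0 ` carrier (P 1) \<and>
     (\<forall>i. a_kernel (P (Suc i)) (P i) (d i) = d (Suc i) ` carrier (P (Suc (Suc i))))"

text \<open>The infimum is \<open>\<infinity>\<close> if there is no finite projective resolution; the zero module has
  projective dimension 0 (so the zero ring has global dimension 0).\<close>

definition proj_dim :: "('a, 'r) ring_scheme \<Rightarrow> ('a, 'm) module \<Rightarrow> enat" where
  "proj_dim R M = (INF n \<in> {n. \<exists>P d \<epsilon>. projective_resolution R M P d \<epsilon> \<and>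
     (\<forall>i>n. carrier (P i) = {\<zero>\<^bsub>P i\<^esub>})}. enat n)"

text \<open>Since HOL cannot quantify over types inside a formula, the type \<open>'m\<close> plays the role of
  a universe: the supremum ranges over all modules whose carrier is a subset of \<open>'m\<close>, and the
  projective modules, test modules and resolutions are taken in \<open>'m\<close> as well. As soon as
  \<open>'m\<close> is infinite and \<open>carrier R\<close> embeds into it, every module in \<open>'m\<close> has a free cover
  in \<open>'m\<close>, projectivity and projective dimension have their absolute meaning, and every cyclic
  module occurs, so the supremum is the usual global dimension. Results should be stated
  for arbitrary \<open>'m\<close>.\<close>

definition lgldim :: "'m itself \<Rightarrow> ('a, 'r) ring_scheme \<Rightarrow> enat" where
  "lgldim U R = (SUP M \<in> {M :: ('a, 'm) module. left_module R M}. proj_dim R M)"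

definition opposite_ring :: "('a, 'r) ring_scheme \<Rightarrow> ('a, 'r) ring_scheme" where
  "opposite_ring R = R\<lparr>monoid.mult := (\<lambda>x y. y \<otimes>\<^bsub>R\<^esub> x)\<rparr>"

text \<open>A right \<open>R\<close>-module is a left module over the opposite ring, with
  \<open>r \<odot> m\<close> read as \<open>m r\<close>.\<close>

definition rgldim :: "'m itself \<Rightarrow> ('a, 'r) ring_scheme \<Rightarrow> enat" where
  "rgldim U R = lgldim U (opposite_ring R)"


section \<open>Algebras over a field, and group actions on them\<close>

text \<open>The library's locale \<open>algebra\<close> is for commutative algebras only.\<close>

locale assoc_algebra = module k A + ring A
  for k :: "('c, 'r) ring_scheme" (structure) and A :: "('c, 'a, 'n) module_scheme" (structure) +
  assumes smult_mult_left: "\<lbrakk>c \<in> carrier k; x \<in> carrier A; y \<in> carrier A\<rbrakk> \<Longrightarrow>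
      (c \<odot>\<^bsub>A\<^esub> x) \<otimes>\<^bsub>A\<^esub> y = c \<odot>\<^bsub>A\<^esub> (x \<otimes>\<^bsub>A\<^esub> y)"
    and smult_mult_right: "\<lbrakk>c \<in> carrier k; x \<in> carrier A; y \<in> carrier A\<rbrakk> \<Longrightarrow>
      x \<otimes>\<^bsub>A\<^esub> (c \<odot>\<^bsub>A\<^esub> y) = c \<odot>\<^bsub>A\<^esub> (x \<otimes>\<^bsub>A\<^esub> y)"

definition finitely_generated_algebra :: "('c, 'r) ring_scheme \<Rightarrow> ('c, 'a) module \<Rightarrow> bool" where
  "finitely_generated_algebra k A \<longleftrightarrow> (\<exists>S. finite S \<and> S \<subseteq> carrier A \<and>
     (\<forall>B. subring B A \<and> (\<forall>c\<in>carrier k. \<forall>b\<in>B. c \<odot>\<^bsub>A\<^esub> b \<in> B) \<and> S \<subseteq> B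
        \<longrightarrow> B = carrier A))"

text \<open>\<open>group.ord\<close> is 0 for elements of infinite order.\<close>

definition characteristic :: "('c, 'r) ring_scheme \<Rightarrow> nat" where
  "characteristic k = group.ord (add_monoid k) \<one>\<^bsub>k\<^esub>"

text \<open>\<open>\<phi> g a\<close> is \<open>a\<close> raised to \<open>g\<close> in exponential notation for the action.\<close>

locale algebra_action = group_action G "carrier A" \<phi> + assoc_algebra k A
  for k :: "('c, 'r) ring_scheme" (structure) and A :: "('c, 'a, 'n) module_scheme" (structure)
    and G :: "('g, 'x) monoid_scheme" (structure) and \<phi> +
  assumes action_ring_hom: "g \<in> carrier G \<Longrightarrow> \<phi> g \<in> ring_hom A A"
    and action_smult: "\<lbrakk>g \<in> carrier G; c \<in> carrier k; a \<in> carrier A\<rbrakk> \<Longrightarrow>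
      \<phi> g (c \<odot>\<^bsub>A\<^esub> a) = c \<odot>\<^bsub>A\<^esub> \<phi> g a"

text \<open>Characters are taken \<open>extensional\<close> so that equality of characters is equality on
  \<open>carrier G\<close>.\<close>

definition dual_group ::
    "('g, 'x) monoid_scheme \<Rightarrow> ('c, 'r) ring_scheme \<Rightarrow> ('g \<Rightarrow> 'c) monoid" where
  "dual_group G k = \<lparr>carrier = hom G (units_of k) \<inter> extensional (carrier G),
     monoid.mult = (\<lambda>\<alpha> \<beta>. \<lambda>h\<in>carrier G. \<alpha> h \<otimes>\<^bsub>k\<^esub> \<beta> h),
     one = (\<lambda>h\<in>carrier G. \<one>\<^bsub>k\<^esub>)\<rparr>"

definition normalised_2cocycle ::
    "('g, 'x) monoid_scheme \<Rightarrow> ('c, 'r) ring_scheme \<Rightarrow> ('g \<Rightarrow> 'g \<Rightarrow> 'c) \<Rightarrow> bool" where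
  "normalised_2cocycle G k \<mu> \<longleftrightarrow>
     (\<forall>g\<in>carrier G. \<forall>h\<in>carrier G. \<mu> g h \<in> Units k) \<and>
     (\<forall>g\<in>carrier G. \<forall>h\<in>carrier G. \<forall>l\<in>carrier G.
        \<mu> g h \<otimes>\<^bsub>k\<^esub> \<mu> (g \<otimes>\<^bsub>G\<^esub> h) l = \<mu> g (h \<otimes>\<^bsub>G\<^esub> l) \<otimes>\<^bsub>k\<^esub> \<mu> h l) \<and>
     (\<forall>g\<in>carrier G. \<mu> \<one>\<^bsub>G\<^esub> g = \<one>\<^bsub>k\<^esub> \<and> \<mu> g \<one>\<^bsub>G\<^esub> = \<one>\<^bsub>k\<^esub>)"


section \<open>The induced grading and the cocycle twist\<close>

definition graded_part ::
    "('c, 'a) module \<Rightarrow> ('g, 'x) monoid_scheme \<Rightarrow> ('g \<Rightarrow> 'a \<Rightarrow> 'a) \<Rightarrow>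
      ('g \<Rightarrow> 'g \<Rightarrow> 'c) \<Rightarrow> 'g \<Rightarrow> 'a set" where
  "graded_part A G \<phi> \<chi> g =
     {a \<in> carrier A. \<forall>h\<in>carrier G. \<phi> h a = \<chi> (inv\<^bsub>G\<^esub> g) h \<odot>\<^bsub>A\<^esub> a}"

text \<open>The family of homogeneous components of \<open>a\<close>. It is well defined when \<open>A\<close> is the direct
  sum of its graded parts, which holds if the base field is algebraically closed of
  characteristic not dividing the order of \<open>G\<close>.\<close>

definition components ::
    "('c, 'a) module \<Rightarrow> ('g, 'x) monoid_scheme \<Rightarrow> ('g \<Rightarrow> 'a \<Rightarrow> 'a) \<Rightarrow>
      ('g \<Rightarrow> 'g \<Rightarrow> 'c) \<Rightarrow> 'a \<Rightarrow> 'g \<Rightarrow> 'a" where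
  "components A G \<phi> \<chi> a = (THE c. c \<in> (\<Pi>\<^sub>E g\<in>carrier G. graded_part A G \<phi> \<chi> g) \<and>
     (\<Oplus>\<^bsub>A\<^esub>g\<in>carrier G. c g) = a)"

text \<open>The bilinear extension of \<open>a * b = \<mu> g h (a b)\<close> for \<open>a\<close> of degree \<open>g\<close> and
  \<open>b\<close> of degree \<open>h\<close>.\<close>

definition cocycle_twist ::
    "('c, 'a) module \<Rightarrow> ('g, 'x) monoid_scheme \<Rightarrow> ('g \<Rightarrow> 'a \<Rightarrow> 'a) \<Rightarrow>
      ('g \<Rightarrow> 'g \<Rightarrow> 'c) \<Rightarrow> ('g \<Rightarrow> 'g \<Rightarrow> 'c) \<Rightarrow> ('c, 'a) module" where
  "cocycle_twist A G \<phi> \<chi> \<mu> = A\<lparr>monoid.mult := (\<lambda>a b.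
     \<Oplus>\<^bsub>A\<^esub>g\<in>carrier G. \<Oplus>\<^bsub>A\<^esub>h\<in>carrier G.
       \<mu> g h \<odot>\<^bsub>A\<^esub> (components A G \<phi> \<chi> a g \<otimes>\<^bsub>A\<^esub> components A G \<phi> \<chi> b h))\<rparr>"

end

theory Submission
  imports Defs
begin

text \<open>Let \<open>B\<close> be the twist of \<open>A\<close>. For an \<open>A\<close>-module \<open>M\<close> let \<open>F M\<close> be the \<open>B\<close>-module of
  functions \<open>G \<rightarrow> M\<close> on which \<open>a \<in> A\<^sub>g\<close> sends \<open>m\<close> in position \<open>h\<close> to \<open>\<mu> g h (a m)\<close> in position \<open>g h\<close>,
  and define \<open>F'\<close> from \<open>B\<close>-modules to \<open>A\<close>-modules in the same way with the inverse cocycle. Both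
  functors are exact and each is left and right adjoint to the other, so both preserve projective
  modules and covers; moreover \<open>M\<close> is a direct summand of \<open>F' (F M)\<close> because \<open>|G|\<close> is invertible.
  By Schanuel's lemma an \<open>n\<close>-th syzygy of \<open>M\<close> is therefore projective whenever \<open>F M\<close> has
  projective dimension at most \<open>n\<close>, and the situation is symmetric in \<open>A\<close> and \<open>B\<close>.

  These constructions stay inside an infinite universe \<open>'m\<close> because \<open>G\<close> is finite. A finite
  universe contains only zero modules, since \<open>k\<close> is infinite.\<close>

section \<open>Stable retracts and syzygies\<close>

text \<open>The categories of \<open>A\<close>-modules and \<open>B\<close>-modules need not be
  equivalent: in characteristic different from 2, a suitable cocycle turns the group algebra of the
  Klein four-group, a product of four copies of \<open>k\<close>, into the 2 by 2 matrices over
  \<open>k\<close>. This is why \<open>M\<close> is recovered only as a summand. The splitting comes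
  from having both adjunctions: the unit of one followed by the counit of the other is
  multiplication by |G|.

  A second obstacle is that a universe \<open>'m\<close> need not be large enough to contain free
  modules, so covers cannot simply be constructed. But an inequality between the two dimensions is
  only in question when its right-hand side is finite. The resolutions that witness this finiteness
  supply a projective module onto every module over that ring, and the adjunction carries these
  surjections to the other ring.

  Covers found in this way bear no relation to those occurring in a given resolution. The induction
  on syzygies therefore has to tolerate a change of cover, that is, it works up to retracts and
  projective summands.\<close>

lemma module_homs_iff:
  "f \<in> module_homs R M N \<longleftrightarrow> (\<forall>x\<in>carrier M. f x \<in> carrier N) \<and>
     (\<forall>x\<in>carrier M. \<forall>y\<in>carrier M. f (x \<oplus>\<^bsub>M\<^esub> y) = f x \<oplus>\<^bsub>N\<^esub> f y) \<and>
     (\<forall>a\<in>carrier R. \<forall>x\<in>carrier M. f (a \<odot>\<^bsub>M\<^esub> x) = a \<odot>\<^bsub>N\<^esub> f x)"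
  by (auto simp: module_homs_def hom_def)

lemma module_homs_closed: "f \<in> module_homs R M N \<Longrightarrow> x \<in> carrier M \<Longrightarrow> f x \<in> carrier N"
  and module_homs_add: "f \<in> module_homs R M N \<Longrightarrow> x \<in> carrier M \<Longrightarrow> y \<in> carrier M \<Longrightarrow>
    f (x \<oplus>\<^bsub>M\<^esub> y) = f x \<oplus>\<^bsub>N\<^esub> f y"
  and module_homs_smult: "f \<in> module_homs R M N \<Longrightarrow> a \<in> carrier R \<Longrightarrow> x \<in> carrier M \<Longrightarrow>
    f (a \<odot>\<^bsub>M\<^esub> x) = a \<odot>\<^bsub>N\<^esub> f x"
  by (auto simp: module_homs_iff)

lemma module_homs_zero:
  assumes "left_module R M" "left_module R N" "f \<in> module_homs R M N"
  shows "f \<zero>\<^bsub>M\<^esub> = \<zero>\<^bsub>N\<^esub>"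
proof -
  interpret M: left_module R M by fact
  interpret N: left_module R N by fact
  have "f \<zero>\<^bsub>M\<^esub> \<oplus>\<^bsub>N\<^esub> f \<zero>\<^bsub>M\<^esub> = f \<zero>\<^bsub>M\<^esub> \<oplus>\<^bsub>N\<^esub> \<zero>\<^bsub>N\<^esub>"
    using module_homs_add[OF assms(3), of "\<zero>\<^bsub>M\<^esub>" "\<zero>\<^bsub>M\<^esub>"] module_homs_closed[OF assms(3)] by simp
  then show ?thesis
    using module_homs_closed[OF assms(3)] N.M.add.l_cancel by (meson M.M.zero_closed N.M.zero_closed)
qed

lemma additive_finsum:
  assumes "abelian_group M" "abelian_group N" "f \<in> hom (add_monoid M) (add_monoid N)"
    "finite I" "\<And>i. i \<in> I \<Longrightarrow> x i \<in> carrier M"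
  shows "f (finsum M x I) = finsum N (\<lambda>i. f (x i)) I"
proof -
  interpret M: abelian_group M by fact
  interpret N: abelian_group N by fact
  interpret group_hom "add_monoid M" "add_monoid N" f
    by (intro group_hom.intro group_hom_axioms.intro M.a_group N.a_group assms(3))
  have cl: "f y \<in> carrier N" if "y \<in> carrier M" for y using that hom_closed by simp
  show ?thesis using assms(4,5)
  proof (induction I)
    case empty
    then show ?case using hom_one by simp
  next
    case (insert i I)
    then have "finsum M x (insert i I) = x i \<oplus>\<^bsub>M\<^esub> finsum M x I"
      by (subst M.finsum_insert) auto
    moreover have "finsum M x I \<in> carrier M" using insert by (intro M.finsum_closed) auto
    moreover have "finsum N (\<lambda>i. f (x i)) (insert i I) = f (x i) \<oplus>\<^bsub>N\<^esub> finsum N (\<lambda>i. f (x i)) I"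
      using insert by (subst N.finsum_insert) (auto intro: cl)
    ultimately show ?case using insert hom_mult by simp
  qed
qed

lemma module_homs_finsum:
  assumes "left_module R M" "left_module R N" "f \<in> module_homs R M N"
    "finite I" "\<And>i. i \<in> I \<Longrightarrow> x i \<in> carrier M"
  shows "f (finsum M x I) = finsum N (\<lambda>i. f (x i)) I"
  using assms by (intro additive_finsum) (auto simp: module_homs_def left_module_def)

lemma module_homs_compose:
  "f \<in> module_homs R L M \<Longrightarrow> g \<in> module_homs R M N \<Longrightarrow> (\<lambda>x. g (f x)) \<in> module_homs R L N"
  by (auto simp: module_homs_iff)

lemma module_homs_plus:
  assumes "left_module R N" "f \<in> module_homs R M N" "g \<in> module_homs R M N"
  shows "(\<lambda>x. f x \<oplus>\<^bsub>N\<^esub> g x) \<in> module_homs R M N"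
proof -
  interpret N: left_module R N by fact
  show ?thesis using assms(2,3)
    by (auto simp: module_homs_iff N.smult_r_distr N.M.a_ac)
qed

lemma left_module_smult_zero:
  assumes "left_module R M" "a \<in> carrier R"
  shows "a \<odot>\<^bsub>M\<^esub> \<zero>\<^bsub>M\<^esub> = \<zero>\<^bsub>M\<^esub>"
proof -
  interpret M: left_module R M by fact
  have "(a \<odot>\<^bsub>M\<^esub> \<zero>\<^bsub>M\<^esub>) \<oplus>\<^bsub>M\<^esub> (a \<odot>\<^bsub>M\<^esub> \<zero>\<^bsub>M\<^esub>) = (a \<odot>\<^bsub>M\<^esub> \<zero>\<^bsub>M\<^esub>) \<oplus>\<^bsub>M\<^esub> \<zero>\<^bsub>M\<^esub>"
    using assms(2) by (simp add: M.smult_closed flip: M.smult_r_distr)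
  then show ?thesis using assms(2)
    by (meson M.M.add.l_cancel M.M.zero_closed M.smult_closed)
qed

lemma module_homs_minus:
  assumes "left_module R N" "f \<in> module_homs R M N"
  shows "(\<lambda>x. \<ominus>\<^bsub>N\<^esub> f x) \<in> module_homs R M N"
proof -
  interpret N: left_module R N by fact
  have "\<ominus>\<^bsub>N\<^esub> (a \<odot>\<^bsub>N\<^esub> y) = a \<odot>\<^bsub>N\<^esub> (\<ominus>\<^bsub>N\<^esub> y)" if "a \<in> carrier R" "y \<in> carrier N" for a y
  proof (rule N.M.minus_equality)
    show "(a \<odot>\<^bsub>N\<^esub> (\<ominus>\<^bsub>N\<^esub> y)) \<oplus>\<^bsub>N\<^esub> (a \<odot>\<^bsub>N\<^esub> y) = \<zero>\<^bsub>N\<^esub>"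
      using that N.M.l_neg by (simp add: left_module_smult_zero[OF assms(1)] flip: N.smult_r_distr)
  qed (use that N.smult_closed in auto)
  then show ?thesis using assms(2)
    by (auto simp: module_homs_iff N.M.minus_add)
qed

lemma module_homs_id: "(\<lambda>x. x) \<in> module_homs R M M"
  by (auto simp: module_homs_iff)

lemma projective_lift:
  fixes P L N :: "('a, 'm) module"
  assumes "projective_module R P" "left_module R L" "left_module R N" "f \<in> module_homs R L N"
    "f ` carrier L = carrier N" "g \<in> module_homs R P N"
  obtains h where "h \<in> module_homs R P L"
    "\<And>p. p \<in> carrier P \<Longrightarrow> f (h p) = g p"
  using assms unfolding projective_module_def by blast

section \<open>Kernels, the building blocks of syzygies\<close>

definition kernel_module :: "('a, 'm) module \<Rightarrow> ('a, 'n) module \<Rightarrow> ('m \<Rightarrow> 'n) \<Rightarrow> ('a, 'm) module" where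
  "kernel_module M N f = M\<lparr>carrier := a_kernel M N f\<rparr>"

lemma kernel_module_simps [simp]:
  "carrier (kernel_module M N f) = {x \<in> carrier M. f x = \<zero>\<^bsub>N\<^esub>}"
  "\<zero>\<^bsub>kernel_module M N f\<^esub> = \<zero>\<^bsub>M\<^esub>"
  "x \<oplus>\<^bsub>kernel_module M N f\<^esub> y = x \<oplus>\<^bsub>M\<^esub> y"
  "a \<odot>\<^bsub>kernel_module M N f\<^esub> x = a \<odot>\<^bsub>M\<^esub> x"
  by (auto simp: kernel_module_def a_kernel_def')

lemma left_module_kernel:
  assumes "left_module R M" "left_module R N" "f \<in> module_homs R M N"
  shows "left_module R (kernel_module M N f)"
proof -
  interpret M: left_module R M by fact
  interpret N: left_module R N by fact
  note zero = module_homs_zero[OF assms]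
  show ?thesis
  proof (intro left_module.intro left_module_axioms.intro abelian_groupI)
    fix x assume "x \<in> carrier (kernel_module M N f)"
    then have x: "x \<in> carrier M" "f x = \<zero>\<^bsub>N\<^esub>" by auto
    then have "f (\<ominus>\<^bsub>M\<^esub> x) = \<zero>\<^bsub>N\<^esub>"
      using module_homs_add[OF assms(3), of "\<ominus>\<^bsub>M\<^esub> x" x] module_homs_closed[OF assms(3), of "\<ominus>\<^bsub>M\<^esub> x"]
      by (simp add: M.M.l_neg zero)
    then show "\<exists>y\<in>carrier (kernel_module M N f). y \<oplus>\<^bsub>kernel_module M N f\<^esub> x = \<zero>\<^bsub>kernel_module M N f\<^esub>"
      using x by (auto intro!: bexI[of _ "\<ominus>\<^bsub>M\<^esub> x"] simp: M.M.l_neg)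
  qed (use assms in \<open>auto simp: module_homs_iff zero M.M.a_ac M.smult_closed M.smult_r_distr
      M.smult_l_distr M.smult_assoc1 M.smult_one left_module_smult_zero[OF assms(2)]
      intro: M.R.ring_axioms\<close>)
qed

lemma module_homs_kernel_incl: "(\<lambda>x. x) \<in> module_homs R (kernel_module M N f) M"
  by (auto simp: module_homs_iff)

lemma module_homs_from_kernel:
  "g \<in> module_homs R M L \<Longrightarrow> g \<in> module_homs R (kernel_module M N f) L"
  by (auto simp: module_homs_iff)

lemma module_homs_into_kernel:
  "g \<in> module_homs R L (kernel_module M N f) \<longleftrightarrow>
     g \<in> module_homs R L M \<and> (\<forall>x\<in>carrier L. f (g x) = \<zero>\<^bsub>N\<^esub>)"
  by (auto simp: module_homs_iff)

text \<open>\<open>N\<close> is a retract of the direct sum of \<open>M\<close> and a projective module; spelling out the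
  components avoids forming direct sums inside the universe.\<close>

definition stable_retract :: "('a, 'r) ring_scheme \<Rightarrow> ('a, 'm) module \<Rightarrow> ('a, 'm) module \<Rightarrow> bool" where
  "stable_retract R N M \<longleftrightarrow> (\<exists>(Q :: ('a, 'm) module) i r u v. projective_module R Q \<and>
     i \<in> module_homs R N M \<and> r \<in> module_homs R M N \<and>
     u \<in> module_homs R N Q \<and> v \<in> module_homs R Q N \<and>
     (\<forall>x\<in>carrier N. r (i x) \<oplus>\<^bsub>N\<^esub> v (u x) = x))"

text \<open>The two parts of the decomposition are lifted separately: \<open>a\<close> lifts
  \<open>g\<close> after \<open>r\<close>, \<open>b\<close> lifts \<open>g\<close> after
  \<open>v\<close>, and the sum of \<open>a\<close> after \<open>i\<close> and \<open>b\<close>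
  after \<open>u\<close> lifts \<open>g\<close> because the two round trips add up to the
  identity.\<close>

lemma projective_stable_retract:
  fixes M :: "('a, 'm) module"
  assumes "stable_retract R N M" "projective_module R M" "left_module R N"
  shows "projective_module R N"
  unfolding projective_module_def
proof (intro conjI allI impI)
  fix L N' :: "('a, 'm) module" and f g
  assume "left_module R L \<and> left_module R N' \<and> f \<in> module_homs R L N' \<and>
    f ` carrier L = carrier N' \<and> g \<in> module_homs R N N'"
  then have L: "left_module R L" and N': "left_module R N'" and f: "f \<in> module_homs R L N'"
    "f ` carrier L = carrier N'" and g: "g \<in> module_homs R N N'" by auto
  obtain Q :: "('a, 'm) module" and i r u v where Q: "projective_module R Q"
    and h: "i \<in> module_homs R N M" "r \<in> module_homs R M N" "u \<in> module_homs R N Q" "v \<in> module_homs R Q N"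
    and id: "\<And>x. x \<in> carrier N \<Longrightarrow> r (i x) \<oplus>\<^bsub>N\<^esub> v (u x) = x"
    using assms(1) unfolding stable_retract_def by blast
  obtain a where a: "a \<in> module_homs R M L" "\<And>p. p \<in> carrier M \<Longrightarrow> f (a p) = g (r p)"
    using projective_lift[OF assms(2) L N' f module_homs_compose[OF h(2) g]] by blast
  obtain b where b: "b \<in> module_homs R Q L" "\<And>p. p \<in> carrier Q \<Longrightarrow> f (b p) = g (v p)"
    using projective_lift[OF Q L N' f module_homs_compose[OF h(4) g]] by blast
  show "\<exists>h\<in>module_homs R N L. \<forall>p\<in>carrier N. f (h p) = g p"
  proof (intro bexI ballI)
    show "(\<lambda>x. a (i x) \<oplus>\<^bsub>L\<^esub> b (u x)) \<in> module_homs R N L"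
      by (intro module_homs_plus L module_homs_compose[OF h(1) a(1)] module_homs_compose[OF h(3) b(1)])
    fix p assume p: "p \<in> carrier N"
    note cl = module_homs_closed[OF h(1)] module_homs_closed[OF h(2)] module_homs_closed[OF h(3)]
      module_homs_closed[OF h(4)] module_homs_closed[OF a(1)] module_homs_closed[OF b(1)]
    have "f (a (i p) \<oplus>\<^bsub>L\<^esub> b (u p)) = g (r (i p)) \<oplus>\<^bsub>N'\<^esub> g (v (u p))"
      using p by (simp add: module_homs_add[OF f(1)] cl a(2) b(2))
    also have "\<dots> = g p" using p cl id by (simp flip: module_homs_add[OF g])
    finally show "f (a (i p) \<oplus>\<^bsub>L\<^esub> b (u p)) = g p" .
  qed
qed (fact assms(3))

text \<open>The zero object is built on the zero of a given module. It serves as the trivial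
  projective summand in \<open>stable_retract_refl\<close> and as the tail of a finite
  resolution.\<close>

lemma zero_module:
  fixes M :: "('a, 'm) module"
  assumes "left_module R M"
  shows "projective_module R (M\<lparr>carrier := {\<zero>\<^bsub>M\<^esub>}\<rparr>)"
proof -
  interpret M: left_module R M by fact
  let ?Z = "M\<lparr>carrier := {\<zero>\<^bsub>M\<^esub>}\<rparr>"
  have l: "left_module R ?Z"
    by (intro left_module.intro left_module_axioms.intro abelian_groupI M.R.ring_axioms)
      (auto simp: left_module_smult_zero[OF assms] M.smult_one)
  show ?thesis unfolding projective_module_def
  proof (intro conjI allI impI l)
    fix L N :: "('a, 'm) module" and f g
    assume *: "left_module R L \<and> left_module R N \<and> f \<in> module_homs R L N \<and>
      f ` carrier L = carrier N \<and> g \<in> module_homs R ?Z N"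
    then interpret L: left_module R L by blast
    have "(\<lambda>_. \<zero>\<^bsub>L\<^esub>) \<in> module_homs R ?Z L"
      using * by (auto simp: module_homs_iff left_module_smult_zero)
    moreover have "f \<zero>\<^bsub>L\<^esub> = g \<zero>\<^bsub>M\<^esub>"
      using * l module_homs_zero[of R L N f] module_homs_zero[of R ?Z N g] by auto
    ultimately show "\<exists>h\<in>module_homs R ?Z L. \<forall>p\<in>carrier ?Z. f (h p) = g p"
      by auto
  qed
qed

lemma stable_retract_refl:
  assumes "left_module R M"
  shows "stable_retract R M M"
proof -
  interpret M: left_module R M by fact
  let ?Z = "M\<lparr>carrier := {\<zero>\<^bsub>M\<^esub>}\<rparr>"
  have "(\<lambda>_. \<zero>\<^bsub>M\<^esub>) \<in> module_homs R M ?Z" "(\<lambda>_. \<zero>\<^bsub>M\<^esub>) \<in> module_homs R ?Z M"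
    by (auto simp: module_homs_iff left_module_smult_zero[OF assms])
  then show ?thesis unfolding stable_retract_def
    by (intro exI[of _ ?Z] exI[of _ "\<lambda>x. x"] exI[of _ "\<lambda>_. \<zero>\<^bsub>M\<^esub>"])
      (auto simp: zero_module[OF assms] module_homs_id)
qed

text \<open>Needed for modules that agree elementwise without being equal as records, such as the
  kernel of an induced map and the module induced from a kernel.\<close>

lemma stable_retract_iso:
  fixes N N' M :: "('a, 'm) module"
  assumes "(\<lambda>x. x) \<in> module_homs R N' N" "(\<lambda>x. x) \<in> module_homs R N N'" "stable_retract R N M"
  shows "stable_retract R N' M"
proof -
  obtain Q :: "('a, 'm) module" and i r u v where Q: "projective_module R Q"
    and h: "i \<in> module_homs R N M" "r \<in> module_homs R M N" "u \<in> module_homs R N Q" "v \<in> module_homs R Q N"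
    and id: "\<And>x. x \<in> carrier N \<Longrightarrow> r (i x) \<oplus>\<^bsub>N\<^esub> v (u x) = x"
    using assms(3) unfolding stable_retract_def by blast
  have "r (i x) \<oplus>\<^bsub>N'\<^esub> v (u x) = x" if "x \<in> carrier N'" for x
    using module_homs_add[OF assms(2), of "r (i x)" "v (u x)"] id[of x] module_homs_closed[OF assms(1) that]
      module_homs_closed[OF h(1)] module_homs_closed[OF h(2)] module_homs_closed[OF h(3)] module_homs_closed[OF h(4)]
    by simp
  then show ?thesis unfolding stable_retract_def
    using Q module_homs_compose[OF assms(1) h(1)] module_homs_compose[OF h(2) assms(2)]
      module_homs_compose[OF assms(1) h(3)] module_homs_compose[OF h(4) assms(2)] by blast
qed

text \<open>Just a surjection from a projective module; the minimality that the usual term carries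
  is not meant.\<close>

definition projective_cover :: "('a, 'r) ring_scheme \<Rightarrow> ('a, 'm) module \<Rightarrow> ('a, 'm) module \<Rightarrow> ('m \<Rightarrow> 'm) \<Rightarrow> bool" where
  "projective_cover R P M p \<longleftrightarrow> projective_module R P \<and> p \<in> module_homs R P M \<and> p ` carrier P = carrier M"

text \<open>A version of Schanuel's lemma: with \<open>i\<close>, \<open>r\<close>, \<open>v\<close> lifted to the covers, the identity of
  \<open>ker q\<close> is \<open>r' i' + w\<close> where \<open>w = id - r' i' - v' u q\<close> is defined on the projective module \<open>Q\<close>.\<close>

lemma stable_retract_kernel:
  fixes M N P Q :: "('a, 'm) module"
  assumes "stable_retract R N M" "left_module R M" "left_module R N"
    "projective_cover R P M p" "projective_cover R Q N q"
  shows "stable_retract R (kernel_module Q N q) (kernel_module P M p)"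
proof -
  obtain Q0 :: "('a, 'm) module" and i r u v where Q0: "projective_module R Q0"
    and h: "i \<in> module_homs R N M" "r \<in> module_homs R M N" "u \<in> module_homs R N Q0" "v \<in> module_homs R Q0 N"
    and id: "\<And>x. x \<in> carrier N \<Longrightarrow> r (i x) \<oplus>\<^bsub>N\<^esub> v (u x) = x"
    using assms(1) unfolding stable_retract_def by blast
  have P: "projective_module R P" "p \<in> module_homs R P M" "p ` carrier P = carrier M"
    using assms(4) unfolding projective_cover_def by auto
  have Q: "projective_module R Q" "q \<in> module_homs R Q N" "q ` carrier Q = carrier N"
    using assms(5) unfolding projective_cover_def by auto
  have lP: "left_module R P" and lQ: "left_module R Q" and lQ0: "left_module R Q0"
    using P(1) Q(1) Q0 unfolding projective_module_def by blast+
  interpret N: left_module R N by fact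
  interpret M: left_module R M by fact
  interpret Q: left_module R Q by fact
  obtain i' where i': "i' \<in> module_homs R Q P" "\<And>x. x \<in> carrier Q \<Longrightarrow> p (i' x) = i (q x)"
    using projective_lift[OF Q(1) lP assms(2) P(2,3) module_homs_compose[OF Q(2) h(1)]] by blast
  obtain r' where r': "r' \<in> module_homs R P Q" "\<And>x. x \<in> carrier P \<Longrightarrow> q (r' x) = r (p x)"
    using projective_lift[OF P(1) lQ assms(3) Q(2,3) module_homs_compose[OF P(2) h(2)]] by blast
  obtain v' where v': "v' \<in> module_homs R Q0 Q" "\<And>x. x \<in> carrier Q0 \<Longrightarrow> q (v' x) = v x"
    using projective_lift[OF Q0 lQ assms(3) Q(2,3) h(4)] by blast
  define w0 where "w0 = (\<lambda>x. r' (i' x) \<oplus>\<^bsub>Q\<^esub> v' (u (q x)))"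
  define w where "w = (\<lambda>x. x \<oplus>\<^bsub>Q\<^esub> \<ominus>\<^bsub>Q\<^esub> w0 x)"
  note cl = module_homs_closed[OF h(1)] module_homs_closed[OF h(2)] module_homs_closed[OF h(3)]
    module_homs_closed[OF h(4)] module_homs_closed[OF i'(1)] module_homs_closed[OF r'(1)]
    module_homs_closed[OF v'(1)] module_homs_closed[OF P(2)] module_homs_closed[OF Q(2)]
  have w0: "w0 \<in> module_homs R Q Q" unfolding w0_def
    by (intro module_homs_plus lQ module_homs_compose[OF i'(1) r'(1)]
        module_homs_compose[OF module_homs_compose[OF Q(2) h(3)] v'(1)])
  \<comment> \<open>By the choice of the lifts, \<open>q\<close> after \<open>w0\<close> is
    \<open>r i q + v u q\<close>, which is \<open>q\<close>. Hence the complement \<open>w\<close>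
    takes values in the kernel of \<open>q\<close>.\<close>
  have qw0: "q (w0 x) = q x" if "x \<in> carrier Q" for x
    using that cl id unfolding w0_def
    by (simp add: module_homs_add[OF Q(2)] r'(2) i'(2) v'(2))
  have w: "w \<in> module_homs R Q Q" unfolding w_def
    by (intro module_homs_plus lQ module_homs_id module_homs_minus w0)
  have ww0: "w x \<oplus>\<^bsub>Q\<^esub> w0 x = x" if "x \<in> carrier Q" for x
    using that module_homs_closed[OF w0] unfolding w_def
    by (simp add: Q.M.a_assoc Q.M.l_neg)
  have qw: "q (w x) = \<zero>\<^bsub>N\<^esub>" if x: "x \<in> carrier Q" for x
  proof -
    have "q (w x) \<oplus>\<^bsub>N\<^esub> q x = \<zero>\<^bsub>N\<^esub> \<oplus>\<^bsub>N\<^esub> q x"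
      using ww0[OF x] qw0[OF x] x module_homs_add[OF Q(2), of "w x" "w0 x"]
        module_homs_closed[OF w] module_homs_closed[OF w0] cl by simp
    then show ?thesis using x module_homs_closed[OF w] cl
      by (meson N.M.add.r_cancel N.M.zero_closed)
  qed
  let ?K = "kernel_module Q N q" and ?L = "kernel_module P M p"
  have "i' \<in> module_homs R ?K ?L" "r' \<in> module_homs R ?L ?K"
    using module_homs_zero[OF assms(3,2) h(1)] module_homs_zero[OF assms(2,3) h(2)]
    by (auto simp: module_homs_into_kernel i'(2) r'(2) intro: module_homs_from_kernel i'(1) r'(1))
  moreover have "w \<in> module_homs R Q ?K" using qw w by (simp add: module_homs_into_kernel)
  moreover have "r' (i' x) \<oplus>\<^bsub>?K\<^esub> w x = x" if "x \<in> carrier ?K" for x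
  proof -
    have x: "x \<in> carrier Q" "q x = \<zero>\<^bsub>N\<^esub>" using that by auto
    \<comment> \<open>On the kernel of \<open>q\<close> the summand of \<open>w0\<close> that passes
      through \<open>Q0\<close> vanishes. The projective companion of the new retract is
      \<open>Q\<close>, with the inclusion of the kernel and \<open>w\<close> as its two
      maps.\<close>
    have "w0 x = r' (i' x)" unfolding w0_def using x cl
      by (simp add: module_homs_zero[OF assms(3) lQ0 h(3)] module_homs_zero[OF lQ0 lQ v'(1)])
    then show ?thesis using ww0[OF x(1)] x cl module_homs_closed[OF w] by (simp add: Q.M.a_comm)
  qed
  ultimately show ?thesis unfolding stable_retract_def
    using Q(1) module_homs_kernel_incl by blast
qed

section \<open>Projective dimension through iterated kernels of covers\<close>

primrec pd_le :: "('a, 'r) ring_scheme \<Rightarrow> nat \<Rightarrow> ('a, 'm) module \<Rightarrow> bool" where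
  "pd_le R 0 M \<longleftrightarrow> projective_module R M"
| "pd_le R (Suc n) M \<longleftrightarrow> left_module R M \<and>
     (\<exists>P p. projective_cover R P M p \<and> pd_le R n (kernel_module P M p))"

lemma projective_resolution_shift:
  assumes "projective_resolution R M P d \<epsilon>" "left_module R M"
  shows "projective_resolution R (kernel_module (P 0) M \<epsilon>) (\<lambda>i. P (Suc i)) (\<lambda>i. d (Suc i)) (d 0)"
proof -
  have l: "left_module R (P i)" for i
    using assms(1) unfolding projective_resolution_def projective_module_def by blast
  have d: "d 0 ` carrier (P (Suc 0)) = {x \<in> carrier (P 0). \<epsilon> x = \<zero>\<^bsub>M\<^esub>}"
    using assms(1) unfolding projective_resolution_def a_kernel_def' by auto
  then show ?thesis
    using assms(1) unfolding projective_resolution_def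
    by (auto simp: module_homs_into_kernel a_kernel_def')
qed

text \<open>In the base case all terms from \<open>P 1\<close> on vanish, so exactness makes
  \<epsilon> injective, and its inverse exhibits \<open>M\<close> as a retract of
  \<open>P 0\<close>. In the induction step the kernel of \<epsilon> is resolved by the shifted
  sequence, whose terms vanish one index earlier.\<close>

lemma pd_le_if_resolution:
  assumes "projective_resolution R M P d \<epsilon>" "left_module R M" "\<And>i. i > n \<Longrightarrow> carrier (P i) = {\<zero>\<^bsub>P i\<^esub>}"
  shows "pd_le R n M"
  using assms
proof (induction n arbitrary: M P d \<epsilon>)
  case 0
  have P: "projective_module R (P 0)" "left_module R (P 0)" "left_module R (P 1)"
    "d 0 \<in> module_homs R (P 1) (P 0)"
    "\<epsilon> \<in> module_homs R (P 0) M" "\<epsilon> ` carrier (P 0) = carrier M"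
    "{x \<in> carrier (P 0). \<epsilon> x = \<zero>\<^bsub>M\<^esub>} = d 0 ` carrier (P 1)"
    using 0(1) unfolding projective_resolution_def projective_module_def a_kernel_def' by auto
  have "d 0 ` carrier (P 1) = {\<zero>\<^bsub>P 0\<^esub>}"
    using 0(3)[of 1] module_homs_zero[OF P(3,2,4)] by simp
  then have ker: "x = \<zero>\<^bsub>P 0\<^esub>" if "x \<in> carrier (P 0)" "\<epsilon> x = \<zero>\<^bsub>M\<^esub>" for x
    using P(7) that by auto
  interpret P0: left_module R "P 0" by (rule P(2))
  interpret M: left_module R M by (rule 0(2))
  have inj: "inj_on \<epsilon> (carrier (P 0))"
  proof (rule inj_onI)
    fix x y assume xy: "x \<in> carrier (P 0)" "y \<in> carrier (P 0)" "\<epsilon> x = \<epsilon> y"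
    have "\<epsilon> (x \<oplus>\<^bsub>P 0\<^esub> \<ominus>\<^bsub>P 0\<^esub> y) = \<epsilon> (y \<oplus>\<^bsub>P 0\<^esub> \<ominus>\<^bsub>P 0\<^esub> y)"
      using xy by (simp add: module_homs_add[OF P(5)])
    also have "\<dots> = \<zero>\<^bsub>M\<^esub>" using xy by (simp add: P0.M.r_neg module_homs_zero[OF P(2) 0(2) P(5)])
    finally have "x \<oplus>\<^bsub>P 0\<^esub> \<ominus>\<^bsub>P 0\<^esub> y = \<zero>\<^bsub>P 0\<^esub>" using xy by (intro ker) auto
    then show "x = y" using xy P0.M.minus_equality[of x "\<ominus>\<^bsub>P 0\<^esub> y"] by simp
  qed
  let ?j = "inv_into (carrier (P 0)) \<epsilon>"
  have j: "?j x \<in> carrier (P 0)" "\<epsilon> (?j x) = x" if "x \<in> carrier M" for x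
    using that P(6) by (auto intro: inv_into_into f_inv_into_f)
  have eq: "?j (\<epsilon> x) = x" if "x \<in> carrier (P 0)" for x
    using that inj by simp
  have "?j \<in> module_homs R M (P 0)"
    unfolding module_homs_iff
  proof (intro conjI ballI)
    fix x y assume "x \<in> carrier M" "y \<in> carrier M"
    then show "?j (x \<oplus>\<^bsub>M\<^esub> y) = ?j x \<oplus>\<^bsub>P 0\<^esub> ?j y"
      using j eq[of "?j x \<oplus>\<^bsub>P 0\<^esub> ?j y"] by (simp add: module_homs_add[OF P(5)])
  next
    fix a x assume "a \<in> carrier R" "x \<in> carrier M"
    then show "?j (a \<odot>\<^bsub>M\<^esub> x) = a \<odot>\<^bsub>P 0\<^esub> ?j x"
      using j eq[of "a \<odot>\<^bsub>P 0\<^esub> ?j x"] by (simp add: module_homs_smult[OF P(5)] P0.smult_closed)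
  qed (use j in auto)
  moreover have "(\<lambda>x. \<zero>\<^bsub>M\<^esub>) \<in> module_homs R (P 0) M"
    by (auto simp: module_homs_iff left_module_smult_zero[OF 0(2)])
  ultimately have "stable_retract R M (P 0)"
    unfolding stable_retract_def
    by (intro exI[of _ "P 0"] exI[of _ ?j] exI[of _ \<epsilon>] exI[of _ "\<lambda>x. \<zero>\<^bsub>M\<^esub>"])
      (use P j in auto)
  then show ?case using P(1) 0(2) by (auto intro: projective_stable_retract)
next
  case (Suc n)
  have P: "projective_cover R (P 0) M \<epsilon>"
    using Suc.prems(1) unfolding projective_resolution_def projective_cover_def by auto
  have "left_module R (kernel_module (P 0) M \<epsilon>)"
    using P Suc.prems(2) by (auto intro!: left_module_kernel simp: projective_cover_def projective_module_def)
  from Suc.IH[OF projective_resolution_shift[OF Suc.prems(1,2)] this]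
  have "pd_le R n (kernel_module (P 0) M \<epsilon>)" using Suc.prems(3) by auto
  then show ?case using P Suc.prems(2) by auto
qed

text \<open>The base case is \<open>M\<close> itself followed by zero modules. In the step the cover
  \<open>P\<close> is spliced in front: the augmentation onto the kernel, followed by the inclusion,
  becomes the differential of index 0, and all others move up by one.\<close>

lemma resolution_if_pd_le:
  assumes "pd_le R n M"
  obtains P d \<epsilon> where "projective_resolution R M P d \<epsilon>" "\<And>i. i > n \<Longrightarrow> carrier (P i) = {\<zero>\<^bsub>P i\<^esub>}"
  using assms
proof (induction n arbitrary: M thesis)
  case 0
  then have M: "left_module R M" "projective_module R M" by (auto simp: projective_module_def)
  interpret M: left_module R M by (rule M(1))
  let ?Z = "M\<lparr>carrier := {\<zero>\<^bsub>M\<^esub>}\<rparr>"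
  have "projective_resolution R M (\<lambda>i. if i = 0 then M else ?Z) (\<lambda>i x. \<zero>\<^bsub>M\<^esub>) (\<lambda>x. x)"
    using M zero_module[OF M(1)] unfolding projective_resolution_def
    by (auto simp: module_homs_iff a_kernel_def' left_module_smult_zero)
  then show ?case using "0.prems"(1) by fastforce
next
  case (Suc n)
  then obtain P p where P: "projective_cover R P M p" "pd_le R n (kernel_module P M p)" and M: "left_module R M"
    by auto
  obtain P' d \<epsilon> where P': "projective_resolution R (kernel_module P M p) P' d \<epsilon>"
    "\<And>i. i > n \<Longrightarrow> carrier (P' i) = {\<zero>\<^bsub>P' i\<^esub>}"
    using Suc.IH[OF _ P(2)] by blast
  have "projective_resolution R M (case_nat P P') (case_nat \<epsilon> d) p"
    unfolding projective_resolution_def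
  proof (intro conjI allI)
    fix i
    show "a_kernel (case_nat P P' (Suc i)) (case_nat P P' i) (case_nat \<epsilon> d i) =
         case_nat \<epsilon> d (Suc i) ` carrier (case_nat P P' (Suc (Suc i)))"
      using P' unfolding projective_resolution_def
      by (cases i) (auto simp: a_kernel_def')
    show "case_nat \<epsilon> d i \<in> module_homs R (case_nat P P' (Suc i)) (case_nat P P' i)"
      using P' unfolding projective_resolution_def
      by (cases i) (auto simp: module_homs_into_kernel)
    show "projective_module R (case_nat P P' i)"
      using P P' unfolding projective_resolution_def projective_cover_def by (cases i) auto
  next
    show "a_kernel (case_nat P P' 0) M p = case_nat \<epsilon> d 0 ` carrier (case_nat P P' 1)"
      using P' unfolding projective_resolution_def by (auto simp: a_kernel_def')
  qed (use P in \<open>auto simp: projective_cover_def\<close>)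
  moreover have "carrier (case_nat P P' i) = {\<zero>\<^bsub>case_nat P P' i\<^esub>}" if "i > Suc n" for i
    using that P'(2) by (cases i) auto
  ultimately show ?case using Suc.prems(1) by blast
qed

lemma proj_dim_le_iff:
  assumes "left_module R M"
  shows "proj_dim R M \<le> enat n \<longleftrightarrow> pd_le R n M"
proof
  assume "proj_dim R M \<le> enat n"
  \<comment> \<open>A strict bound on an infimum yields a member of the set below the bound, that
    is, an actual resolution of length at most \<open>n\<close>.\<close>
  then have "proj_dim R M < enat (Suc n)" by (meson enat_ord_simps(2) lessI order_le_less_trans)
  then obtain m P d \<epsilon> where "m < Suc n" "projective_resolution R M P d \<epsilon>"
    "\<forall>i>m. carrier (P i) = {\<zero>\<^bsub>P i\<^esub>}"
    unfolding proj_dim_def INF_less_iff by auto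
  then show "pd_le R n M" using pd_le_if_resolution[OF _ assms] by auto
next
  assume "pd_le R n M"
  then show "proj_dim R M \<le> enat n"
    unfolding proj_dim_def by (elim resolution_if_pd_le) (auto intro: INF_lower)
qed

lemma lgldim_le_iff:
  "lgldim TYPE('m) R \<le> enat n \<longleftrightarrow> (\<forall>M :: ('a, 'm) module. left_module R M \<longrightarrow> pd_le R n M)"
  for R :: "('a, 'r) ring_scheme"
  by (auto simp: lgldim_def SUP_le_iff proj_dim_le_iff)

lemma lgldim_eq_0:
  fixes R :: "('a, 'r) ring_scheme"
  assumes "\<And>M :: ('a, 'm) module. left_module R M \<Longrightarrow> carrier M = {\<zero>\<^bsub>M\<^esub>}"
  shows "lgldim TYPE('m) R = 0"
proof -
  have "pd_le R 0 M" if "left_module R M" for M :: "('a, 'm) module"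
  proof -
    have "M\<lparr>carrier := {\<zero>\<^bsub>M\<^esub>}\<rparr> = M" using assms[OF that] by simp
    then show ?thesis using zero_module[OF that] by simp
  qed
  then have "lgldim TYPE('m) R \<le> enat 0" unfolding lgldim_le_iff by blast
  then show ?thesis by (simp add: enat_0)
qed

section \<open>Twists of graded rings\<close>

text \<open>The grading is recorded by its component maps rather than by subgroups, because the
  action on induced modules is written with components. The same maps also grade the twist and the
  opposite rings.\<close>

locale graded_ring = R: ring R + G: comm_group G
  for R :: "('a, 'r) ring_scheme" and G :: "('g, 'x) monoid_scheme" (structure) +
  fixes \<pi> :: "'g \<Rightarrow> 'a \<Rightarrow> 'a"
  assumes finite_G: "finite (carrier G)"
    and comp_closed: "\<lbrakk>g \<in> carrier G; a \<in> carrier R\<rbrakk> \<Longrightarrow> \<pi> g a \<in> carrier R"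
    and comp_add: "\<lbrakk>g \<in> carrier G; a \<in> carrier R; b \<in> carrier R\<rbrakk> \<Longrightarrow> \<pi> g (a \<oplus>\<^bsub>R\<^esub> b) = \<pi> g a \<oplus>\<^bsub>R\<^esub> \<pi> g b"
    and comp_sum: "a \<in> carrier R \<Longrightarrow> (\<Oplus>\<^bsub>R\<^esub>g\<in>carrier G. \<pi> g a) = a"
    and comp_comp: "\<lbrakk>g \<in> carrier G; h \<in> carrier G; a \<in> carrier R\<rbrakk> \<Longrightarrow>
      \<pi> g (\<pi> h a) = (if g = h then \<pi> g a else \<zero>\<^bsub>R\<^esub>)"
    and comp_one: "\<pi> \<one> \<one>\<^bsub>R\<^esub> = \<one>\<^bsub>R\<^esub>"
    and comp_mult: "\<lbrakk>g \<in> carrier G; h \<in> carrier G; a \<in> carrier R; b \<in> carrier R; \<pi> g a = a; \<pi> h b = b\<rbrakk> \<Longrightarrow>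
      \<pi> (g \<otimes> h) (a \<otimes>\<^bsub>R\<^esub> b) = a \<otimes>\<^bsub>R\<^esub> b"
begin

definition part :: "'g \<Rightarrow> 'a set" where "part g = {a \<in> carrier R. \<pi> g a = a}"

lemma part_carrier: "a \<in> part g \<Longrightarrow> a \<in> carrier R" and part_comp: "a \<in> part g \<Longrightarrow> \<pi> g a = a"
  by (auto simp: part_def)

lemma comp_in_part: "g \<in> carrier G \<Longrightarrow> a \<in> carrier R \<Longrightarrow> \<pi> g a \<in> part g"
  by (simp add: part_def comp_closed comp_comp)

lemma comp_part: "a \<in> part h \<Longrightarrow> g \<in> carrier G \<Longrightarrow> h \<in> carrier G \<Longrightarrow> \<pi> g a = (if g = h then a else \<zero>\<^bsub>R\<^esub>)"
  using comp_comp[of g h a] by (auto simp: part_def)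

lemma one_part: "\<one>\<^bsub>R\<^esub> \<in> part \<one>"
  by (simp add: part_def comp_one)

lemma part_mult: "\<lbrakk>g \<in> carrier G; h \<in> carrier G; a \<in> part g; b \<in> part h\<rbrakk> \<Longrightarrow> a \<otimes>\<^bsub>R\<^esub> b \<in> part (g \<otimes> h)"
  by (simp add: part_def comp_mult)

text \<open>An element is the sum of its components, so an additive map is determined on homogeneous
  elements. Associativity and linearity below are reduced in this way to fixed degrees, where the
  twist is a single scalar.\<close>

lemma additive_eqI:
  assumes "abelian_group M" "f \<in> hom (add_monoid R) (add_monoid M)" "f' \<in> hom (add_monoid R) (add_monoid M)"
    "\<And>g a. g \<in> carrier G \<Longrightarrow> a \<in> part g \<Longrightarrow> f a = f' a" "a \<in> carrier R"
  shows "f a = f' a"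
proof -
  interpret M: abelian_group M by fact
  have f: "f a = (\<Oplus>\<^bsub>M\<^esub>g\<in>carrier G. f (\<pi> g a))" if "f \<in> hom (add_monoid R) (add_monoid M)" for f
    using additive_finsum[OF R.is_abelian_group assms(1) that finite_G, of "\<lambda>g. \<pi> g a"]
    by (simp add: comp_sum assms(5) comp_closed)
  have "f' (\<pi> g a) \<in> carrier M" if "g \<in> carrier G" for g
    using assms(3) comp_closed[OF that assms(5)] by (auto simp: hom_def)
  then show ?thesis unfolding f[OF assms(2)] f[OF assms(3)]
    using assms(4) comp_in_part[OF _ assms(5)] by (intro M.finsum_cong') auto
qed

end

text \<open>The base field has disappeared: the values of the cocycle and of its inverse are central
  elements \<open>u\<close> and \<open>v\<close> of trivial degree, and \<open>w\<close> stands for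
  1/|G|. What remains is symmetric in the two rings up to exchanging \<open>u\<close> and
  \<open>v\<close>.\<close>

locale twist_pair = graded_ring R G \<pi> + S: ring S
  for R :: "('a, 'r) ring_scheme" and S :: "('a, 's) ring_scheme" and G :: "('g, 'x) monoid_scheme" (structure)
    and \<pi> :: "'g \<Rightarrow> 'a \<Rightarrow> 'a" +
  fixes u v :: "'g \<Rightarrow> 'g \<Rightarrow> 'a" and w :: 'a
  assumes carrier_eq: "carrier S = carrier R"
    and add_eq: "x \<oplus>\<^bsub>S\<^esub> y = x \<oplus>\<^bsub>R\<^esub> y"
    and zero_eq: "\<zero>\<^bsub>S\<^esub> = \<zero>\<^bsub>R\<^esub>"
    and one_eq: "\<one>\<^bsub>S\<^esub> = \<one>\<^bsub>R\<^esub>"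
    and u_closed: "\<lbrakk>g \<in> carrier G; h \<in> carrier G\<rbrakk> \<Longrightarrow> u g h \<in> carrier R"
    and v_closed: "\<lbrakk>g \<in> carrier G; h \<in> carrier G\<rbrakk> \<Longrightarrow> v g h \<in> carrier R"
    and u_deg: "\<lbrakk>g \<in> carrier G; h \<in> carrier G\<rbrakk> \<Longrightarrow> \<pi> \<one> (u g h) = u g h"
    and v_deg: "\<lbrakk>g \<in> carrier G; h \<in> carrier G\<rbrakk> \<Longrightarrow> \<pi> \<one> (v g h) = v g h"
    and u_v: "\<lbrakk>g \<in> carrier G; h \<in> carrier G\<rbrakk> \<Longrightarrow> u g h \<otimes>\<^bsub>R\<^esub> v g h = \<one>\<^bsub>R\<^esub>"
    and u_central: "\<lbrakk>g \<in> carrier G; h \<in> carrier G; a \<in> carrier R\<rbrakk> \<Longrightarrow> u g h \<otimes>\<^bsub>R\<^esub> a = a \<otimes>\<^bsub>R\<^esub> u g h"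
    and twist: "\<lbrakk>g \<in> carrier G; h \<in> carrier G; a \<in> carrier R; b \<in> carrier R; \<pi> g a = a; \<pi> h b = b\<rbrakk> \<Longrightarrow>
      a \<otimes>\<^bsub>S\<^esub> b = u g h \<otimes>\<^bsub>R\<^esub> (a \<otimes>\<^bsub>R\<^esub> b)"
    and u_cocycle: "\<lbrakk>g \<in> carrier G; h \<in> carrier G; l \<in> carrier G\<rbrakk> \<Longrightarrow>
      u g h \<otimes>\<^bsub>R\<^esub> u (g \<otimes> h) l = u g (h \<otimes> l) \<otimes>\<^bsub>R\<^esub> u h l"
    and u_one: "g \<in> carrier G \<Longrightarrow> u \<one> g = \<one>\<^bsub>R\<^esub>" "g \<in> carrier G \<Longrightarrow> u g \<one> = \<one>\<^bsub>R\<^esub>"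
    and w_closed: "w \<in> carrier R" and w_deg: "\<pi> \<one> w = w"
    and w_central: "a \<in> carrier R \<Longrightarrow> w \<otimes>\<^bsub>R\<^esub> a = a \<otimes>\<^bsub>R\<^esub> w"
    and w_sum: "(\<Oplus>\<^bsub>R\<^esub>g\<in>carrier G. w) = \<one>\<^bsub>R\<^esub>"
begin

lemma finsum_eq: "finsum S = finsum R"
proof -
  have "ring.add S = ring.add R" "ring.zero S = ring.zero R" by (auto simp: fun_eq_iff add_eq zero_eq)
  then show ?thesis by (intro ext) (simp add: finsum_def finprod_def carrier_eq)
qed

lemma u_part: "\<lbrakk>g \<in> carrier G; h \<in> carrier G\<rbrakk> \<Longrightarrow> u g h \<in> part \<one>"
  and v_part: "\<lbrakk>g \<in> carrier G; h \<in> carrier G\<rbrakk> \<Longrightarrow> v g h \<in> part \<one>"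
  and w_part: "w \<in> part \<one>"
  by (auto simp: part_def u_closed u_deg v_closed v_deg w_closed w_deg)

lemma twist_part: "\<lbrakk>g \<in> carrier G; h \<in> carrier G; a \<in> part g; b \<in> part h\<rbrakk> \<Longrightarrow>
    a \<otimes>\<^bsub>S\<^esub> b = u g h \<otimes>\<^bsub>R\<^esub> (a \<otimes>\<^bsub>R\<^esub> b)"
  by (simp add: part_def twist)

lemma v_u: "\<lbrakk>g \<in> carrier G; h \<in> carrier G\<rbrakk> \<Longrightarrow> v g h \<otimes>\<^bsub>R\<^esub> u g h = \<one>\<^bsub>R\<^esub>"
  using u_v u_central v_closed by metis

lemma v_central:
  assumes "g \<in> carrier G" "h \<in> carrier G" "a \<in> carrier R"
  shows "v g h \<otimes>\<^bsub>R\<^esub> a = a \<otimes>\<^bsub>R\<^esub> v g h"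
proof -
  note cl = assms u_closed[OF assms(1,2)] v_closed[OF assms(1,2)]
  have "v g h \<otimes>\<^bsub>R\<^esub> a = v g h \<otimes>\<^bsub>R\<^esub> (a \<otimes>\<^bsub>R\<^esub> u g h) \<otimes>\<^bsub>R\<^esub> v g h"
    using cl by (simp add: R.m_assoc u_v)
  also have "\<dots> = v g h \<otimes>\<^bsub>R\<^esub> (u g h \<otimes>\<^bsub>R\<^esub> a) \<otimes>\<^bsub>R\<^esub> v g h"
    using cl by (simp add: u_central)
  also have "\<dots> = (v g h \<otimes>\<^bsub>R\<^esub> u g h) \<otimes>\<^bsub>R\<^esub> a \<otimes>\<^bsub>R\<^esub> v g h"
    using cl R.m_assoc by simp
  finally show ?thesis using cl by (simp add: v_u)
qed

text \<open>Normalisation of the cocycle makes products with an element of trivial degree the same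
  in both rings. Relations among \<open>u\<close>, \<open>v\<close> and \<open>w\<close> can thus be
  moved between \<open>R\<close> and \<open>S\<close>.\<close>

lemma twist_one_left:
  assumes "b \<in> part \<one>" "a \<in> carrier R"
  shows "b \<otimes>\<^bsub>S\<^esub> a = b \<otimes>\<^bsub>R\<^esub> a"
  using S.is_abelian_group
proof (rule additive_eqI[where f = "\<lambda>a. b \<otimes>\<^bsub>S\<^esub> a" and f' = "\<lambda>a. b \<otimes>\<^bsub>R\<^esub> a"])
  show "(\<lambda>a. b \<otimes>\<^bsub>S\<^esub> a) \<in> hom (add_monoid R) (add_monoid S)"
    using assms(1) by (auto simp: hom_def part_carrier S.r_distr[unfolded carrier_eq add_eq] add_eq
      intro: S.m_closed[unfolded carrier_eq] simp: carrier_eq)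
  show "(\<lambda>a. b \<otimes>\<^bsub>R\<^esub> a) \<in> hom (add_monoid R) (add_monoid S)"
    using assms(1) by (auto simp: hom_def part_carrier add_eq carrier_eq R.r_distr)
  fix g c assume "g \<in> carrier G" "c \<in> part g"
  then show "b \<otimes>\<^bsub>S\<^esub> c = b \<otimes>\<^bsub>R\<^esub> c"
    using assms(1) twist_part[of \<one> g b c] by (simp add: u_one part_carrier)
qed (fact assms(2))

lemma twist_one_right:
  assumes "b \<in> part \<one>" "a \<in> carrier R"
  shows "a \<otimes>\<^bsub>S\<^esub> b = a \<otimes>\<^bsub>R\<^esub> b"
  using S.is_abelian_group
proof (rule additive_eqI[where f = "\<lambda>a. a \<otimes>\<^bsub>S\<^esub> b" and f' = "\<lambda>a. a \<otimes>\<^bsub>R\<^esub> b"])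
  show "(\<lambda>a. a \<otimes>\<^bsub>S\<^esub> b) \<in> hom (add_monoid R) (add_monoid S)"
    using assms(1) by (auto simp: hom_def part_carrier S.l_distr[unfolded carrier_eq add_eq] add_eq
      intro: S.m_closed[unfolded carrier_eq] simp: carrier_eq)
  show "(\<lambda>a. a \<otimes>\<^bsub>R\<^esub> b) \<in> hom (add_monoid R) (add_monoid S)"
    using assms(1) by (auto simp: hom_def part_carrier add_eq carrier_eq R.l_distr)
  fix g c assume "g \<in> carrier G" "c \<in> part g"
  then show "c \<otimes>\<^bsub>S\<^esub> b = c \<otimes>\<^bsub>R\<^esub> b"
    using assms(1) twist_part[of g \<one> c b] by (simp add: u_one part_carrier)
qed (fact assms(2))

lemma v_one: "g \<in> carrier G \<Longrightarrow> v \<one> g = \<one>\<^bsub>R\<^esub>" "g \<in> carrier G \<Longrightarrow> v g \<one> = \<one>\<^bsub>R\<^esub>"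
  using u_v[of \<one> g] u_v[of g \<one>] by (simp_all add: u_one v_closed)

text \<open>Both sides invert the same element: one side inverts the left of
  \<open>u_cocycle\<close>, the other its right. Centrality provides the two-sided inverse that
  uniqueness asks for.\<close>

lemma v_cocycle:
  assumes "g \<in> carrier G" "h \<in> carrier G" "l \<in> carrier G"
  shows "v g h \<otimes>\<^bsub>R\<^esub> v (g \<otimes> h) l = v g (h \<otimes> l) \<otimes>\<^bsub>R\<^esub> v h l"
proof (rule R.inv_unique)
  let ?x = "u g h \<otimes>\<^bsub>R\<^esub> u (g \<otimes> h) l"
  have inv: "(v a b \<otimes>\<^bsub>R\<^esub> v c d) \<otimes>\<^bsub>R\<^esub> (u a b \<otimes>\<^bsub>R\<^esub> u c d) = \<one>\<^bsub>R\<^esub>"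
    if "a \<in> carrier G" "b \<in> carrier G" "c \<in> carrier G" "d \<in> carrier G" for a b c d
  proof -
    note cl = that u_closed v_closed
    have "(v a b \<otimes>\<^bsub>R\<^esub> v c d) \<otimes>\<^bsub>R\<^esub> (u a b \<otimes>\<^bsub>R\<^esub> u c d) = v a b \<otimes>\<^bsub>R\<^esub> (v c d \<otimes>\<^bsub>R\<^esub> u a b) \<otimes>\<^bsub>R\<^esub> u c d"
      using cl by (simp add: R.m_assoc)
    also have "v c d \<otimes>\<^bsub>R\<^esub> u a b = u a b \<otimes>\<^bsub>R\<^esub> v c d"
      using cl by (simp add: v_central)
    also have "v a b \<otimes>\<^bsub>R\<^esub> (u a b \<otimes>\<^bsub>R\<^esub> v c d) \<otimes>\<^bsub>R\<^esub> u c d = (v a b \<otimes>\<^bsub>R\<^esub> u a b) \<otimes>\<^bsub>R\<^esub> (v c d \<otimes>\<^bsub>R\<^esub> u c d)"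
      using cl R.m_assoc by simp
    finally show ?thesis using cl by (simp add: v_u)
  qed
  show "(v g h \<otimes>\<^bsub>R\<^esub> v (g \<otimes> h) l) \<otimes>\<^bsub>R\<^esub> ?x = \<one>\<^bsub>R\<^esub>" using assms by (intro inv) auto
  have comm: "x \<otimes>\<^bsub>R\<^esub> (v a b \<otimes>\<^bsub>R\<^esub> v c d) = (v a b \<otimes>\<^bsub>R\<^esub> v c d) \<otimes>\<^bsub>R\<^esub> x"
    if "a \<in> carrier G" "b \<in> carrier G" "c \<in> carrier G" "d \<in> carrier G" "x \<in> carrier R" for a b c d x
  proof -
    have "x \<otimes>\<^bsub>R\<^esub> (v a b \<otimes>\<^bsub>R\<^esub> v c d) = (v a b \<otimes>\<^bsub>R\<^esub> x) \<otimes>\<^bsub>R\<^esub> v c d"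
      using that v_central[of a b x] by (simp add: v_closed R.m_assoc[symmetric])
    also have "\<dots> = v a b \<otimes>\<^bsub>R\<^esub> (v c d \<otimes>\<^bsub>R\<^esub> x)"
      using that v_central[of c d x] by (simp add: v_closed R.m_assoc)
    finally show ?thesis using that by (simp add: v_closed R.m_assoc)
  qed
  have "?x \<otimes>\<^bsub>R\<^esub> (v g (h \<otimes> l) \<otimes>\<^bsub>R\<^esub> v h l) = (v g (h \<otimes> l) \<otimes>\<^bsub>R\<^esub> v h l) \<otimes>\<^bsub>R\<^esub> ?x"
    using assms by (intro comm) (auto simp: u_closed)
  also have "\<dots> = \<one>\<^bsub>R\<^esub>" unfolding u_cocycle[OF assms] using assms by (intro inv) auto
  finally show "?x \<otimes>\<^bsub>R\<^esub> (v g (h \<otimes> l) \<otimes>\<^bsub>R\<^esub> v h l) = \<one>\<^bsub>R\<^esub>" .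
qed (use assms u_closed v_closed in auto)

text \<open>Twisting \<open>S\<close> by the inverse cocycle gives back \<open>R\<close>. From here
  on a statement proved in one direction is available in the other.\<close>

lemma twist_pair_swap: "twist_pair S R G \<pi> v u w"
proof unfold_locales
  fix g h a b assume *: "g \<in> carrier G" "h \<in> carrier G" "a \<in> carrier S" "b \<in> carrier S" "\<pi> g a = a" "\<pi> h b = b"
  then have p: "a \<in> part g" "b \<in> part h" by (auto simp: part_def carrier_eq)
  have ab: "a \<otimes>\<^bsub>S\<^esub> b = u g h \<otimes>\<^bsub>R\<^esub> (a \<otimes>\<^bsub>R\<^esub> b)" using * p by (simp add: twist_part)
  have "a \<otimes>\<^bsub>S\<^esub> b \<in> part (\<one> \<otimes> (g \<otimes> h))" unfolding ab using * p
    by (intro part_mult u_part) auto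
  then show "\<pi> (g \<otimes> h) (a \<otimes>\<^bsub>S\<^esub> b) = a \<otimes>\<^bsub>S\<^esub> b" using * by (simp add: part_def)
  have "v g h \<otimes>\<^bsub>S\<^esub> (a \<otimes>\<^bsub>S\<^esub> b) = v g h \<otimes>\<^bsub>R\<^esub> (u g h \<otimes>\<^bsub>R\<^esub> (a \<otimes>\<^bsub>R\<^esub> b))"
    using * p by (simp add: ab twist_one_left v_part part_carrier u_closed)
  also have "\<dots> = a \<otimes>\<^bsub>R\<^esub> b"
    using * p by (simp add: part_carrier u_closed v_closed v_u flip: R.m_assoc)
  finally show "a \<otimes>\<^bsub>R\<^esub> b = v g h \<otimes>\<^bsub>S\<^esub> (a \<otimes>\<^bsub>S\<^esub> b)" ..
next
  fix g h a assume "g \<in> carrier G" "h \<in> carrier G" "a \<in> carrier S"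
  then show "v g h \<otimes>\<^bsub>S\<^esub> a = a \<otimes>\<^bsub>S\<^esub> v g h"
    using v_central by (simp add: carrier_eq twist_one_left twist_one_right v_part)
next
  fix a assume "a \<in> carrier S"
  then show "w \<otimes>\<^bsub>S\<^esub> a = a \<otimes>\<^bsub>S\<^esub> w"
    using w_central by (simp add: carrier_eq twist_one_left twist_one_right w_part)
next
  fix g h assume "g \<in> carrier G" "h \<in> carrier G"
  then show "v g h \<otimes>\<^bsub>S\<^esub> u g h = \<one>\<^bsub>S\<^esub>"
    by (simp add: twist_one_left v_part u_closed v_u one_eq)
next
  fix g h l assume "g \<in> carrier G" "h \<in> carrier G" "l \<in> carrier G"
  then show "v g h \<otimes>\<^bsub>S\<^esub> v (g \<otimes> h) l = v g (h \<otimes> l) \<otimes>\<^bsub>S\<^esub> v h l"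
    by (simp add: twist_one_left v_part v_closed v_cocycle)
qed (simp_all only: carrier_eq add_eq zero_eq one_eq finsum_eq finite_G, (rule comp_closed comp_add comp_sum
    comp_comp comp_one u_closed v_closed u_deg v_deg w_closed w_deg w_sum v_one; assumption)+)

end

section \<open>Opposite rings, for the right-hand dimension\<close>

lemma opposite_ring_simps [simp]:
  "carrier (opposite_ring R) = carrier R" "\<zero>\<^bsub>opposite_ring R\<^esub> = \<zero>\<^bsub>R\<^esub>"
  "\<one>\<^bsub>opposite_ring R\<^esub> = \<one>\<^bsub>R\<^esub>" "x \<oplus>\<^bsub>opposite_ring R\<^esub> y = x \<oplus>\<^bsub>R\<^esub> y"
  "x \<otimes>\<^bsub>opposite_ring R\<^esub> y = y \<otimes>\<^bsub>R\<^esub> x" "finsum (opposite_ring R) = finsum R"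
  by (auto simp: opposite_ring_def finsum_def finprod_def fun_eq_iff)

lemma ring_opposite: "ring (opposite_ring R)" if "ring R"
proof -
  interpret R: ring R by fact
  show ?thesis
  proof (intro ringI abelian_groupI monoidI)
    fix x assume "x \<in> carrier (opposite_ring R)"
    then show "\<exists>y\<in>carrier (opposite_ring R). y \<oplus>\<^bsub>opposite_ring R\<^esub> x = \<zero>\<^bsub>opposite_ring R\<^esub>"
      using R.l_neg by (auto intro!: bexI[of _ "\<ominus>\<^bsub>R\<^esub> x"])
  qed (auto simp: R.a_ac R.l_distr R.r_distr R.m_assoc)
qed

text \<open>In the opposite ring a product of degrees \<open>g\<close> and \<open>h\<close> is the
  original product of degrees \<open>h\<close> and \<open>g\<close>, hence the transposed cocycle.
  Since \<open>G\<close> is commutative, degrees still multiply correctly and the transpose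
  satisfies the cocycle identity.\<close>

lemma (in twist_pair) twist_pair_opposite:
  "twist_pair (opposite_ring R) (opposite_ring S) G \<pi> (\<lambda>g h. u h g) (\<lambda>g h. v h g) w"
proof -
  interpret R': ring "opposite_ring R" by (rule ring_opposite) unfold_locales
  interpret S': ring "opposite_ring S" by (rule ring_opposite) unfold_locales
  show ?thesis
  proof unfold_locales
    fix g h a b assume *: "g \<in> carrier G" "h \<in> carrier G" "a \<in> carrier (opposite_ring R)"
      "b \<in> carrier (opposite_ring R)" "\<pi> g a = a" "\<pi> h b = b"
    then show "\<pi> (g \<otimes> h) (a \<otimes>\<^bsub>opposite_ring R\<^esub> b) = a \<otimes>\<^bsub>opposite_ring R\<^esub> b"
      using comp_mult[of h g b a] by (simp add: G.m_comm)
    show "a \<otimes>\<^bsub>opposite_ring S\<^esub> b = u h g \<otimes>\<^bsub>opposite_ring R\<^esub> (a \<otimes>\<^bsub>opposite_ring R\<^esub> b)"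
      using * by (simp add: twist[of h g b a] u_central)
  next
    fix g h l assume "g \<in> carrier G" "h \<in> carrier G" "l \<in> carrier G"
    then show "u h g \<otimes>\<^bsub>opposite_ring R\<^esub> u l (g \<otimes> h) = u (h \<otimes> l) g \<otimes>\<^bsub>opposite_ring R\<^esub> u l h"
      using u_cocycle[of l h g] by (simp add: G.m_comm)
  qed (use finite_G in \<open>auto simp: carrier_eq add_eq zero_eq one_eq comp_closed comp_add comp_sum comp_comp
    comp_one u_closed v_closed u_deg v_deg w_closed w_deg u_v w_central u_central[symmetric] w_sum u_one\<close>)
qed

text \<open>This is \<open>M\<close> tensored with the twisted group algebra of the cocycle, pulled
  back along the ring map sending \<open>a\<close> of degree \<open>g\<close> to \<open>a\<close>
  tensor \<open>g\<close>. Position \<open>l\<close> collects, for every degree \<open>g\<close>,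
  what the component of that degree moves there from position \<open>inv g\<close> times
  \<open>l\<close>. Elements are codes, so the result is a module in the same universe.\<close>

definition induced :: "('g, 'x) monoid_scheme \<Rightarrow> ('g \<Rightarrow> 'a \<Rightarrow> 'a) \<Rightarrow> ('g \<Rightarrow> 'g \<Rightarrow> 'a) \<Rightarrow>
    ('m \<Rightarrow> 'g \<Rightarrow> 'm) \<Rightarrow> (('g \<Rightarrow> 'm) \<Rightarrow> 'm) \<Rightarrow> ('a, 'm) module \<Rightarrow> ('a, 'm) module" where
  "induced G \<pi> u dec enc M = \<lparr>carrier = {x. \<forall>g\<in>carrier G. dec x g \<in> carrier M},
     monoid.mult = undefined, monoid.one = undefined,
     ring.zero = enc (\<lambda>_. \<zero>\<^bsub>M\<^esub>), ring.add = (\<lambda>x y. enc (\<lambda>g. dec x g \<oplus>\<^bsub>M\<^esub> dec y g)),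
     smult = (\<lambda>a x. enc (\<lambda>l. \<Oplus>\<^bsub>M\<^esub>g\<in>carrier G.
       u g (inv\<^bsub>G\<^esub> g \<otimes>\<^bsub>G\<^esub> l) \<odot>\<^bsub>M\<^esub> (\<pi> g a \<odot>\<^bsub>M\<^esub> dec x (inv\<^bsub>G\<^esub> g \<otimes>\<^bsub>G\<^esub> l))))\<rparr>"

section \<open>Induced modules\<close>

text \<open>\<open>dec\<close> and \<open>enc\<close> identify the universe \<open>'m\<close> with the functions \<open>G \<rightarrow> 'm\<close>.\<close>

locale coded_twist_pair = twist_pair R S G \<pi> u v w
  for R :: "('a, 'r) ring_scheme" and S :: "('a, 's) ring_scheme" and G :: "('g, 'x) monoid_scheme" (structure)
    and \<pi> :: "'g \<Rightarrow> 'a \<Rightarrow> 'a" and u v :: "'g \<Rightarrow> 'g \<Rightarrow> 'a" and w :: 'a +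
  fixes dec :: "'m \<Rightarrow> 'g \<Rightarrow> 'm" and enc :: "('g \<Rightarrow> 'm) \<Rightarrow> 'm"
  assumes dec_enc [simp]: "g \<in> carrier G \<Longrightarrow> dec (enc f) g = f g"
    and dec_inject: "(\<And>g. g \<in> carrier G \<Longrightarrow> dec x g = dec y g) \<Longrightarrow> x = y"
begin

abbreviation "ind \<equiv> induced G \<pi> u dec enc"
abbreviation "ind' \<equiv> induced G \<pi> v dec enc"

lemma coded_swap: "coded_twist_pair S R G \<pi> v u w dec enc"
  using twist_pair_swap dec_inject by (auto simp: coded_twist_pair_def coded_twist_pair_axioms_def)

lemma ind_carrier [simp]: "x \<in> carrier (ind M) \<longleftrightarrow> (\<forall>g\<in>carrier G. dec x g \<in> carrier M)"
  by (simp add: induced_def)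

lemma dec_zero [simp]: "g \<in> carrier G \<Longrightarrow> dec \<zero>\<^bsub>ind M\<^esub> g = \<zero>\<^bsub>M\<^esub>"
  and dec_add [simp]: "g \<in> carrier G \<Longrightarrow> dec (x \<oplus>\<^bsub>ind M\<^esub> y) g = dec x g \<oplus>\<^bsub>M\<^esub> dec y g"
  and dec_smult: "l \<in> carrier G \<Longrightarrow> dec (a \<odot>\<^bsub>ind M\<^esub> x) l =
    (\<Oplus>\<^bsub>M\<^esub>g\<in>carrier G. u g (inv g \<otimes> l) \<odot>\<^bsub>M\<^esub> (\<pi> g a \<odot>\<^bsub>M\<^esub> dec x (inv g \<otimes> l)))"
  by (auto simp: induced_def)

text \<open>A homogeneous element of degree \<open>g\<close> moves position \<open>h\<close> to
  position \<open>g\<close> times \<open>h\<close>, so equations about its action are best compared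
  at positions of that form.\<close>

lemma dec_inject': "g \<in> carrier G \<Longrightarrow> (\<And>h. h \<in> carrier G \<Longrightarrow> dec x (g \<otimes> h) = dec y (g \<otimes> h)) \<Longrightarrow> x = y"
proof (rule dec_inject)
  fix l assume "g \<in> carrier G" "\<And>h. h \<in> carrier G \<Longrightarrow> dec x (g \<otimes> h) = dec y (g \<otimes> h)" "l \<in> carrier G"
  moreover have "g \<otimes> (inv g \<otimes> l) = l" if "g \<in> carrier G" "l \<in> carrier G"
    using that by (simp flip: G.m_assoc)
  ultimately show "dec x l = dec y l" by (metis G.inv_closed G.m_closed)
qed

lemma left_module_zero_smult:
  assumes "left_module R M" "x \<in> carrier M"
  shows "\<zero>\<^bsub>R\<^esub> \<odot>\<^bsub>M\<^esub> x = \<zero>\<^bsub>M\<^esub>"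
proof -
  interpret M: left_module R M by fact
  have "(\<zero>\<^bsub>R\<^esub> \<odot>\<^bsub>M\<^esub> x) \<oplus>\<^bsub>M\<^esub> (\<zero>\<^bsub>R\<^esub> \<odot>\<^bsub>M\<^esub> x) = (\<zero>\<^bsub>R\<^esub> \<odot>\<^bsub>M\<^esub> x) \<oplus>\<^bsub>M\<^esub> \<zero>\<^bsub>M\<^esub>"
    using assms(2) by (simp add: M.smult_closed flip: M.smult_l_distr)
  then show ?thesis using assms(2)
    by (meson M.M.add.l_cancel M.M.zero_closed M.smult_closed R.zero_closed)
qed

text \<open>Only the summand indexed by the degree of \<open>a\<close> survives. The sum over all
  degrees is needed to make the action total and additive; computations use this formula
  instead.\<close>

lemma dec_smult_part:
  assumes M: "left_module R M" and x: "x \<in> carrier (ind M)" and a: "g \<in> carrier G" "a \<in> part g" and h: "h \<in> carrier G"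
  shows "dec (a \<odot>\<^bsub>ind M\<^esub> x) (g \<otimes> h) = u g h \<odot>\<^bsub>M\<^esub> (a \<odot>\<^bsub>M\<^esub> dec x h)"
proof -
  interpret M: left_module R M by fact
  let ?f = "\<lambda>s. u s (inv s \<otimes> (g \<otimes> h)) \<odot>\<^bsub>M\<^esub> (\<pi> s a \<odot>\<^bsub>M\<^esub> dec x (inv s \<otimes> (g \<otimes> h)))"
  have aR: "a \<in> carrier R" using a(2) by (rule part_carrier)
  have cl: "?f s \<in> carrier M" if "s \<in> carrier G" for s
    using that x a(1) h comp_closed[OF that aR] by (auto intro!: M.smult_closed u_closed)
  have "?f s = \<zero>\<^bsub>M\<^esub>" if "s \<in> carrier G" "s \<noteq> g" for s
    using that a h x u_closed by (simp add: comp_part left_module_zero_smult[OF M] left_module_smult_zero[OF M])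
  then have "dec (a \<odot>\<^bsub>ind M\<^esub> x) (g \<otimes> h) = (\<Oplus>\<^bsub>M\<^esub>s\<in>carrier G. if g = s then ?f s else \<zero>\<^bsub>M\<^esub>)"
    unfolding dec_smult[OF G.m_closed[OF a(1) h]] using cl by (intro M.M.finsum_cong') auto
  also have "\<dots> = ?f g" using cl finite_G a(1) by (intro M.M.finsum_singleton) auto
  also have "inv g \<otimes> (g \<otimes> h) = h" using a(1) h by (simp flip: G.m_assoc)
  finally show ?thesis using a by (simp add: comp_part)
qed

lemma abelian_group_ind:
  assumes M: "left_module R M"
  shows "abelian_group (ind M)"
proof -
  interpret M: left_module R M by fact
  show ?thesis
  proof (intro abelian_groupI)
    fix x assume x: "x \<in> carrier (ind M)"
    have "enc (\<lambda>g. \<ominus>\<^bsub>M\<^esub> dec x g) \<oplus>\<^bsub>ind M\<^esub> x = \<zero>\<^bsub>ind M\<^esub>"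
      by (rule dec_inject) (use x in \<open>auto simp: M.M.l_neg\<close>)
    then show "\<exists>y\<in>carrier (ind M). y \<oplus>\<^bsub>ind M\<^esub> x = \<zero>\<^bsub>ind M\<^esub>"
      using x by (intro bexI[of _ "enc (\<lambda>g. \<ominus>\<^bsub>M\<^esub> dec x g)"]) auto
  qed (auto simp: M.M.a_ac intro: dec_inject[of "_ \<oplus>\<^bsub>ind M\<^esub> _"])
qed

text \<open>Both sides are additive in \<open>b\<close> and in \<open>a\<close>, so
  \<open>additive_eqI\<close> is applied in one argument after the other.\<close>

lemma left_module_homogeneous_assoc:
  assumes M: "abelian_group M" and cl: "\<And>a x. a \<in> carrier R \<Longrightarrow> x \<in> carrier M \<Longrightarrow> a \<odot>\<^bsub>M\<^esub> x \<in> carrier M"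
    and l: "\<And>a b x. a \<in> carrier R \<Longrightarrow> b \<in> carrier R \<Longrightarrow> x \<in> carrier M \<Longrightarrow>
      (a \<oplus>\<^bsub>R\<^esub> b) \<odot>\<^bsub>M\<^esub> x = a \<odot>\<^bsub>M\<^esub> x \<oplus>\<^bsub>M\<^esub> b \<odot>\<^bsub>M\<^esub> x"
    and r: "\<And>a x y. a \<in> carrier R \<Longrightarrow> x \<in> carrier M \<Longrightarrow> y \<in> carrier M \<Longrightarrow>
      a \<odot>\<^bsub>M\<^esub> (x \<oplus>\<^bsub>M\<^esub> y) = a \<odot>\<^bsub>M\<^esub> x \<oplus>\<^bsub>M\<^esub> a \<odot>\<^bsub>M\<^esub> y"
    and hom: "\<And>g h a b x. g \<in> carrier G \<Longrightarrow> h \<in> carrier G \<Longrightarrow> a \<in> part g \<Longrightarrow> b \<in> part h \<Longrightarrow> x \<in> carrier M \<Longrightarrow>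
      (a \<otimes>\<^bsub>S\<^esub> b) \<odot>\<^bsub>M\<^esub> x = a \<odot>\<^bsub>M\<^esub> (b \<odot>\<^bsub>M\<^esub> x)"
    and a: "a \<in> carrier R" and b: "b \<in> carrier R" and x: "x \<in> carrier M"
  shows "(a \<otimes>\<^bsub>S\<^esub> b) \<odot>\<^bsub>M\<^esub> x = a \<odot>\<^bsub>M\<^esub> (b \<odot>\<^bsub>M\<^esub> x)"
proof -
  note S = S.m_closed[unfolded carrier_eq] S.l_distr[unfolded carrier_eq add_eq] S.r_distr[unfolded carrier_eq add_eq]
  have 1: "(a \<otimes>\<^bsub>S\<^esub> b) \<odot>\<^bsub>M\<^esub> x = a \<odot>\<^bsub>M\<^esub> (b \<odot>\<^bsub>M\<^esub> x)" if "g \<in> carrier G" "a \<in> part g" for g a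
  proof (rule additive_eqI[OF M, where f = "\<lambda>b. (a \<otimes>\<^bsub>S\<^esub> b) \<odot>\<^bsub>M\<^esub> x" and f' = "\<lambda>b. a \<odot>\<^bsub>M\<^esub> (b \<odot>\<^bsub>M\<^esub> x)"])
    fix h b assume "h \<in> carrier G" "b \<in> part h"
    show "(a \<otimes>\<^bsub>S\<^esub> b) \<odot>\<^bsub>M\<^esub> x = a \<odot>\<^bsub>M\<^esub> (b \<odot>\<^bsub>M\<^esub> x)" by (rule hom) fact+
  qed (use x b part_carrier[OF that(2)] in \<open>auto simp: hom_def cl l r S\<close>)
  show ?thesis
  proof (rule additive_eqI[OF M, where f = "\<lambda>a. (a \<otimes>\<^bsub>S\<^esub> b) \<odot>\<^bsub>M\<^esub> x" and f' = "\<lambda>a. a \<odot>\<^bsub>M\<^esub> (b \<odot>\<^bsub>M\<^esub> x)"])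
  qed (use 1 a b x in \<open>auto simp: hom_def cl l r S\<close>)
qed

text \<open>Associativity is where the cocycle identity enters. For degrees \<open>g\<close>,
  \<open>h\<close> acting on position \<open>l\<close>, multiplying first in \<open>S\<close> gives
  the scalars \<open>u g h\<close> and \<open>u (g \<otimes> h) l\<close>, acting twice gives
  \<open>u h l\<close> and \<open>u g (h \<otimes> l)\<close>.\<close>

lemma left_module_ind:
  assumes M: "left_module R M"
  shows "left_module S (ind M)"
proof -
  interpret M: left_module R M by fact
  interpret I: abelian_group "ind M" by (rule abelian_group_ind[OF M])
  have fcl: "u g (inv g \<otimes> l) \<odot>\<^bsub>M\<^esub> (\<pi> g a \<odot>\<^bsub>M\<^esub> dec x (inv g \<otimes> l)) \<in> carrier M"
    if "g \<in> carrier G" "l \<in> carrier G" "a \<in> carrier R" "x \<in> carrier (ind M)" for g l a x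
    using that by (intro M.smult_closed u_closed comp_closed) auto
  have cl: "a \<odot>\<^bsub>ind M\<^esub> x \<in> carrier (ind M)" if "a \<in> carrier R" "x \<in> carrier (ind M)" for a x
    using that fcl by (auto simp: dec_smult intro!: M.M.finsum_closed)
  have l: "(a \<oplus>\<^bsub>R\<^esub> b) \<odot>\<^bsub>ind M\<^esub> x = a \<odot>\<^bsub>ind M\<^esub> x \<oplus>\<^bsub>ind M\<^esub> b \<odot>\<^bsub>ind M\<^esub> x"
    if "a \<in> carrier R" "b \<in> carrier R" "x \<in> carrier (ind M)" for a b x
  proof (rule dec_inject)
    fix l assume l: "l \<in> carrier G"
    have "dec ((a \<oplus>\<^bsub>R\<^esub> b) \<odot>\<^bsub>ind M\<^esub> x) l = (\<Oplus>\<^bsub>M\<^esub>g\<in>carrier G.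
        (u g (inv g \<otimes> l) \<odot>\<^bsub>M\<^esub> (\<pi> g a \<odot>\<^bsub>M\<^esub> dec x (inv g \<otimes> l))) \<oplus>\<^bsub>M\<^esub>
        (u g (inv g \<otimes> l) \<odot>\<^bsub>M\<^esub> (\<pi> g b \<odot>\<^bsub>M\<^esub> dec x (inv g \<otimes> l))))"
      unfolding dec_smult[OF l] using that l fcl
      by (intro M.M.finsum_cong') (auto simp: comp_add comp_closed u_closed M.smult_closed M.smult_l_distr M.smult_r_distr)
    also have "\<dots> = dec (a \<odot>\<^bsub>ind M\<^esub> x \<oplus>\<^bsub>ind M\<^esub> b \<odot>\<^bsub>ind M\<^esub> x) l"
      unfolding dec_add[OF l] dec_smult[OF l] using that l fcl by (intro M.M.finsum_addf) auto
    finally show "dec ((a \<oplus>\<^bsub>R\<^esub> b) \<odot>\<^bsub>ind M\<^esub> x) l = dec (a \<odot>\<^bsub>ind M\<^esub> x \<oplus>\<^bsub>ind M\<^esub> b \<odot>\<^bsub>ind M\<^esub> x) l" .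
  qed
  have r: "a \<odot>\<^bsub>ind M\<^esub> (x \<oplus>\<^bsub>ind M\<^esub> y) = a \<odot>\<^bsub>ind M\<^esub> x \<oplus>\<^bsub>ind M\<^esub> a \<odot>\<^bsub>ind M\<^esub> y"
    if "a \<in> carrier R" "x \<in> carrier (ind M)" "y \<in> carrier (ind M)" for a x y
  proof (rule dec_inject)
    fix l assume l: "l \<in> carrier G"
    have "dec (a \<odot>\<^bsub>ind M\<^esub> (x \<oplus>\<^bsub>ind M\<^esub> y)) l = (\<Oplus>\<^bsub>M\<^esub>g\<in>carrier G.
        (u g (inv g \<otimes> l) \<odot>\<^bsub>M\<^esub> (\<pi> g a \<odot>\<^bsub>M\<^esub> dec x (inv g \<otimes> l))) \<oplus>\<^bsub>M\<^esub>
        (u g (inv g \<otimes> l) \<odot>\<^bsub>M\<^esub> (\<pi> g a \<odot>\<^bsub>M\<^esub> dec y (inv g \<otimes> l))))"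
      unfolding dec_smult[OF l] using that l fcl
      by (intro M.M.finsum_cong') (auto simp: comp_closed u_closed M.smult_closed M.smult_r_distr)
    also have "\<dots> = dec (a \<odot>\<^bsub>ind M\<^esub> x \<oplus>\<^bsub>ind M\<^esub> a \<odot>\<^bsub>ind M\<^esub> y) l"
      unfolding dec_add[OF l] dec_smult[OF l] using that l fcl by (intro M.M.finsum_addf) auto
    finally show "dec (a \<odot>\<^bsub>ind M\<^esub> (x \<oplus>\<^bsub>ind M\<^esub> y)) l = dec (a \<odot>\<^bsub>ind M\<^esub> x \<oplus>\<^bsub>ind M\<^esub> a \<odot>\<^bsub>ind M\<^esub> y) l" .
  qed
  have assoc: "(a \<otimes>\<^bsub>S\<^esub> b) \<odot>\<^bsub>ind M\<^esub> x = a \<odot>\<^bsub>ind M\<^esub> (b \<odot>\<^bsub>ind M\<^esub> x)"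
    if "g \<in> carrier G" "h \<in> carrier G" "a \<in> part g" "b \<in> part h" "x \<in> carrier (ind M)" for g h a b x
  proof (rule dec_inject'[of "g \<otimes> h"])
    fix l assume l: "l \<in> carrier G"
    note [simp] = u_closed part_carrier[OF that(3)] part_carrier[OF that(4)]
    have bx: "b \<odot>\<^bsub>ind M\<^esub> x \<in> carrier (ind M)" using that by (intro cl) auto
    have x: "dec x l \<in> carrier M" using that l by auto
    have ab: "a \<otimes>\<^bsub>S\<^esub> b = u g h \<otimes>\<^bsub>R\<^esub> (a \<otimes>\<^bsub>R\<^esub> b)" using that by (simp add: twist_part)
    have "a \<otimes>\<^bsub>S\<^esub> b \<in> part (\<one> \<otimes> (g \<otimes> h))" unfolding ab using that by (intro part_mult u_part) auto
    then have "dec ((a \<otimes>\<^bsub>S\<^esub> b) \<odot>\<^bsub>ind M\<^esub> x) (g \<otimes> h \<otimes> l) = u (g \<otimes> h) l \<odot>\<^bsub>M\<^esub> ((a \<otimes>\<^bsub>S\<^esub> b) \<odot>\<^bsub>M\<^esub> dec x l)"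
      using that l by (intro dec_smult_part[OF M]) auto
    also have "\<dots> = (u (g \<otimes> h) l \<otimes>\<^bsub>R\<^esub> u g h) \<odot>\<^bsub>M\<^esub> ((a \<otimes>\<^bsub>R\<^esub> b) \<odot>\<^bsub>M\<^esub> dec x l)"
      unfolding ab using that l x by (simp add: M.smult_assoc1 M.smult_closed)
    also have "u (g \<otimes> h) l \<otimes>\<^bsub>R\<^esub> u g h = u g (h \<otimes> l) \<otimes>\<^bsub>R\<^esub> u h l"
      using that l u_cocycle[of g h l] u_central[of g h "u (g \<otimes> h) l"] by simp
    also have "(u g (h \<otimes> l) \<otimes>\<^bsub>R\<^esub> u h l) \<odot>\<^bsub>M\<^esub> ((a \<otimes>\<^bsub>R\<^esub> b) \<odot>\<^bsub>M\<^esub> dec x l) =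
        u g (h \<otimes> l) \<odot>\<^bsub>M\<^esub> ((u h l \<otimes>\<^bsub>R\<^esub> a) \<odot>\<^bsub>M\<^esub> (b \<odot>\<^bsub>M\<^esub> dec x l))"
      using that l x by (simp add: M.smult_assoc1 M.smult_closed)
    also have "\<dots> = u g (h \<otimes> l) \<odot>\<^bsub>M\<^esub> (a \<odot>\<^bsub>M\<^esub> (u h l \<odot>\<^bsub>M\<^esub> (b \<odot>\<^bsub>M\<^esub> dec x l)))"
      using that l x u_central[of h l a] by (simp add: M.smult_assoc1 M.smult_closed)
    also have "\<dots> = u g (h \<otimes> l) \<odot>\<^bsub>M\<^esub> (a \<odot>\<^bsub>M\<^esub> dec (b \<odot>\<^bsub>ind M\<^esub> x) (h \<otimes> l))"
      using that l by (simp add: dec_smult_part[OF M])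
    also have "\<dots> = dec (a \<odot>\<^bsub>ind M\<^esub> (b \<odot>\<^bsub>ind M\<^esub> x)) (g \<otimes> (h \<otimes> l))"
      using that l bx by (intro dec_smult_part[OF M, symmetric]) auto
    finally show "dec ((a \<otimes>\<^bsub>S\<^esub> b) \<odot>\<^bsub>ind M\<^esub> x) (g \<otimes> h \<otimes> l) = dec (a \<odot>\<^bsub>ind M\<^esub> (b \<odot>\<^bsub>ind M\<^esub> x)) (g \<otimes> h \<otimes> l)"
      using that l by (simp add: G.m_assoc)
  qed (use that in auto)
  have one: "\<one>\<^bsub>R\<^esub> \<odot>\<^bsub>ind M\<^esub> x = x" if "x \<in> carrier (ind M)" for x
  proof (rule dec_inject)
    fix h assume h: "h \<in> carrier G"
    then show "dec (\<one>\<^bsub>R\<^esub> \<odot>\<^bsub>ind M\<^esub> x) h = dec x h"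
      using that dec_smult_part[OF M that G.one_closed one_part h] by (simp add: u_one M.smult_one)
  qed
  show ?thesis
    using left_module_homogeneous_assoc[OF I.abelian_group_axioms cl l r assoc] cl l r one
    by (intro left_module.intro left_module_axioms.intro S.ring_axioms I.abelian_group_axioms)
      (simp_all only: carrier_eq add_eq one_eq)
qed

lemma module_homs_homogeneousI:
  assumes "left_module R M" "left_module R N"
    and f: "\<And>x. x \<in> carrier M \<Longrightarrow> f x \<in> carrier N"
      "\<And>x y. x \<in> carrier M \<Longrightarrow> y \<in> carrier M \<Longrightarrow> f (x \<oplus>\<^bsub>M\<^esub> y) = f x \<oplus>\<^bsub>N\<^esub> f y"
      "\<And>g a x. g \<in> carrier G \<Longrightarrow> a \<in> part g \<Longrightarrow> x \<in> carrier M \<Longrightarrow> f (a \<odot>\<^bsub>M\<^esub> x) = a \<odot>\<^bsub>N\<^esub> f x"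
  shows "f \<in> module_homs R M N"
proof -
  interpret M: left_module R M by fact
  interpret N: left_module R N by fact
  have "f (a \<odot>\<^bsub>M\<^esub> x) = a \<odot>\<^bsub>N\<^esub> f x" if "a \<in> carrier R" "x \<in> carrier M" for a x
    by (rule additive_eqI[OF N.abelian_group_axioms, where f = "\<lambda>a. f (a \<odot>\<^bsub>M\<^esub> x)" and f' = "\<lambda>a. a \<odot>\<^bsub>N\<^esub> f x"])
      (use that f in \<open>auto simp: hom_def M.smult_closed N.smult_closed M.smult_l_distr N.smult_l_distr\<close>)
  then show ?thesis using f by (simp add: module_homs_iff)
qed

lemma part_swap: "graded_ring.part S \<pi> = part"
  using graded_ring.part_def[OF twist_pair.axioms(1)[OF twist_pair_swap]] by (auto simp: part_def carrier_eq fun_eq_iff)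

lemma module_homs_homogeneousI':
  assumes "left_module S M" "left_module S N"
    and f: "\<And>x. x \<in> carrier M \<Longrightarrow> f x \<in> carrier N"
      "\<And>x y. x \<in> carrier M \<Longrightarrow> y \<in> carrier M \<Longrightarrow> f (x \<oplus>\<^bsub>M\<^esub> y) = f x \<oplus>\<^bsub>N\<^esub> f y"
      "\<And>g a x. g \<in> carrier G \<Longrightarrow> a \<in> part g \<Longrightarrow> x \<in> carrier M \<Longrightarrow> f (a \<odot>\<^bsub>M\<^esub> x) = a \<odot>\<^bsub>N\<^esub> f x"
  shows "f \<in> module_homs S M N"
  using coded_twist_pair.module_homs_homogeneousI[OF coded_swap assms(1-4)] assms(5)
  by (simp add: part_swap)

lemma ind'_carrier [simp]: "x \<in> carrier (ind' M) \<longleftrightarrow> (\<forall>g\<in>carrier G. dec x g \<in> carrier M)"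
  and dec_zero' [simp]: "g \<in> carrier G \<Longrightarrow> dec \<zero>\<^bsub>ind' M\<^esub> g = \<zero>\<^bsub>M\<^esub>"
  and dec_add' [simp]: "g \<in> carrier G \<Longrightarrow> dec (x \<oplus>\<^bsub>ind' M\<^esub> y) g = dec x g \<oplus>\<^bsub>M\<^esub> dec y g"
  by (auto simp: induced_def)

lemma left_module_ind': "left_module S N \<Longrightarrow> left_module R (ind' N)"
  by (rule coded_twist_pair.left_module_ind[OF coded_swap])

lemma dec_smult_part':
  "\<lbrakk>left_module S N; x \<in> carrier (ind' N); g \<in> carrier G; a \<in> part g; h \<in> carrier G\<rbrakk> \<Longrightarrow>
    dec (a \<odot>\<^bsub>ind' N\<^esub> x) (g \<otimes> h) = v g h \<odot>\<^bsub>N\<^esub> (a \<odot>\<^bsub>N\<^esub> dec x h)"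
  using coded_twist_pair.dec_smult_part[OF coded_swap] by (simp add: part_swap)

section \<open>The adjunction between \<open>ind\<close> and \<open>ind'\<close>\<close>

definition single :: "('a, 'm) module \<Rightarrow> 'g \<Rightarrow> 'm \<Rightarrow> 'm" where
  "single P l p = enc (\<lambda>h. if h = l then p else \<zero>\<^bsub>P\<^esub>)"

lemma dec_single [simp]: "g \<in> carrier G \<Longrightarrow> dec (single P l p) g = (if g = l then p else \<zero>\<^bsub>P\<^esub>)"
  by (simp add: single_def)

lemma single_closed:
  assumes "left_module R P" "p \<in> carrier P"
  shows "single P l p \<in> carrier (ind P)"
proof -
  interpret P: left_module R P by fact
  show ?thesis using assms by auto
qed

lemma single_add:
  assumes "left_module R P" "p \<in> carrier P" "q \<in> carrier P"
  shows "single P l (p \<oplus>\<^bsub>P\<^esub> q) = single P l p \<oplus>\<^bsub>ind P\<^esub> single P l q"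
proof -
  interpret P: left_module R P by fact
  show ?thesis by (rule dec_inject) simp
qed

lemma smult_single:
  assumes P: "left_module R P" and p: "p \<in> carrier P" and a: "g \<in> carrier G" "a \<in> part g" and h: "h \<in> carrier G"
  shows "a \<odot>\<^bsub>ind P\<^esub> single P h p = single P (g \<otimes> h) (u g h \<odot>\<^bsub>P\<^esub> (a \<odot>\<^bsub>P\<^esub> p))"
proof (rule dec_inject'[OF a(1)])
  fix l assume l: "l \<in> carrier G"
  show "dec (a \<odot>\<^bsub>ind P\<^esub> single P h p) (g \<otimes> l) = dec (single P (g \<otimes> h) (u g h \<odot>\<^bsub>P\<^esub> (a \<odot>\<^bsub>P\<^esub> p))) (g \<otimes> l)"
    unfolding dec_smult_part[OF P single_closed[OF P p] a l]
    using a h l part_carrier[OF a(2)] by (simp add: left_module_smult_zero[OF P] u_closed)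
qed

text \<open>The transpose of \<open>f\<close> remembers its value on a copy of \<open>p\<close> in
  each position. It is linear because \<open>a\<close> moves the copy from \<open>h\<close> to
  \<open>g \<otimes> h\<close> with factor \<open>u g h\<close>, which the factor
  \<open>v g h\<close> of the action on \<open>ind' N\<close> cancels.\<close>

lemma curry_hom:
  assumes P: "left_module R P" and N: "left_module S N" and f: "f \<in> module_homs S (ind P) N"
  shows "(\<lambda>p. enc (\<lambda>l. f (single P l p))) \<in> module_homs R P (ind' N)"
proof (rule module_homs_homogeneousI[OF P left_module_ind'[OF N]])
  interpret P: left_module R P by fact
  interpret IP: left_module S "ind P" by (rule left_module_ind[OF P])
  interpret N: left_module S N by fact
  note fcl = module_homs_closed[OF f single_closed[OF P]]
  show cl: "enc (\<lambda>l. f (single P l x)) \<in> carrier (ind' N)" if "x \<in> carrier P" for x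
    using that fcl by simp
  show "enc (\<lambda>l. f (single P l (x \<oplus>\<^bsub>P\<^esub> y))) =
      enc (\<lambda>l. f (single P l x)) \<oplus>\<^bsub>ind' N\<^esub> enc (\<lambda>l. f (single P l y))"
    if "x \<in> carrier P" "y \<in> carrier P" for x y
    by (rule dec_inject) (use that in \<open>simp add: single_add[OF P] module_homs_add[OF f] single_closed[OF P] del: ind_carrier\<close>)
  fix g a x assume a: "g \<in> carrier G" "a \<in> part g" and x: "x \<in> carrier P"
  show "enc (\<lambda>l. f (single P l (a \<odot>\<^bsub>P\<^esub> x))) = a \<odot>\<^bsub>ind' N\<^esub> enc (\<lambda>l. f (single P l x))"
  proof (rule dec_inject'[OF a(1)])
    fix h assume h: "h \<in> carrier G"
    have aR: "a \<in> carrier R" "a \<in> carrier S" using part_carrier[OF a(2)] by (auto simp: carrier_eq)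
    have vS: "v g h \<in> carrier S" using a h by (simp add: carrier_eq v_closed)
    have "dec (a \<odot>\<^bsub>ind' N\<^esub> enc (\<lambda>l. f (single P l x))) (g \<otimes> h) = v g h \<odot>\<^bsub>N\<^esub> (a \<odot>\<^bsub>N\<^esub> f (single P h x))"
      unfolding dec_smult_part'[OF N cl[OF x] a h] using h by simp
    also have "\<dots> = f (v g h \<odot>\<^bsub>ind P\<^esub> (a \<odot>\<^bsub>ind P\<^esub> single P h x))"
      using aR vS single_closed[OF P x] IP.smult_closed by (simp add: module_homs_smult[OF f] del: ind_carrier)
    \<comment> \<open>The element \<open>v g h\<close> has trivial degree, so it acts within
      position \<open>g \<otimes> h\<close> and contributes no further cocycle factor.\<close>
    also have "v g h \<odot>\<^bsub>ind P\<^esub> (a \<odot>\<^bsub>ind P\<^esub> single P h x) =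
        single P (g \<otimes> h) (v g h \<odot>\<^bsub>P\<^esub> (u g h \<odot>\<^bsub>P\<^esub> (a \<odot>\<^bsub>P\<^esub> x)))"
      using a h x aR smult_single[OF P _ G.one_closed v_part[OF a(1) h] G.m_closed[OF a(1) h],
          of "u g h \<odot>\<^bsub>P\<^esub> (a \<odot>\<^bsub>P\<^esub> x)"]
      by (simp add: smult_single[OF P] u_closed v_closed P.smult_closed u_one P.smult_one)
    also have "v g h \<odot>\<^bsub>P\<^esub> (u g h \<odot>\<^bsub>P\<^esub> (a \<odot>\<^bsub>P\<^esub> x)) = a \<odot>\<^bsub>P\<^esub> x"
      using a h x aR R.m_assoc[of "v g h" "u g h" a]
      by (simp add: u_closed v_closed v_u flip: P.smult_assoc1)
    finally show "dec (enc (\<lambda>l. f (single P l (a \<odot>\<^bsub>P\<^esub> x)))) (g \<otimes> h) =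
      dec (a \<odot>\<^bsub>ind' N\<^esub> enc (\<lambda>l. f (single P l x))) (g \<otimes> h)" using a h by simp
  qed
qed

text \<open>The inverse transpose sums the diagonal entries: the \<open>l\<close>-th position of the
  image of the \<open>l\<close>-th position. An element of degree \<open>g\<close> carries the
  diagonal entry at \<open>h\<close> to the one at \<open>g \<otimes> h\<close>, the factors
  \<open>u g h\<close> and \<open>v g h\<close> cancel, and translation by \<open>g\<close> only
  permutes the summands.\<close>

lemma uncurry_hom:
  assumes P: "left_module R P" and N: "left_module S N" and f: "f \<in> module_homs R P (ind' N)"
  shows "(\<lambda>x. \<Oplus>\<^bsub>N\<^esub>l\<in>carrier G. dec (f (dec x l)) l) \<in> module_homs S (ind P) N"
proof (rule module_homs_homogeneousI'[OF left_module_ind[OF P] N])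
  interpret P: left_module R P by fact
  interpret IN: left_module R "ind' N" by (rule left_module_ind'[OF N])
  interpret N: left_module S N by fact
  have fcl: "dec (f p) l \<in> carrier N" if "p \<in> carrier P" "l \<in> carrier G" for p l
    using module_homs_closed[OF f that(1)] that(2) by simp
  show "(\<Oplus>\<^bsub>N\<^esub>l\<in>carrier G. dec (f (dec x l)) l) \<in> carrier N" if "x \<in> carrier (ind P)" for x
    using that fcl by (intro N.M.finsum_closed) auto
  show "(\<Oplus>\<^bsub>N\<^esub>l\<in>carrier G. dec (f (dec (x \<oplus>\<^bsub>ind P\<^esub> y) l)) l) =
      (\<Oplus>\<^bsub>N\<^esub>l\<in>carrier G. dec (f (dec x l)) l) \<oplus>\<^bsub>N\<^esub> (\<Oplus>\<^bsub>N\<^esub>l\<in>carrier G. dec (f (dec y l)) l)"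
    if "x \<in> carrier (ind P)" "y \<in> carrier (ind P)" for x y
  proof -
    have "(\<Oplus>\<^bsub>N\<^esub>l\<in>carrier G. dec (f (dec (x \<oplus>\<^bsub>ind P\<^esub> y) l)) l) =
        (\<Oplus>\<^bsub>N\<^esub>l\<in>carrier G. dec (f (dec x l)) l \<oplus>\<^bsub>N\<^esub> dec (f (dec y l)) l)"
      using that fcl by (intro N.M.finsum_cong') (auto simp: module_homs_add[OF f])
    also have "\<dots> = (\<Oplus>\<^bsub>N\<^esub>l\<in>carrier G. dec (f (dec x l)) l) \<oplus>\<^bsub>N\<^esub> (\<Oplus>\<^bsub>N\<^esub>l\<in>carrier G. dec (f (dec y l)) l)"
      using that fcl by (intro N.M.finsum_addf) auto
    finally show ?thesis .
  qed
  fix g a x assume a: "g \<in> carrier G" "a \<in> part g" and x: "x \<in> carrier (ind P)"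
  have aR: "a \<in> carrier R" "a \<in> carrier S" using part_carrier[OF a(2)] by (auto simp: carrier_eq)
  have ax: "a \<odot>\<^bsub>ind P\<^esub> x \<in> carrier (ind P)"
    using left_module.smult_closed[OF left_module_ind[OF P] aR(2) x] .
  have eq: "dec (f (dec (a \<odot>\<^bsub>ind P\<^esub> x) (g \<otimes> h))) (g \<otimes> h) = a \<odot>\<^bsub>N\<^esub> dec (f (dec x h)) h" if h: "h \<in> carrier G" for h
  proof -
    have uv: "u g h \<in> carrier S" "v g h \<in> carrier S" "u g h \<in> carrier R" "v g h \<in> carrier R"
      using a h by (simp_all add: carrier_eq u_closed v_closed)
    have xh: "dec x h \<in> carrier P" using x h by simp
    have fx: "f (dec x h) \<in> carrier (ind' N)" by (rule module_homs_closed[OF f xh])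
    have afx: "a \<odot>\<^bsub>ind' N\<^esub> f (dec x h) \<in> carrier (ind' N)" by (rule IN.smult_closed[OF aR(1) fx])
    have "f (dec (a \<odot>\<^bsub>ind P\<^esub> x) (g \<otimes> h)) = u g h \<odot>\<^bsub>ind' N\<^esub> (a \<odot>\<^bsub>ind' N\<^esub> f (dec x h))"
      unfolding dec_smult_part[OF P x a h] using uv aR xh
      by (simp add: module_homs_smult[OF f] P.smult_closed)
    \<comment> \<open>The position is written with a leading \<open>\<one>\<close> because the
      acting element \<open>u g h\<close> has trivial degree and the formula for homogeneous
      elements expects its degree there.\<close>
    also have "dec \<dots> (\<one> \<otimes> (g \<otimes> h)) = v \<one> (g \<otimes> h) \<odot>\<^bsub>N\<^esub> (u g h \<odot>\<^bsub>N\<^esub> dec (a \<odot>\<^bsub>ind' N\<^esub> f (dec x h)) (g \<otimes> h))"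
      using a h by (intro dec_smult_part'[OF N afx] u_part) auto
    also have "dec (a \<odot>\<^bsub>ind' N\<^esub> f (dec x h)) (g \<otimes> h) = v g h \<odot>\<^bsub>N\<^esub> (a \<odot>\<^bsub>N\<^esub> dec (f (dec x h)) h)"
      by (rule dec_smult_part'[OF N fx a h])
    also have "v \<one> (g \<otimes> h) = \<one>\<^bsub>S\<^esub>" using a h by (simp add: v_one one_eq)
    also have "u g h \<odot>\<^bsub>N\<^esub> (v g h \<odot>\<^bsub>N\<^esub> (a \<odot>\<^bsub>N\<^esub> dec (f (dec x h)) h)) =
        (u g h \<otimes>\<^bsub>S\<^esub> v g h) \<odot>\<^bsub>N\<^esub> (a \<odot>\<^bsub>N\<^esub> dec (f (dec x h)) h)"
      using uv aR fx h by (simp add: N.smult_assoc1 N.smult_closed)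
    also have "u g h \<otimes>\<^bsub>S\<^esub> v g h = \<one>\<^bsub>S\<^esub>"
      using a h uv by (simp add: twist_one_left u_part u_v one_eq)
    finally show ?thesis using a h aR fx by (simp add: N.smult_one N.smult_closed)
  qed
  have "(\<Oplus>\<^bsub>N\<^esub>l\<in>carrier G. dec (f (dec (a \<odot>\<^bsub>ind P\<^esub> x) l)) l) =
      (\<Oplus>\<^bsub>N\<^esub>l\<in>(\<lambda>h. g \<otimes> h) ` carrier G. dec (f (dec (a \<odot>\<^bsub>ind P\<^esub> x) l)) l)"
    using G.surj_const_mult[OF a(1)] by simp
  also have "\<dots> = (\<Oplus>\<^bsub>N\<^esub>h\<in>carrier G. dec (f (dec (a \<odot>\<^bsub>ind P\<^esub> x) (g \<otimes> h))) (g \<otimes> h))"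
    using a ax fcl by (intro N.M.finsum_reindex) (auto intro: G.inj_on_cmult)
  also have "\<dots> = (\<Oplus>\<^bsub>N\<^esub>h\<in>carrier G. a \<odot>\<^bsub>N\<^esub> dec (f (dec x h)) h)"
    using x aR fcl eq by (intro N.M.finsum_cong') (auto intro: N.smult_closed)
  also have "\<dots> = a \<odot>\<^bsub>N\<^esub> (\<Oplus>\<^bsub>N\<^esub>h\<in>carrier G. dec (f (dec x h)) h)"
    using x aR fcl finite_G
    by (intro additive_finsum[symmetric, where f = "\<lambda>y. a \<odot>\<^bsub>N\<^esub> y"] N.abelian_group_axioms)
      (auto simp: hom_def N.smult_closed N.smult_r_distr)
  finally show "(\<Oplus>\<^bsub>N\<^esub>l\<in>carrier G. dec (f (dec (a \<odot>\<^bsub>ind P\<^esub> x) l)) l) =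
      a \<odot>\<^bsub>N\<^esub> (\<Oplus>\<^bsub>N\<^esub>h\<in>carrier G. dec (f (dec x h)) h)" .
qed

lemma ind_map:
  assumes "left_module R M" "left_module R N" and f: "f \<in> module_homs R M N"
  shows "(\<lambda>x. enc (\<lambda>l. f (dec x l))) \<in> module_homs S (ind M) (ind N)"
proof (rule module_homs_homogeneousI'[OF left_module_ind[OF assms(1)] left_module_ind[OF assms(2)]])
  interpret M: left_module R M by fact
  show cl: "enc (\<lambda>l. f (dec x l)) \<in> carrier (ind N)" if "x \<in> carrier (ind M)" for x
    using that module_homs_closed[OF f] by auto
  show "enc (\<lambda>l. f (dec (x \<oplus>\<^bsub>ind M\<^esub> y) l)) = enc (\<lambda>l. f (dec x l)) \<oplus>\<^bsub>ind N\<^esub> enc (\<lambda>l. f (dec y l))"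
    if "x \<in> carrier (ind M)" "y \<in> carrier (ind M)" for x y
    by (rule dec_inject) (use that in \<open>simp add: module_homs_add[OF f]\<close>)
  fix g a x assume a: "g \<in> carrier G" "a \<in> part g" and x: "x \<in> carrier (ind M)"
  show "enc (\<lambda>l. f (dec (a \<odot>\<^bsub>ind M\<^esub> x) l)) = a \<odot>\<^bsub>ind N\<^esub> enc (\<lambda>l. f (dec x l))"
  proof (rule dec_inject'[OF a(1)])
    fix h assume h: "h \<in> carrier G"
    show "dec (enc (\<lambda>l. f (dec (a \<odot>\<^bsub>ind M\<^esub> x) l))) (g \<otimes> h) = dec (a \<odot>\<^bsub>ind N\<^esub> enc (\<lambda>l. f (dec x l))) (g \<otimes> h)"
      unfolding dec_smult_part[OF assms(2) cl[OF x] a h]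
      using a h x u_closed[OF a(1) h] part_carrier[OF a(2)]
      by (simp add: dec_smult_part[OF assms(1) x a h] module_homs_smult[OF f] M.smult_closed)
  qed
qed

lemma ind_decompose:
  assumes P: "left_module R P" and x: "x \<in> carrier (ind P)"
  shows "(\<Oplus>\<^bsub>ind P\<^esub>l\<in>carrier G. single P l (dec x l)) = x"
proof (rule dec_inject)
  fix h assume h: "h \<in> carrier G"
  interpret P: left_module R P by fact
  have "dec (\<Oplus>\<^bsub>ind P\<^esub>l\<in>carrier G. single P l (dec x l)) h = (\<Oplus>\<^bsub>P\<^esub>l\<in>carrier G. dec (single P l (dec x l)) h)"
    using h x single_closed[OF P] finite_G
    by (intro additive_finsum[where f = "\<lambda>x. dec x h"] abelian_group_ind[OF P] P.abelian_group_axioms)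
      (auto simp: hom_def)
  also have "\<dots> = (\<Oplus>\<^bsub>P\<^esub>l\<in>carrier G. if h = l then dec x l else \<zero>\<^bsub>P\<^esub>)" using h by simp
  also have "\<dots> = dec x h" using h x finite_G by (intro P.M.finsum_singleton) auto
  finally show "dec (\<Oplus>\<^bsub>ind P\<^esub>l\<in>carrier G. single P l (dec x l)) h = dec x h" .
qed

text \<open>A lifting problem for \<open>ind P\<close> against \<open>f\<close> is transposed to one
  for \<open>P\<close> against the map that \<open>f\<close> induces on \<open>ind'\<close>. That
  map is onto, since preimages can be chosen position by position, and the lift found for
  \<open>P\<close> is transposed back.\<close>

lemma projective_ind:
  fixes P :: "('a, 'm) module"
  assumes proj: "projective_module R P"
  shows "projective_module S (ind P)"
  unfolding projective_module_def
proof (intro conjI allI impI)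
  have P: "left_module R P" using proj by (simp add: projective_module_def)
  then show IP: "left_module S (ind P)" by (rule left_module_ind)
  interpret P: left_module R P by fact
  fix L N :: "('a, 'm) module" and f g
  assume "left_module S L \<and> left_module S N \<and> f \<in> module_homs S L N \<and>
    f ` carrier L = carrier N \<and> g \<in> module_homs S (ind P) N"
  then have L: "left_module S L" and N: "left_module S N" and f: "f \<in> module_homs S L N"
    "f ` carrier L = carrier N" and g: "g \<in> module_homs S (ind P) N" by auto
  interpret L: left_module S L by fact
  interpret N: left_module S N by fact
  let ?f = "\<lambda>x. enc (\<lambda>l. f (dec x l))" and ?g = "\<lambda>p. enc (\<lambda>l. g (single P l p))"
  have f': "?f \<in> module_homs R (ind' L) (ind' N)"
    by (rule coded_twist_pair.ind_map[OF coded_swap L N f(1)])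
  have "?f ` carrier (ind' L) = carrier (ind' N)"
  proof (intro equalityI subsetI)
    fix y assume y: "y \<in> carrier (ind' N)"
    let ?x = "enc (\<lambda>l. inv_into (carrier L) f (dec y l))"
    have "?x \<in> carrier (ind' L)" using y f(2) by (auto intro: inv_into_into)
    moreover have "?f ?x = y" by (rule dec_inject) (use y f(2) in \<open>auto intro: f_inv_into_f\<close>)
    ultimately show "y \<in> ?f ` carrier (ind' L)" by (metis imageI)
  qed (use module_homs_closed[OF f'] in auto)
  then obtain h where h: "h \<in> module_homs R P (ind' L)" "\<And>p. p \<in> carrier P \<Longrightarrow> ?f (h p) = ?g p"
    using projective_lift[OF proj left_module_ind'[OF L] left_module_ind'[OF N] f' _ curry_hom[OF P N g]]
    by blast
  show "\<exists>h\<in>module_homs S (ind P) L. \<forall>p\<in>carrier (ind P). f (h p) = g p"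
  proof (intro bexI[OF _ uncurry_hom[OF P L h(1)]] ballI)
    fix x assume x: "x \<in> carrier (ind P)"
    have hcl: "dec (h p) l \<in> carrier L" if "p \<in> carrier P" "l \<in> carrier G" for p l
      using module_homs_closed[OF h(1) that(1)] that(2) by simp
    have "f (dec (h p) l) = g (single P l p)" if "p \<in> carrier P" "l \<in> carrier G" for p l
      using arg_cong[OF h(2)[OF that(1)], of "\<lambda>y. dec y l"] that(2) by simp
    then have "(\<Oplus>\<^bsub>N\<^esub>l\<in>carrier G. f (dec (h (dec x l)) l)) = (\<Oplus>\<^bsub>N\<^esub>l\<in>carrier G. g (single P l (dec x l)))"
      using x module_homs_closed[OF g single_closed[OF P]] by (intro N.M.finsum_cong') auto
    also have "\<dots> = g x"
      using module_homs_finsum[OF IP N g finite_G, of "\<lambda>l. single P l (dec x l)"] x single_closed[OF P]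
      by (simp add: ind_decompose[OF P x])
    finally show "f (\<Oplus>\<^bsub>L\<^esub>l\<in>carrier G. dec (h (dec x l)) l) = g x"
      using module_homs_finsum[OF L N f(1) finite_G, of "\<lambda>l. dec (h (dec x l)) l"] x hcl by simp
  qed
qed

text \<open>Transposing identity maps gives \<open>?i\<close>, which puts \<open>m\<close> in all
  diagonal positions, and \<open>?r\<close>, which sums the diagonal. Their composite multiplies by
  |G|, so scaling \<open>?r\<close> by the central element \<open>w\<close> splits
  \<open>?i\<close>.\<close>

lemma projective_if_projective_ind:
  fixes M :: "('a, 'm) module"
  assumes M: "left_module R M" and proj: "projective_module S (ind M)"
  shows "projective_module R M"
proof -
  interpret M: left_module R M by fact
  have IM: "left_module S (ind M)" by (rule left_module_ind[OF M])
  have IIM: "left_module R (ind' (ind M))" by (rule left_module_ind'[OF IM])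
  have proj': "projective_module R (ind' (ind M))"
    by (rule coded_twist_pair.projective_ind[OF coded_swap proj])
  let ?i = "\<lambda>m. enc (\<lambda>l. single M l m)" and ?r = "\<lambda>x. \<Oplus>\<^bsub>M\<^esub>l\<in>carrier G. dec (dec x l) l"
  have i: "?i \<in> module_homs R M (ind' (ind M))"
    by (rule curry_hom[OF M IM module_homs_id])
  have r: "?r \<in> module_homs R (ind' (ind M)) M"
    by (rule coded_twist_pair.uncurry_hom[OF coded_swap IM M module_homs_id])
  have w: "(\<lambda>m. w \<odot>\<^bsub>M\<^esub> m) \<in> module_homs R M M"
    using w_closed w_central by (auto simp: module_homs_iff M.smult_closed M.smult_r_distr simp flip: M.smult_assoc1)
  have "w \<odot>\<^bsub>M\<^esub> ?r (?i m) = m" if m: "m \<in> carrier M" for m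
  proof -
    have "?r (?i m) = (\<Oplus>\<^bsub>M\<^esub>l\<in>carrier G. m)" using m by (intro M.M.finsum_cong') auto
    then have "w \<odot>\<^bsub>M\<^esub> ?r (?i m) = (\<Oplus>\<^bsub>M\<^esub>l\<in>carrier G. w \<odot>\<^bsub>M\<^esub> m)"
      using module_homs_finsum[OF M M w finite_G] m by simp
    also have "\<dots> = (\<Oplus>\<^bsub>R\<^esub>l\<in>carrier G. w) \<odot>\<^bsub>M\<^esub> m"
      using m w_closed finite_G
      by (intro additive_finsum[symmetric, where f = "\<lambda>a. a \<odot>\<^bsub>M\<^esub> m"] R.is_abelian_group M.abelian_group_axioms)
        (auto simp: hom_def M.smult_closed M.smult_l_distr)
    finally show ?thesis using m by (simp add: w_sum M.smult_one)
  qed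
  \<comment> \<open>A genuine retract is wanted here; the projective companion required by
    \<open>stable_retract\<close> is \<open>ind' (ind M)\<close> once more, with zero as its return
    map.\<close>
  moreover have "(\<lambda>_. \<zero>\<^bsub>M\<^esub>) \<in> module_homs R (ind' (ind M)) M"
    by (auto simp: module_homs_iff left_module_smult_zero[OF M])
  ultimately have "stable_retract R M (ind' (ind M))"
    unfolding stable_retract_def
    by (intro exI[of _ "ind' (ind M)"] exI[of _ ?i] exI[of _ "\<lambda>x. w \<odot>\<^bsub>M\<^esub> ?r x"] exI[of _ ?i] exI[of _ "\<lambda>_. \<zero>\<^bsub>M\<^esub>"])
      (use proj' i module_homs_compose[OF r w] in auto)
  then show ?thesis using proj' M by (rule projective_stable_retract)
qed

text \<open>Produces covers over \<open>R\<close> from covers over \<open>S\<close> without appeal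
  to free modules. The map is the transpose of \<open>q\<close>. It is onto because a preimage of
  \<open>single M \<one> m\<close>, placed in position \<open>\<one>\<close>, has diagonal sum
  \<open>m\<close>.\<close>

lemma projective_cover_coind:
  fixes M :: "('a, 'm) module"
  assumes M: "left_module R M" and q: "projective_cover S Q (ind M) q"
  shows "projective_cover R (ind' Q) M (\<lambda>x. \<Oplus>\<^bsub>M\<^esub>l\<in>carrier G. dec (q (dec x l)) l)"
proof -
  let ?p = "\<lambda>x. \<Oplus>\<^bsub>M\<^esub>l\<in>carrier G. dec (q (dec x l)) l"
  have Q: "projective_module S Q" "left_module S Q" "q \<in> module_homs S Q (ind M)" "q ` carrier Q = carrier (ind M)"
    using q unfolding projective_cover_def projective_module_def by blast+
  interpret M: left_module R M by fact
  interpret Q: left_module S Q by (rule Q(2))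
  have p: "?p \<in> module_homs R (ind' Q) M"
    by (rule coded_twist_pair.uncurry_hom[OF coded_swap Q(2) M Q(3)])
  have "m \<in> ?p ` carrier (ind' Q)" if m: "m \<in> carrier M" for m
  proof -
    obtain y where y: "y \<in> carrier Q" "q y = single M \<one> m"
      using Q(4) single_closed[OF M m, of \<one>] by (metis imageE)
    let ?x = "enc (\<lambda>l. if l = \<one> then y else \<zero>\<^bsub>Q\<^esub>)"
    have "?p ?x = (\<Oplus>\<^bsub>M\<^esub>l\<in>carrier G. if \<one> = l then m else \<zero>\<^bsub>M\<^esub>)"
      using m y module_homs_zero[OF Q(2) left_module_ind[OF M] Q(3)]
      by (intro M.M.finsum_cong') auto
    also have "\<dots> = m" using m finite_G by (intro M.M.finsum_singleton) auto
    finally show ?thesis using y by (intro image_eqI[of _ _ ?x]) auto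
  qed
  then show ?thesis unfolding projective_cover_def
    using p module_homs_closed[OF p] coded_twist_pair.projective_ind[OF coded_swap Q(1)] by blast
qed

text \<open>The claim for \<open>N = ind M\<close> alone would not survive the induction. The cover
  of \<open>N\<close> comes from \<open>pd_le\<close>, that of \<open>ind M\<close> is induced from
  a cover of \<open>M\<close>, and \<open>stable_retract_kernel\<close> relates their kernels only
  as a stable retract. With the general \<open>N\<close> this is exactly the induction hypothesis
  for the kernel of the cover of \<open>M\<close>.\<close>

lemma pd_le_if_ind:
  fixes M N :: "('a, 'm) module"
  assumes covers: "\<And>N :: ('a, 'm) module. left_module S N \<Longrightarrow> \<exists>Q q. projective_cover S Q N q"
    and "left_module R M" "stable_retract S (ind M) N" "pd_le S n N"
  shows "pd_le R n M"
  using assms(2-)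
proof (induction n arbitrary: M N)
  case 0
  then have "projective_module S (ind M)"
    by (auto intro: projective_stable_retract left_module_ind)
  then show ?case using 0 by (auto intro: projective_if_projective_ind)
next
  case (Suc n)
  note M = Suc.prems(1)
  obtain P p where P: "projective_cover S P N p" "pd_le S n (kernel_module P N p)" and N: "left_module S N"
    using Suc.prems(3) by auto
  note IM = left_module_ind[OF M]
  obtain Q q where Q: "projective_cover R Q M q"
    using covers[OF IM] projective_cover_coind[OF M] by blast
  then have Q': "projective_module R Q" "left_module R Q" "q \<in> module_homs R Q M" "q ` carrier Q = carrier M"
    unfolding projective_cover_def projective_module_def by blast+
  let ?q = "\<lambda>x. enc (\<lambda>l. q (dec x l))"
  have q: "?q \<in> module_homs S (ind Q) (ind M)" by (rule ind_map[OF Q'(2) M Q'(3)])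
  have "?q ` carrier (ind Q) = carrier (ind M)"
  proof (intro equalityI subsetI)
    fix y assume y: "y \<in> carrier (ind M)"
    let ?x = "enc (\<lambda>l. inv_into (carrier Q) q (dec y l))"
    have "?x \<in> carrier (ind Q)" using y Q'(4) by (auto intro: inv_into_into)
    moreover have "?q ?x = y" by (rule dec_inject) (use y Q'(4) in \<open>auto intro: f_inv_into_f\<close>)
    ultimately show "y \<in> ?q ` carrier (ind Q)" by (metis imageI)
  qed (use module_homs_closed[OF q] in auto)
  then have "projective_cover S (ind Q) (ind M) ?q"
    using q projective_ind[OF Q'(1)] by (simp add: projective_cover_def)
  then have sr: "stable_retract S (kernel_module (ind Q) (ind M) ?q) (kernel_module P N p)"
    using Suc.prems(2) N IM P(1) by (intro stable_retract_kernel)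
  let ?K = "kernel_module Q M q" and ?IK = "kernel_module (ind Q) (ind M) ?q"
  have K: "left_module R ?K" by (rule left_module_kernel[OF Q'(2) M Q'(3)])
  have enc_dec: "enc (\<lambda>l. dec x l) = x" for x by (rule dec_inject) simp
  have id: "(\<lambda>x. x) \<in> module_homs S (ind ?K) (ind Q)"
    using ind_map[OF K Q'(2) module_homs_kernel_incl] by (simp add: enc_dec)
  have dec_q: "?q x = \<zero>\<^bsub>ind M\<^esub> \<longleftrightarrow> (\<forall>l\<in>carrier G. q (dec x l) = \<zero>\<^bsub>M\<^esub>)" for x
    by (metis dec_enc dec_inject dec_zero)
  \<comment> \<open>Exactness of \<open>ind\<close>: a code lies in the kernel of the induced map
    iff each of its positions lies in the kernel of \<open>q\<close>. The identity map is therefore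
    linear in both directions.\<close>
  have "(\<lambda>x. x) \<in> module_homs S (ind ?K) ?IK"
    unfolding module_homs_into_kernel using id by (simp add: dec_q)
  moreover have "(\<lambda>x. x) \<in> module_homs S ?IK (ind ?K)"
    using id by (auto simp: module_homs_iff dec_q)
  ultimately have "stable_retract S (ind ?K) (kernel_module P N p)"
    using sr by (auto intro: stable_retract_iso)
  then have "pd_le R n ?K" using Suc.IH[OF K] P(2) by blast
  then show ?case using Q M by auto
qed

text \<open>If the right-hand side is infinite there is nothing to show. Otherwise each
  \<open>S\<close>-module in the universe has a resolution, whose term of index 0 is the cover
  needed, and \<open>pd_le_if_ind\<close> starts from \<open>ind M\<close> as a stable retract of
  itself.\<close>

lemma lgldim_le: "lgldim TYPE('m) R \<le> lgldim TYPE('m) S"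
proof (cases "lgldim TYPE('m) S")
  case (enat n)
  then have "lgldim TYPE('m) S \<le> enat n" by simp
  then have S: "pd_le S n N" if "left_module S N" for N :: "('a, 'm) module"
    using that unfolding lgldim_le_iff by blast
  have covers: "\<exists>Q q. projective_cover S Q N q" if "left_module S N" for N :: "('a, 'm) module"
    using resolution_if_pd_le[OF S[OF that]]
    unfolding projective_resolution_def projective_cover_def by metis
  have "pd_le R n M" if M: "left_module R M" for M :: "('a, 'm) module"
    by (rule pd_le_if_ind[OF covers M stable_retract_refl S]) (simp_all add: left_module_ind[OF M])
  then show ?thesis unfolding enat lgldim_le_iff by blast
qed simp

lemma lgldim_eq: "lgldim TYPE('m) R = lgldim TYPE('m) S"
  using lgldim_le coded_twist_pair.lgldim_le[OF coded_swap] by (rule antisym)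

end

section \<open>Characters of finite abelian groups\<close>

text \<open>Over a field with \<open>q\<close> elements the polynomial X^q - X + 1 would have no
  root. The infinitude of scalars feeds the pigeonhole argument for finite universes.\<close>

lemma (in algebraically_closed) infinite_carrier: "infinite (carrier L)"
proof
  assume fin: "finite (carrier L)"
  define q where "q = card (carrier L)"
  have "card {\<zero>, \<one>} \<le> q" unfolding q_def using fin by (intro card_mono) auto
  then have q: "q \<ge> 2" by simp
  then obtain n where n: "q = Suc (Suc n)" by (metis add_2_eq_Suc le_Suc_ex)
  \<comment> \<open>Polynomials are coefficient lists, and appending \<open>c\<close> multiplies by
    X and adds \<open>c\<close>. Since \<open>n\<close> is \<open>q - 2\<close>, this is X^q - X +
    1, which takes the value 1 at every point.\<close>
  let ?P = "(monom \<one> n @ [\<ominus> \<one>]) @ [\<one>]"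
  have set: "set (monom \<one> n) \<subseteq> carrier L" "set (monom \<one> n @ [\<ominus> \<one>]) \<subseteq> carrier L"
    unfolding monom_def by auto
  have eval: "eval ?P a = \<one>" if a: "a \<in> carrier L" for a
  proof -
    have "eval ?P a = (a [^] n \<otimes> a \<oplus> \<ominus> \<one>) \<otimes> a \<oplus> \<one>"
      using a by (simp add: eval_append_aux[OF set(1)] eval_append_aux[OF set(2)] eval_monom del: append_assoc)
    also have "(a [^] n \<otimes> a \<oplus> \<ominus> \<one>) \<otimes> a = \<zero>"
    proof (cases "a = \<zero>")
      case False
      interpret M: group "Multiplicative_Group.mult_of L" by (rule field_mult_group)
      have "a [^]\<^bsub>Multiplicative_Group.mult_of L\<^esub> order (Multiplicative_Group.mult_of L) = \<one>\<^bsub>Multiplicative_Group.mult_of L\<^esub>"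
        using a False by (intro M.pow_order_eq_1) auto
      then have "a [^] Suc n = \<one>"
        using n fin by (simp add: order_mult_of order_def q_def[symmetric] Multiplicative_Group.nat_pow_mult_of[symmetric] del: nat_pow_Suc)
      then show ?thesis using a by (simp add: r_neg)
    qed simp
    finally show ?thesis by simp
  qed
  have P: "?P \<in> carrier (poly_ring L)"
    using set unfolding sym[OF univ_poly_carrier] polynomial_def by (auto simp: monom_def)
  then have "size (roots ?P) = degree ?P" using roots_over_carrier unfolding splitted_def by blast
  then have "roots ?P \<noteq> {#}" by (auto simp: monom_def)
  then obtain a where "a \<in># roots ?P" by blast
  then have "a \<in> carrier L" "eval ?P a = \<zero>"
    unfolding roots_mem_iff_is_root[OF P] is_root_def by auto
  then show False using eval by simp
qed

text \<open>Gaussian elimination on the points. If some \<open>f j\<close> is nonzero at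
  \<open>x\<close>, it serves as pivot: multiples of it are subtracted so that the other functions
  vanish at \<open>x\<close>, and the induction hypothesis applies to these on
  \<open>V\<close>.\<close>

lemma (in field) linear_dependence:
  assumes "finite V" "finite I" "card V < card I" "\<And>i x. i \<in> I \<Longrightarrow> x \<in> V \<Longrightarrow> f i x \<in> carrier R"
  shows "\<exists>c. (\<forall>i\<in>I. c i \<in> carrier R) \<and> (\<exists>i\<in>I. c i \<noteq> \<zero>) \<and> (\<forall>x\<in>V. (\<Oplus>i\<in>I. c i \<otimes> f i x) = \<zero>)"
  using assms
proof (induction V arbitrary: I f)
  case empty
  then obtain i where "i \<in> I" by (metis card_gt_0_iff card.empty equals0I)
  then show ?case by (intro exI[of _ "\<lambda>_. \<one>"]) auto
next
  case (insert x V)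
  show ?case
  proof (cases "\<forall>i\<in>I. f i x = \<zero>")
    case True
    obtain c where c: "\<forall>i\<in>I. c i \<in> carrier R" "\<exists>i\<in>I. c i \<noteq> \<zero>" "\<forall>y\<in>V. (\<Oplus>i\<in>I. c i \<otimes> f i y) = \<zero>"
      using insert.IH[of I f] insert.prems insert.hyps by auto
    have "(\<Oplus>i\<in>I. c i \<otimes> f i x) = (\<Oplus>i\<in>I. \<zero>)"
      using True c(1) by (intro finsum_cong') auto
    then show ?thesis using c by (intro exI[of _ c]) (auto simp: finsum_zero)
  next
    case False
    then obtain j where j: "j \<in> I" "f j x \<noteq> \<zero>" by blast
    let ?I = "I - {j}"
    define t where "t i = f i x \<otimes> inv (f j x)" for i
    define f' where "f' i y = f i y \<ominus> t i \<otimes> f j y" for i y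
    note fcl = insert.prems(3)
    have fj: "f j x \<in> Units R" using j fcl by (simp add: field_Units)
    have tcl: "t i \<in> carrier R" if "i \<in> I" for i using that fcl fj by (simp add: t_def)
    have "card V < card ?I" using insert.prems insert.hyps j by simp
    then obtain c where c: "\<forall>i\<in>?I. c i \<in> carrier R" "\<exists>i\<in>?I. c i \<noteq> \<zero>" "\<forall>y\<in>V. (\<Oplus>i\<in>?I. c i \<otimes> f' i y) = \<zero>"
      using insert.IH[of ?I f'] insert.prems(1) fcl tcl j by (auto simp: f'_def)
    have f'x: "f' i x = \<zero>" if "i \<in> I" for i
      using that fcl fj j unfolding f'_def t_def by (simp add: m_assoc r_right_minus_eq)
    have "(\<Oplus>i\<in>?I. c i \<otimes> f' i x) = (\<Oplus>i\<in>?I. \<zero>)"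
      using f'x c(1) by (intro finsum_cong') auto
    then have c0: "(\<Oplus>i\<in>?I. c i \<otimes> f' i y) = \<zero>" if "y \<in> insert x V" for y
      using that c(3) by (auto simp: finsum_zero)
    \<comment> \<open>The coefficient of the pivot is chosen to absorb all the subtracted multiples,
      so that the new relation among the \<open>f i\<close> equals the relation found for the
      \<open>f' i\<close>.\<close>
    define s where "s = (\<Oplus>i\<in>?I. \<ominus> (c i \<otimes> t i))"
    let ?c = "c(j := s)"
    have scl: "s \<in> carrier R" unfolding s_def using c(1) tcl by (intro finsum_closed) auto
    have "(\<Oplus>i\<in>I. ?c i \<otimes> f i y) = \<zero>" if y: "y \<in> insert x V" for y
    proof -
      note fy = fcl[OF _ y]
      have "(\<Oplus>i\<in>I. ?c i \<otimes> f i y) = (\<Oplus>i\<in>insert j ?I. ?c i \<otimes> f i y)"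
        using j by (simp add: insert_absorb)
      also have "\<dots> = ?c j \<otimes> f j y \<oplus> (\<Oplus>i\<in>?I. ?c i \<otimes> f i y)"
        using insert.prems(1) fy j c(1) scl by (intro finsum_insert) auto
      also have "(\<Oplus>i\<in>?I. ?c i \<otimes> f i y) = (\<Oplus>i\<in>?I. c i \<otimes> f i y)"
        using fy c(1) by (intro finsum_cong') auto
      also have "?c j \<otimes> f j y = (\<Oplus>i\<in>?I. \<ominus> (c i \<otimes> t i) \<otimes> f j y)"
        unfolding fun_upd_same s_def using c(1) tcl insert.prems(1) fy j by (intro finsum_ldistr) auto
      also have "(\<Oplus>i\<in>?I. \<ominus> (c i \<otimes> t i) \<otimes> f j y) \<oplus> (\<Oplus>i\<in>?I. c i \<otimes> f i y) =
          (\<Oplus>i\<in>?I. \<ominus> (c i \<otimes> t i) \<otimes> f j y \<oplus> c i \<otimes> f i y)"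
        using c(1) tcl fy j by (intro finsum_addf[symmetric]) auto
      also have "\<dots> = (\<Oplus>i\<in>?I. c i \<otimes> f' i y)"
        using c(1) tcl fy j
        by (intro finsum_cong') (auto simp: f'_def r_distr a_minus_def l_minus r_minus m_assoc a_comm)
      finally show ?thesis using c0[OF y] by simp
    qed
    then show ?thesis using c(1,2) scl by (intro exI[of _ ?c]) auto
  qed
qed

lemma finsum_swap:
  assumes M: "abelian_group M" and "finite I" "finite J" "\<And>i j. i \<in> I \<Longrightarrow> j \<in> J \<Longrightarrow> f i j \<in> carrier M"
  shows "(\<Oplus>\<^bsub>M\<^esub>i\<in>I. \<Oplus>\<^bsub>M\<^esub>j\<in>J. f i j) = (\<Oplus>\<^bsub>M\<^esub>j\<in>J. \<Oplus>\<^bsub>M\<^esub>i\<in>I. f i j)"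
  using assms(2,4)
proof (induction I)
  case empty
  interpret M: abelian_group M by fact
  show ?case by (simp add: M.finsum_zero)
next
  case (insert i I)
  interpret M: abelian_group M by fact
  have cl: "(\<Oplus>\<^bsub>M\<^esub>j\<in>J. f l j) \<in> carrier M" if "l \<in> insert i I" for l
    using that insert.prems by (intro M.finsum_closed) auto
  have cl': "(\<Oplus>\<^bsub>M\<^esub>i\<in>I. f i j) \<in> carrier M" if "j \<in> J" for j
    using that insert.prems by (intro M.finsum_closed) auto
  have "(\<Oplus>\<^bsub>M\<^esub>i\<in>insert i I. \<Oplus>\<^bsub>M\<^esub>j\<in>J. f i j) = (\<Oplus>\<^bsub>M\<^esub>j\<in>J. f i j) \<oplus>\<^bsub>M\<^esub> (\<Oplus>\<^bsub>M\<^esub>j\<in>J. \<Oplus>\<^bsub>M\<^esub>i\<in>I. f i j)"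
    using insert cl by (subst M.finsum_insert) auto
  also have "\<dots> = (\<Oplus>\<^bsub>M\<^esub>j\<in>J. f i j \<oplus>\<^bsub>M\<^esub> (\<Oplus>\<^bsub>M\<^esub>i\<in>I. f i j))"
    using insert.prems cl' by (intro M.finsum_addf[symmetric]) auto
  also have "\<dots> = (\<Oplus>\<^bsub>M\<^esub>j\<in>J. \<Oplus>\<^bsub>M\<^esub>i\<in>insert i I. f i j)"
    using insert cl' by (intro M.finsum_cong') (auto simp: M.finsum_insert Pi_def)
  finally show ?case .
qed

section \<open>Orthogonality for pairings of a finite group\<close>

locale bicharacter = K: field K + G: comm_group G
  for K :: "('c, 'r) ring_scheme" and G :: "('g, 'x) monoid_scheme" (structure) +
  fixes \<chi> :: "'g \<Rightarrow> 'g \<Rightarrow> 'c"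
  assumes finite_G: "finite (carrier G)"
    and chi_closed: "\<lbrakk>g \<in> carrier G; h \<in> carrier G\<rbrakk> \<Longrightarrow> \<chi> g h \<in> carrier K"
    and chi_left: "\<lbrakk>g \<in> carrier G; g' \<in> carrier G; h \<in> carrier G\<rbrakk> \<Longrightarrow> \<chi> (g \<otimes> g') h = \<chi> g h \<otimes>\<^bsub>K\<^esub> \<chi> g' h"
    and chi_right: "\<lbrakk>g \<in> carrier G; h \<in> carrier G; h' \<in> carrier G\<rbrakk> \<Longrightarrow> \<chi> g (h \<otimes> h') = \<chi> g h \<otimes>\<^bsub>K\<^esub> \<chi> g h'"
    and chi_one_left: "h \<in> carrier G \<Longrightarrow> \<chi> \<one> h = \<one>\<^bsub>K\<^esub>"
    and chi_one_right: "g \<in> carrier G \<Longrightarrow> \<chi> g \<one> = \<one>\<^bsub>K\<^esub>"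
begin

definition N :: 'c where "N = (\<Oplus>\<^bsub>K\<^esub>g\<in>carrier G. \<one>\<^bsub>K\<^esub>)"

lemma N_closed: "N \<in> carrier K"
  unfolding N_def by (intro K.finsum_closed) auto

text \<open>Translating the summation variable by \<open>l\<close> multiplies the sum by \<chi>
  \<open>g l\<close>, which differs from one; in a field the sum must then vanish.\<close>

lemma chi_sum_zero:
  assumes g: "g \<in> carrier G" and l: "l \<in> carrier G" "\<chi> g l \<noteq> \<one>\<^bsub>K\<^esub>"
  shows "(\<Oplus>\<^bsub>K\<^esub>h\<in>carrier G. \<chi> g h) = \<zero>\<^bsub>K\<^esub>"
proof -
  let ?s = "\<Oplus>\<^bsub>K\<^esub>h\<in>carrier G. \<chi> g h"
  have s: "?s \<in> carrier K" using g by (intro K.finsum_closed) (auto simp: chi_closed)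
  have "?s = (\<Oplus>\<^bsub>K\<^esub>h\<in>(\<lambda>h. l \<otimes> h) ` carrier G. \<chi> g h)" using G.surj_const_mult[OF l(1)] by simp
  also have "\<dots> = (\<Oplus>\<^bsub>K\<^esub>h\<in>carrier G. \<chi> g (l \<otimes> h))"
    using g l by (intro K.finsum_reindex) (auto simp: chi_closed intro: G.inj_on_cmult)
  also have "\<dots> = (\<Oplus>\<^bsub>K\<^esub>h\<in>carrier G. \<chi> g l \<otimes>\<^bsub>K\<^esub> \<chi> g h)"
    using g l by (intro K.finsum_cong') (auto simp: chi_closed chi_right)
  also have "\<dots> = \<chi> g l \<otimes>\<^bsub>K\<^esub> ?s"
    using g l finite_G by (intro K.finsum_rdistr[symmetric]) (auto simp: chi_closed)
  finally have "?s = \<chi> g l \<otimes>\<^bsub>K\<^esub> ?s" .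
  then have "(\<chi> g l \<ominus>\<^bsub>K\<^esub> \<one>\<^bsub>K\<^esub>) \<otimes>\<^bsub>K\<^esub> ?s = \<zero>\<^bsub>K\<^esub>"
    using s chi_closed[OF g l(1)] by (simp add: a_minus_def K.l_distr K.l_minus K.r_neg)
  then show ?thesis using s chi_closed[OF g l(1)] l(2) K.integral by fastforce
qed

text \<open>Makes \<open>chi_sum_zero\<close> available for sums over the first argument as
  well.\<close>

lemma bicharacter_swap: "bicharacter K G (\<lambda>g h. \<chi> h g)"
  by unfold_locales (auto simp: finite_G chi_closed chi_left chi_right chi_one_left chi_one_right)

text \<open>If \<open>h\<close> were in the right kernel, the \<open>|G|\<close> functions \<open>\<chi> g\<close>, restricted to the
  \<open>|G| - 1\<close> points of \<open>G - {h}\<close>, would satisfy a linear relation; it would also hold at \<open>h\<close>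
  because the \<open>\<chi> g\<close> do not distinguish \<open>h\<close> from \<open>1\<close>, against orthogonality.\<close>

lemma right_nondegenerate:
  assumes nondeg: "\<And>g. g \<in> carrier G \<Longrightarrow> g \<noteq> \<one> \<Longrightarrow> \<exists>l\<in>carrier G. \<chi> g l \<noteq> \<one>\<^bsub>K\<^esub>"
    and N: "N \<noteq> \<zero>\<^bsub>K\<^esub>" and h: "h \<in> carrier G" "h \<noteq> \<one>"
  shows "\<exists>g\<in>carrier G. \<chi> g h \<noteq> \<one>\<^bsub>K\<^esub>"
proof (rule ccontr)
  assume neg: "\<not> (\<exists>g\<in>carrier G. \<chi> g h \<noteq> \<one>\<^bsub>K\<^esub>)"
  have "card (carrier G - {h}) < card (carrier G)"
    using h finite_G by (intro card_Diff1_less)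
  then obtain c where c: "\<forall>g\<in>carrier G. c g \<in> carrier K" "\<exists>g\<in>carrier G. c g \<noteq> \<zero>\<^bsub>K\<^esub>"
    "\<forall>x\<in>carrier G - {h}. (\<Oplus>\<^bsub>K\<^esub>g\<in>carrier G. c g \<otimes>\<^bsub>K\<^esub> \<chi> g x) = \<zero>\<^bsub>K\<^esub>"
    using K.linear_dependence[of "carrier G - {h}" "carrier G" \<chi>] finite_G chi_closed by auto
  have "(\<Oplus>\<^bsub>K\<^esub>g\<in>carrier G. c g \<otimes>\<^bsub>K\<^esub> \<chi> g h) = (\<Oplus>\<^bsub>K\<^esub>g\<in>carrier G. c g \<otimes>\<^bsub>K\<^esub> \<chi> g \<one>)"
    using neg c(1) chi_closed by (intro K.finsum_cong') (auto simp: chi_one_right)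
  then have c0: "(\<Oplus>\<^bsub>K\<^esub>g\<in>carrier G. c g \<otimes>\<^bsub>K\<^esub> \<chi> g x) = \<zero>\<^bsub>K\<^esub>" if "x \<in> carrier G" for x
    using c(3) h that by (cases "x = h") auto
  obtain g0 where g0: "g0 \<in> carrier G" "c g0 \<noteq> \<zero>\<^bsub>K\<^esub>" using c(2) by blast
  \<comment> \<open>Fourier inversion: multiplying the relation by the character of
    \<open>inv g0\<close> and summing over \<open>x\<close> isolates the coefficient at
    \<open>g0\<close>, multiplied by \<open>N\<close>. This is nonzero by choice of
    \<open>g0\<close>.\<close>
  have summand: "(\<Oplus>\<^bsub>K\<^esub>x\<in>carrier G. c g \<otimes>\<^bsub>K\<^esub> \<chi> g x \<otimes>\<^bsub>K\<^esub> \<chi> (inv g0) x) =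
      (if g0 = g then c g \<otimes>\<^bsub>K\<^esub> N else \<zero>\<^bsub>K\<^esub>)" if g: "g \<in> carrier G" for g
  proof -
    have "(\<Oplus>\<^bsub>K\<^esub>x\<in>carrier G. c g \<otimes>\<^bsub>K\<^esub> \<chi> g x \<otimes>\<^bsub>K\<^esub> \<chi> (inv g0) x) = (\<Oplus>\<^bsub>K\<^esub>x\<in>carrier G. c g \<otimes>\<^bsub>K\<^esub> \<chi> (g \<otimes> inv g0) x)"
      using g g0 c(1) by (intro K.finsum_cong') (auto simp: chi_closed chi_left K.m_assoc)
    also have "\<dots> = c g \<otimes>\<^bsub>K\<^esub> (\<Oplus>\<^bsub>K\<^esub>x\<in>carrier G. \<chi> (g \<otimes> inv g0) x)"
      using g g0 c(1) finite_G by (intro K.finsum_rdistr[symmetric]) (auto simp: chi_closed)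
    also have "(\<Oplus>\<^bsub>K\<^esub>x\<in>carrier G. \<chi> (g \<otimes> inv g0) x) = (if g0 = g then N else \<zero>\<^bsub>K\<^esub>)"
    proof (cases "g0 = g")
      case True
      then show ?thesis unfolding N_def using g
        by (auto simp: chi_one_left intro!: K.finsum_cong')
    next
      case False
      then have "g \<otimes> inv g0 \<noteq> \<one>" using g g0 G.inv_equality[of g "inv g0"] by auto
      then obtain l where "l \<in> carrier G" "\<chi> (g \<otimes> inv g0) l \<noteq> \<one>\<^bsub>K\<^esub>" using nondeg[of "g \<otimes> inv g0"] g g0 by auto
      then show ?thesis using False g g0 chi_sum_zero[of "g \<otimes> inv g0"] by simp
    qed
    finally show ?thesis using c(1) g by auto
  qed
  have "\<zero>\<^bsub>K\<^esub> = (\<Oplus>\<^bsub>K\<^esub>x\<in>carrier G. (\<Oplus>\<^bsub>K\<^esub>g\<in>carrier G. c g \<otimes>\<^bsub>K\<^esub> \<chi> g x) \<otimes>\<^bsub>K\<^esub> \<chi> (inv g0) x)"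
    using g0 by (intro K.add.finprod_one_eqI[symmetric]) (auto simp: c0 chi_closed)
  also have "\<dots> = (\<Oplus>\<^bsub>K\<^esub>x\<in>carrier G. \<Oplus>\<^bsub>K\<^esub>g\<in>carrier G. c g \<otimes>\<^bsub>K\<^esub> \<chi> g x \<otimes>\<^bsub>K\<^esub> \<chi> (inv g0) x)"
    using g0 c(1) finite_G
    by (intro K.finsum_cong' refl Pi_I K.finsum_closed) (auto simp: chi_closed intro!: K.finsum_ldistr)
  also have "\<dots> = (\<Oplus>\<^bsub>K\<^esub>g\<in>carrier G. \<Oplus>\<^bsub>K\<^esub>x\<in>carrier G. c g \<otimes>\<^bsub>K\<^esub> \<chi> g x \<otimes>\<^bsub>K\<^esub> \<chi> (inv g0) x)"
    using g0 c(1) finite_G by (intro finsum_swap K.is_abelian_group) (auto simp: chi_closed)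
  also have "\<dots> = (\<Oplus>\<^bsub>K\<^esub>g\<in>carrier G. if g0 = g then c g \<otimes>\<^bsub>K\<^esub> N else \<zero>\<^bsub>K\<^esub>)"
    using c(1) N_closed by (intro K.finsum_cong') (auto simp: summand)
  also have "\<dots> = c g0 \<otimes>\<^bsub>K\<^esub> N"
    using c(1) N_closed g0 finite_G by (intro K.finsum_singleton) auto
  finally show False using g0 N N_closed c(1) K.integral by metis
qed

end

section \<open>Infinite and finite universes\<close>

lemma infinite_encoding:
  assumes "infinite (UNIV :: 'm set)" "finite (I :: 'g set)" "I \<noteq> {}"
  obtains dec :: "'m \<Rightarrow> 'g \<Rightarrow> 'm" and enc where "\<forall>f. \<forall>g\<in>I. dec (enc f) g = f g"
    "\<forall>x y. (\<forall>g\<in>I. dec x g = dec y g) \<longrightarrow> x = y"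
proof -
  obtain gs where gs: "set gs = I" using assms(2) finite_list by blast
  obtain e where e: "bij_betw e (lists (UNIV :: 'm set)) (UNIV :: 'm set)"
    using lists_infinite_bij_betw[OF assms(1)] by metis
  \<comment> \<open>The universe embeds into the functions as constants. A function is determined by
    its list of values along \<open>gs\<close>, and the lists over an infinite type embed back into
    that type.\<close>
  have "\<exists>b. bij_betw b (UNIV :: 'm set) (I \<rightarrow>\<^sub>E (UNIV :: 'm set))"
  proof (rule Schroeder_Bernstein)
    show "inj_on (\<lambda>m. \<lambda>g\<in>I. m) (UNIV :: 'm set)"
      using assms(3) by (intro inj_onI) (metis ex_in_conv restrict_apply')
    show "inj_on (\<lambda>f. e (map f gs)) (I \<rightarrow>\<^sub>E (UNIV :: 'm set))"
    proof (rule inj_onI)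
      fix f f' assume *: "f \<in> I \<rightarrow>\<^sub>E UNIV" "f' \<in> I \<rightarrow>\<^sub>E UNIV" "e (map f gs) = e (map f' gs)"
      then have "map f gs = map f' gs" using e by (auto simp: bij_betw_def dest: inj_onD)
      then show "f = f'" using * gs by (intro PiE_ext[of f I _ f']) auto
    qed
  qed auto
  then obtain b where b: "bij_betw b (UNIV :: 'm set) (I \<rightarrow>\<^sub>E (UNIV :: 'm set))" by blast
  let ?enc = "\<lambda>f. inv_into UNIV b (restrict f I)"
  have "b (?enc f) = restrict f I" for f
    using b by (intro f_inv_into_f) (auto simp: bij_betw_def)
  moreover have "x = y" if "\<forall>g\<in>I. b x g = b y g" for x y
  proof -
    have "b x \<in> I \<rightarrow>\<^sub>E UNIV" "b y \<in> I \<rightarrow>\<^sub>E UNIV" using b by (auto simp: bij_betw_def)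
    then have "b x = b y" using that by (intro PiE_ext[of "b x" I _ "b y"]) auto
    then show ?thesis using b by (auto simp: bij_betw_def dest: injD)
  qed
  ultimately show thesis by (intro that[of b ?enc]) auto
qed

text \<open>By pigeonhole two distinct scalars act alike on a given \<open>x\<close>, so their
  difference \<open>z\<close> kills \<open>x\<close>; as \<open>z\<close> has the left inverse
  \<open>y\<close>, it follows that \<open>x\<close> is zero. The formulation with \<iota> covers
  the algebra, its twist and both opposite rings.\<close>

lemma lgldim_eq_0_if_finite_universe:
  fixes R :: "('a, 'r) ring_scheme" and \<iota> :: "'c \<Rightarrow> 'a"
  assumes "finite (UNIV :: 'm set)" "infinite K" "\<And>c. c \<in> K \<Longrightarrow> \<iota> c \<in> carrier R"
    and diff: "\<And>c c'. \<lbrakk>c \<in> K; c' \<in> K; c \<noteq> c'\<rbrakk> \<Longrightarrow>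
      \<exists>y\<in>carrier R. \<exists>z\<in>carrier R. \<iota> c = \<iota> c' \<oplus>\<^bsub>R\<^esub> z \<and> y \<otimes>\<^bsub>R\<^esub> z = \<one>\<^bsub>R\<^esub>"
  shows "lgldim TYPE('m) R = 0"
proof (rule lgldim_eq_0)
  fix M :: "('a, 'm) module"
  assume M: "left_module R M"
  interpret M: left_module R M by fact
  have "x = \<zero>\<^bsub>M\<^esub>" if x: "x \<in> carrier M" for x
  proof -
    have "\<not> inj_on (\<lambda>c. \<iota> c \<odot>\<^bsub>M\<^esub> x) K"
      using assms(1,2) by (meson finite_imageD finite_subset subset_UNIV)
    then obtain c c' where c: "c \<in> K" "c' \<in> K" "c \<noteq> c'" "\<iota> c \<odot>\<^bsub>M\<^esub> x = \<iota> c' \<odot>\<^bsub>M\<^esub> x"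
      by (auto simp: inj_on_def)
    then obtain y z where yz: "y \<in> carrier R" "z \<in> carrier R" "\<iota> c = \<iota> c' \<oplus>\<^bsub>R\<^esub> z" "y \<otimes>\<^bsub>R\<^esub> z = \<one>\<^bsub>R\<^esub>"
      using diff by blast
    have "\<iota> c' \<odot>\<^bsub>M\<^esub> x \<oplus>\<^bsub>M\<^esub> z \<odot>\<^bsub>M\<^esub> x = \<iota> c' \<odot>\<^bsub>M\<^esub> x \<oplus>\<^bsub>M\<^esub> \<zero>\<^bsub>M\<^esub>"
      using c yz x assms(3) by (simp add: M.smult_closed flip: M.smult_l_distr)
    then have "z \<odot>\<^bsub>M\<^esub> x = \<zero>\<^bsub>M\<^esub>"
      using c yz x assms(3) M.M.add.l_cancel by (meson M.M.zero_closed M.smult_closed)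
    then have "(y \<otimes>\<^bsub>R\<^esub> z) \<odot>\<^bsub>M\<^esub> x = \<zero>\<^bsub>M\<^esub>"
      using yz(1,2) x by (simp add: M.smult_assoc1 left_module_smult_zero[OF M])
    then show ?thesis using yz x by (simp add: M.smult_one)
  qed
  then show "carrier M = {\<zero>\<^bsub>M\<^esub>}" by auto
qed

section \<open>The cocycle twist of an algebra\<close>

locale twisted_algebra = K: algebraically_closed k + A: ring A + G: comm_group G + V: module k A + act: algebra_action k A G \<phi>
  for k :: "('c, 'r) ring_scheme" and A :: "('c, 'a) module" and G :: "('g, 'x) monoid_scheme" (structure)
    and \<phi> :: "'g \<Rightarrow> 'a \<Rightarrow> 'a" +
  fixes \<chi> \<mu> :: "'g \<Rightarrow> 'g \<Rightarrow> 'c"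
  assumes finite_G: "finite (carrier G)"
    and char: "\<not> characteristic k dvd order G"
    and iso: "\<chi> \<in> iso G (dual_group G k)"
    and cocycle: "normalised_2cocycle G k \<mu>"
begin

section \<open>The characters of \<open>G\<close> and their orthogonality relations\<close>

lemma chi_hom: "g \<in> carrier G \<Longrightarrow> \<chi> g \<in> hom G (units_of k)"
  and chi_extensional: "g \<in> carrier G \<Longrightarrow> \<chi> g \<in> extensional (carrier G)"
  using iso by (auto simp: iso_def hom_def dual_group_def)

lemma chi_Units: "g \<in> carrier G \<Longrightarrow> h \<in> carrier G \<Longrightarrow> \<chi> g h \<in> Units k"
  using chi_hom[of g] by (auto simp: hom_def units_of_carrier)

lemma chi_mult: "\<lbrakk>g \<in> carrier G; g' \<in> carrier G; h \<in> carrier G\<rbrakk> \<Longrightarrow> \<chi> (g \<otimes> g') h = \<chi> g h \<otimes>\<^bsub>k\<^esub> \<chi> g' h"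
  using iso by (auto simp: iso_def hom_def dual_group_def)

lemma Units_idem: "x \<in> Units k \<Longrightarrow> x = x \<otimes>\<^bsub>k\<^esub> x \<Longrightarrow> x = \<one>\<^bsub>k\<^esub>"
  by (metis K.Units_closed K.Units_l_cancel K.one_closed K.r_one)

sublocale chi: bicharacter k G \<chi>
proof
  fix g h h' assume "g \<in> carrier G" "h \<in> carrier G" "h' \<in> carrier G"
  then show "\<chi> g (h \<otimes> h') = \<chi> g h \<otimes>\<^bsub>k\<^esub> \<chi> g h'"
    using chi_hom[of g] by (auto simp: hom_def units_of_mult)
next
  fix g assume g: "g \<in> carrier G"
  then have "\<chi> g (\<one> \<otimes> \<one>) = \<chi> g \<one> \<otimes>\<^bsub>k\<^esub> \<chi> g \<one>"
    using hom_mult[OF chi_hom[OF g] G.one_closed G.one_closed] by (simp add: units_of_mult)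
  then show "\<chi> g \<one> = \<one>\<^bsub>k\<^esub>" using g chi_Units[of g \<one>] Units_idem by simp
  show "\<chi> \<one> g = \<one>\<^bsub>k\<^esub>" using g chi_mult[of \<one> \<one> g] chi_Units[of \<one> g] Units_idem by simp
qed (use finite_G chi_Units chi_mult in auto)

text \<open>This is injectivity of \<chi>: an element whose character is trivial has the same
  extensional character as \<open>\<one>\<close>.\<close>

lemma chi_nondegenerate:
  assumes "g \<in> carrier G" "g \<noteq> \<one>"
  shows "\<exists>l\<in>carrier G. \<chi> g l \<noteq> \<one>\<^bsub>k\<^esub>"
proof (rule ccontr)
  assume "\<not> ?thesis"
  then have "\<chi> g = \<chi> \<one>"
    using assms chi_extensional by (intro extensionalityI[of _ "carrier G"]) (auto simp: chi.chi_one_left)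
  moreover have "inj_on \<chi> (carrier G)" using iso by (auto simp: iso_def bij_betw_def)
  ultimately show False using assms by (auto dest: inj_onD)
qed

text \<open>The characteristic is the additive order of one, so if |G| vanished in \<open>k\<close>,
  that order would divide |G|.\<close>

lemma N_Units: "chi.N \<in> Units k"
proof -
  have "chi.N = \<one>\<^bsub>k\<^esub> [^]\<^bsub>add_monoid k\<^esub> order G"
    unfolding chi.N_def using K.add.finprod_const[of "\<one>\<^bsub>k\<^esub>" "carrier G"] by (simp add: order_def add_pow_def)
  then have "chi.N \<noteq> \<zero>\<^bsub>k\<^esub>" using char group.pow_eq_id[OF K.a_group, of "\<one>\<^bsub>k\<^esub>" "order G"] by (simp add: characteristic_def)
  then show ?thesis using chi.N_closed by (simp add: K.field_Units)
qed

lemma chi_row: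
  assumes "g \<in> carrier G"
  shows "(\<Oplus>\<^bsub>k\<^esub>h\<in>carrier G. \<chi> g h) = (if g = \<one> then chi.N else \<zero>\<^bsub>k\<^esub>)"
proof (cases "g = \<one>")
  case True
  then show ?thesis unfolding chi.N_def by (auto simp: chi.chi_one_left intro!: K.finsum_cong')
next
  case False
  then show ?thesis using chi_nondegenerate[OF assms] chi.chi_sum_zero[OF assms] by auto
qed

text \<open>Row sums make the projections below orthogonal; column sums make them add up to the
  identity. The latter need nondegeneracy in the second argument, which
  \<open>right_nondegenerate\<close> derives from the first.\<close>

lemma chi_column:
  assumes "h \<in> carrier G"
  shows "(\<Oplus>\<^bsub>k\<^esub>g\<in>carrier G. \<chi> g h) = (if h = \<one> then chi.N else \<zero>\<^bsub>k\<^esub>)"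
proof (cases "h = \<one>")
  case True
  then show ?thesis unfolding chi.N_def by (auto simp: chi.chi_one_right intro!: K.finsum_cong')
next
  case False
  have "chi.N \<noteq> \<zero>\<^bsub>k\<^esub>" using N_Units by (simp add: K.field_Units)
  then show ?thesis
    using False chi.right_nondegenerate[OF chi_nondegenerate _ assms False]
      bicharacter.chi_sum_zero[OF chi.bicharacter_swap assms] by auto
qed

section \<open>Decomposition of \<open>A\<close> into eigenspaces\<close>

lemma phi_closed: "g \<in> carrier G \<Longrightarrow> a \<in> carrier A \<Longrightarrow> \<phi> g a \<in> carrier A"
  and phi_add: "g \<in> carrier G \<Longrightarrow> a \<in> carrier A \<Longrightarrow> b \<in> carrier A \<Longrightarrow> \<phi> g (a \<oplus>\<^bsub>A\<^esub> b) = \<phi> g a \<oplus>\<^bsub>A\<^esub> \<phi> g b"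
  and phi_mult: "g \<in> carrier G \<Longrightarrow> a \<in> carrier A \<Longrightarrow> b \<in> carrier A \<Longrightarrow> \<phi> g (a \<otimes>\<^bsub>A\<^esub> b) = \<phi> g a \<otimes>\<^bsub>A\<^esub> \<phi> g b"
  and phi_one: "g \<in> carrier G \<Longrightarrow> \<phi> g \<one>\<^bsub>A\<^esub> = \<one>\<^bsub>A\<^esub>"
  using act.action_ring_hom[of g] by (auto simp: ring_hom_def)

lemma phi_id: "a \<in> carrier A \<Longrightarrow> \<phi> \<one> a = a"
  using act.id_eq_one by (metis restrict_apply')

lemma smult_sum:
  assumes "finite I" "c \<in> carrier k" "\<And>i. i \<in> I \<Longrightarrow> x i \<in> carrier A"
  shows "c \<odot>\<^bsub>A\<^esub> (\<Oplus>\<^bsub>A\<^esub>i\<in>I. x i) = (\<Oplus>\<^bsub>A\<^esub>i\<in>I. c \<odot>\<^bsub>A\<^esub> x i)"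
  using assms by (intro additive_finsum A.is_abelian_group) (auto simp: hom_def V.smult_r_distr)

lemma sum_smult:
  assumes "finite I" "a \<in> carrier A" "\<And>i. i \<in> I \<Longrightarrow> c i \<in> carrier k"
  shows "(\<Oplus>\<^bsub>k\<^esub>i\<in>I. c i) \<odot>\<^bsub>A\<^esub> a = (\<Oplus>\<^bsub>A\<^esub>i\<in>I. c i \<odot>\<^bsub>A\<^esub> a)"
  using assms
  by (intro additive_finsum[where f = "\<lambda>c. c \<odot>\<^bsub>A\<^esub> a"] A.is_abelian_group K.is_abelian_group)
    (auto simp: hom_def V.smult_l_distr)

text \<open>The usual averaging projection onto an eigenspace, which weights each group element by
  the inverse of the eigencharacter. In degree \<open>g\<close> that character is \<chi>
  \<open>(inv g)\<close>, hence the weight \<chi> \<open>g h\<close> without an inverse.\<close>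

definition proj :: "'g \<Rightarrow> 'a \<Rightarrow> 'a" where
  "proj g a = inv\<^bsub>k\<^esub> chi.N \<odot>\<^bsub>A\<^esub> (\<Oplus>\<^bsub>A\<^esub>h\<in>carrier G. \<chi> g h \<odot>\<^bsub>A\<^esub> \<phi> h a)"

lemma invN_closed: "inv\<^bsub>k\<^esub> chi.N \<in> carrier k"
  using N_Units by simp

lemma invN_smult: "a \<in> carrier A \<Longrightarrow> inv\<^bsub>k\<^esub> chi.N \<odot>\<^bsub>A\<^esub> (chi.N \<odot>\<^bsub>A\<^esub> a) = a"
  using N_Units chi.N_closed by (simp flip: V.smult_assoc1)

lemma term_closed: "\<lbrakk>g \<in> carrier G; h \<in> carrier G; a \<in> carrier A\<rbrakk> \<Longrightarrow> \<chi> g h \<odot>\<^bsub>A\<^esub> \<phi> h a \<in> carrier A"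
  by (simp add: chi.chi_closed phi_closed)

lemma proj_closed: "g \<in> carrier G \<Longrightarrow> a \<in> carrier A \<Longrightarrow> proj g a \<in> carrier A"
  unfolding proj_def by (intro V.smult_closed invN_closed A.finsum_closed) (auto simp: term_closed)

lemma proj_add:
  assumes "g \<in> carrier G" "a \<in> carrier A" "b \<in> carrier A"
  shows "proj g (a \<oplus>\<^bsub>A\<^esub> b) = proj g a \<oplus>\<^bsub>A\<^esub> proj g b"
proof -
  have "(\<Oplus>\<^bsub>A\<^esub>h\<in>carrier G. \<chi> g h \<odot>\<^bsub>A\<^esub> \<phi> h (a \<oplus>\<^bsub>A\<^esub> b)) =
      (\<Oplus>\<^bsub>A\<^esub>h\<in>carrier G. \<chi> g h \<odot>\<^bsub>A\<^esub> \<phi> h a \<oplus>\<^bsub>A\<^esub> \<chi> g h \<odot>\<^bsub>A\<^esub> \<phi> h b)"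
    using assms by (intro A.finsum_cong') (auto simp: phi_add phi_closed chi.chi_closed V.smult_r_distr)
  also have "\<dots> = (\<Oplus>\<^bsub>A\<^esub>h\<in>carrier G. \<chi> g h \<odot>\<^bsub>A\<^esub> \<phi> h a) \<oplus>\<^bsub>A\<^esub> (\<Oplus>\<^bsub>A\<^esub>h\<in>carrier G. \<chi> g h \<odot>\<^bsub>A\<^esub> \<phi> h b)"
    using assms by (intro A.finsum_addf) (auto simp: term_closed)
  finally show ?thesis unfolding proj_def using assms invN_closed
    by (simp add: V.smult_r_distr A.finsum_closed Pi_def term_closed)
qed

text \<open>Applying \<phi> \<open>l\<close> turns the group element \<open>h\<close> into
  \<open>l \<otimes> h\<close> but keeps its weight. Reindexing the sum by translation produces the
  factor \<chi> \<open>(inv g) l\<close>.\<close>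

lemma phi_proj:
  assumes l: "l \<in> carrier G" and g: "g \<in> carrier G" and a: "a \<in> carrier A"
  shows "\<phi> l (proj g a) = \<chi> (inv g) l \<odot>\<^bsub>A\<^esub> proj g a"
proof -
  let ?t = "\<lambda>h. \<chi> g h \<odot>\<^bsub>A\<^esub> \<phi> h a"
  have t: "?t h \<in> carrier A" if "h \<in> carrier G" for h using that g a by (rule_tac term_closed)
  have "\<chi> (inv g) l \<otimes>\<^bsub>k\<^esub> \<chi> g l = \<one>\<^bsub>k\<^esub>"
    using l g chi.chi_left[of "inv g" g l] by (simp add: chi.chi_one_left)
  then have inv: "\<chi> (inv g) l \<otimes>\<^bsub>k\<^esub> \<chi> g (l \<otimes> h) = \<chi> g h" if "h \<in> carrier G" for h
    using that l g by (simp add: chi.chi_right chi.chi_closed flip: K.m_assoc)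
  have "(\<Oplus>\<^bsub>A\<^esub>h\<in>carrier G. ?t h) = (\<Oplus>\<^bsub>A\<^esub>h\<in>(\<lambda>h. l \<otimes> h) ` carrier G. ?t h)"
    using G.surj_const_mult[OF l] by simp
  also have "\<dots> = (\<Oplus>\<^bsub>A\<^esub>h\<in>carrier G. ?t (l \<otimes> h))"
    using l t by (intro A.finsum_reindex) (auto intro: G.inj_on_cmult)
  finally have "\<chi> (inv g) l \<odot>\<^bsub>A\<^esub> (\<Oplus>\<^bsub>A\<^esub>h\<in>carrier G. ?t h) =
      (\<Oplus>\<^bsub>A\<^esub>h\<in>carrier G. \<chi> (inv g) l \<odot>\<^bsub>A\<^esub> ?t (l \<otimes> h))"
    using l t g finite_G by (simp add: smult_sum chi.chi_closed)
  also have "\<dots> = (\<Oplus>\<^bsub>A\<^esub>h\<in>carrier G. \<phi> l (?t h))"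
    using l g a t inv phi_closed
    by (intro A.finsum_cong') (auto simp: chi.chi_closed act.action_smult act.composition_rule simp flip: V.smult_assoc1)
  also have "\<dots> = \<phi> l (\<Oplus>\<^bsub>A\<^esub>h\<in>carrier G. ?t h)"
    using l t finite_G by (intro additive_finsum[symmetric] A.is_abelian_group) (auto simp: hom_def phi_add phi_closed)
  finally have eq: "\<phi> l (\<Oplus>\<^bsub>A\<^esub>h\<in>carrier G. ?t h) = \<chi> (inv g) l \<odot>\<^bsub>A\<^esub> (\<Oplus>\<^bsub>A\<^esub>h\<in>carrier G. ?t h)" ..
  have s: "(\<Oplus>\<^bsub>A\<^esub>h\<in>carrier G. ?t h) \<in> carrier A" using t by (intro A.finsum_closed) auto
  have c: "\<chi> (inv g) l \<in> carrier k" using l g by (simp add: chi.chi_closed)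
  show ?thesis unfolding proj_def act.action_smult[OF l invN_closed s] eq
    using c invN_closed s K.m_comm[OF c invN_closed] by (simp flip: V.smult_assoc1)
qed

lemma proj_in_graded_part: "g \<in> carrier G \<Longrightarrow> a \<in> carrier A \<Longrightarrow> proj g a \<in> graded_part A G \<phi> \<chi> g"
  by (simp add: graded_part_def proj_closed phi_proj)

text \<open>On an element of degree \<open>g'\<close> the average becomes the character sum for
  \<open>g \<otimes> inv g'\<close>, which is evaluated by the row relation.\<close>

lemma proj_graded_part:
  assumes g: "g \<in> carrier G" and g': "g' \<in> carrier G" and b: "b \<in> graded_part A G \<phi> \<chi> g'"
  shows "proj g b = (if g = g' then b else \<zero>\<^bsub>A\<^esub>)"
proof -
  have bA: "b \<in> carrier A" using b by (simp add: graded_part_def)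
  have "(\<Oplus>\<^bsub>A\<^esub>h\<in>carrier G. \<chi> g h \<odot>\<^bsub>A\<^esub> \<phi> h b) = (\<Oplus>\<^bsub>A\<^esub>h\<in>carrier G. \<chi> (g \<otimes> inv g') h \<odot>\<^bsub>A\<^esub> b)"
    using g g' b by (intro A.finsum_cong') (auto simp: graded_part_def chi.chi_left chi.chi_closed V.smult_assoc1)
  also have "\<dots> = (\<Oplus>\<^bsub>k\<^esub>h\<in>carrier G. \<chi> (g \<otimes> inv g') h) \<odot>\<^bsub>A\<^esub> b"
    using g g' bA finite_G by (intro sum_smult[symmetric]) (auto simp: chi.chi_closed)
  also have "\<dots> = (if g \<otimes> inv g' = \<one> then chi.N else \<zero>\<^bsub>k\<^esub>) \<odot>\<^bsub>A\<^esub> b"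
    using g g' by (simp add: chi_row)
  also have "g \<otimes> inv g' = \<one> \<longleftrightarrow> g = g'"
    using g g' by (metis G.inv_closed G.inv_equality G.inv_inv G.r_inv)
  finally show ?thesis unfolding proj_def using bA invN_closed by (simp add: invN_smult)
qed

text \<open>After exchanging the sums, the column relation removes every group element except
  \<open>\<one>\<close>, which acts trivially.\<close>

lemma proj_sum:
  assumes a: "a \<in> carrier A"
  shows "(\<Oplus>\<^bsub>A\<^esub>g\<in>carrier G. proj g a) = a"
proof -
  have "(\<Oplus>\<^bsub>A\<^esub>g\<in>carrier G. proj g a) = inv\<^bsub>k\<^esub> chi.N \<odot>\<^bsub>A\<^esub> (\<Oplus>\<^bsub>A\<^esub>g\<in>carrier G. \<Oplus>\<^bsub>A\<^esub>h\<in>carrier G. \<chi> g h \<odot>\<^bsub>A\<^esub> \<phi> h a)"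
    unfolding proj_def using a finite_G invN_closed
    by (intro smult_sum[symmetric]) (auto intro!: A.finsum_closed simp: term_closed)
  also have "(\<Oplus>\<^bsub>A\<^esub>g\<in>carrier G. \<Oplus>\<^bsub>A\<^esub>h\<in>carrier G. \<chi> g h \<odot>\<^bsub>A\<^esub> \<phi> h a) =
      (\<Oplus>\<^bsub>A\<^esub>h\<in>carrier G. \<Oplus>\<^bsub>A\<^esub>g\<in>carrier G. \<chi> g h \<odot>\<^bsub>A\<^esub> \<phi> h a)"
    using a finite_G by (intro finsum_swap A.is_abelian_group) (auto simp: term_closed)
  also have "\<dots> = (\<Oplus>\<^bsub>A\<^esub>h\<in>carrier G. (\<Oplus>\<^bsub>k\<^esub>g\<in>carrier G. \<chi> g h) \<odot>\<^bsub>A\<^esub> \<phi> h a)"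
    using a finite_G
    by (intro A.finsum_cong' sum_smult[symmetric])
      (auto simp: chi.chi_closed phi_closed intro!: V.smult_closed K.finsum_closed)
  also have "\<dots> = (\<Oplus>\<^bsub>A\<^esub>h\<in>carrier G. if \<one> = h then chi.N \<odot>\<^bsub>A\<^esub> \<phi> h a else \<zero>\<^bsub>A\<^esub>)"
    using a chi.N_closed by (intro A.finsum_cong') (auto simp: chi_column phi_closed)
  also have "\<dots> = chi.N \<odot>\<^bsub>A\<^esub> \<phi> \<one> a"
    using a chi.N_closed finite_G by (intro A.finsum_singleton) (auto simp: phi_closed)
  finally show ?thesis using a by (simp add: phi_id invN_smult)
qed

lemma graded_part_one: "\<one>\<^bsub>A\<^esub> \<in> graded_part A G \<phi> \<chi> \<one>"
  by (simp add: graded_part_def phi_one chi.chi_one_left)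

lemma smult_mult_smult:
  "\<lbrakk>c \<in> carrier k; d \<in> carrier k; a \<in> carrier A; b \<in> carrier A\<rbrakk> \<Longrightarrow>
    (c \<odot>\<^bsub>A\<^esub> a) \<otimes>\<^bsub>A\<^esub> (d \<odot>\<^bsub>A\<^esub> b) = (c \<otimes>\<^bsub>k\<^esub> d) \<odot>\<^bsub>A\<^esub> (a \<otimes>\<^bsub>A\<^esub> b)"
  by (simp add: act.smult_mult_left act.smult_mult_right K.m_comm flip: V.smult_assoc1)

lemma graded_part_mult:
  assumes "g \<in> carrier G" "h \<in> carrier G" "a \<in> graded_part A G \<phi> \<chi> g" "b \<in> graded_part A G \<phi> \<chi> h"
  shows "a \<otimes>\<^bsub>A\<^esub> b \<in> graded_part A G \<phi> \<chi> (g \<otimes> h)"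
  using assms by (auto simp: graded_part_def phi_mult smult_mult_smult chi.chi_closed chi.chi_left G.inv_mult)

sublocale gr: graded_ring A G proj
proof
  show "proj g (proj h a) = (if g = h then proj g a else \<zero>\<^bsub>A\<^esub>)"
    if "g \<in> carrier G" "h \<in> carrier G" "a \<in> carrier A" for g h a
    using that proj_graded_part[OF that(1,2) proj_in_graded_part] by simp
  show "proj \<one> \<one>\<^bsub>A\<^esub> = \<one>\<^bsub>A\<^esub>" using proj_graded_part[OF _ _ graded_part_one] by simp
  fix g h a b assume *: "g \<in> carrier G" "h \<in> carrier G" "a \<in> carrier A" "b \<in> carrier A"
    "proj g a = a" "proj h b = b"
  then have "a \<otimes>\<^bsub>A\<^esub> b \<in> graded_part A G \<phi> \<chi> (g \<otimes> h)"
    using proj_in_graded_part[of g a] proj_in_graded_part[of h b] by (intro graded_part_mult) auto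
  from proj_graded_part[OF _ _ this] show "proj (g \<otimes> h) (a \<otimes>\<^bsub>A\<^esub> b) = a \<otimes>\<^bsub>A\<^esub> b" using * by simp
qed (auto simp: finite_G proj_closed proj_add proj_sum)

text \<open>The definite description is resolved: \<open>proj\<close> gives one homogeneous
  decomposition, and applying \<open>proj g\<close> to any other extracts its term of degree
  \<open>g\<close>.\<close>

lemma components_eq:
  assumes a: "a \<in> carrier A" and g: "g \<in> carrier G"
  shows "components A G \<phi> \<chi> a g = proj g a"
proof -
  have "components A G \<phi> \<chi> a = (\<lambda>g\<in>carrier G. proj g a)"
    unfolding components_def
  proof (rule the_equality)
    have "(\<Oplus>\<^bsub>A\<^esub>g\<in>carrier G. (\<lambda>g\<in>carrier G. proj g a) g) = (\<Oplus>\<^bsub>A\<^esub>g\<in>carrier G. proj g a)"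
      using a by (intro A.finsum_cong') (auto simp: proj_closed)
    then show "(\<lambda>g\<in>carrier G. proj g a) \<in> (\<Pi>\<^sub>E g\<in>carrier G. graded_part A G \<phi> \<chi> g) \<and>
        (\<Oplus>\<^bsub>A\<^esub>g\<in>carrier G. (\<lambda>g\<in>carrier G. proj g a) g) = a"
      using a by (auto simp: proj_in_graded_part proj_sum)
  next
    fix c assume c: "c \<in> (\<Pi>\<^sub>E g\<in>carrier G. graded_part A G \<phi> \<chi> g) \<and> (\<Oplus>\<^bsub>A\<^esub>g\<in>carrier G. c g) = a"
    have cg: "c g \<in> graded_part A G \<phi> \<chi> g" "c g \<in> carrier A" if "g \<in> carrier G" for g
      using c that by (auto simp: graded_part_def PiE_iff)
    show "c = (\<lambda>g\<in>carrier G. proj g a)"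
    proof (rule extensionalityI[of _ "carrier G"])
      fix g assume g: "g \<in> carrier G"
      have "proj g a = (\<Oplus>\<^bsub>A\<^esub>h\<in>carrier G. proj g (c h))"
        using c cg finite_G g additive_finsum[OF A.is_abelian_group A.is_abelian_group, of "proj g" "carrier G" c]
        by (auto simp: hom_def proj_closed proj_add)
      also have "\<dots> = (\<Oplus>\<^bsub>A\<^esub>h\<in>carrier G. if g = h then c h else \<zero>\<^bsub>A\<^esub>)"
        using cg g by (intro A.finsum_cong') (auto simp: proj_graded_part)
      also have "\<dots> = c g" using cg g finite_G by (intro A.finsum_singleton) auto
      finally show "c g = (\<lambda>g\<in>carrier G. proj g a) g" using g by simp
    qed (use c in \<open>auto simp: PiE_iff\<close>)
  qed
  then show ?thesis using g by simp
qed

section \<open>Ring structure of the twist\<close>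

abbreviation "B \<equiv> cocycle_twist A G \<phi> \<chi> \<mu>"

lemma twist_simps [simp]:
  "carrier B = carrier A" "\<zero>\<^bsub>B\<^esub> = \<zero>\<^bsub>A\<^esub>" "\<one>\<^bsub>B\<^esub> = \<one>\<^bsub>A\<^esub>" "x \<oplus>\<^bsub>B\<^esub> y = x \<oplus>\<^bsub>A\<^esub> y"
  by (simp_all add: cocycle_twist_def)

lemma mu_Units: "\<lbrakk>g \<in> carrier G; h \<in> carrier G\<rbrakk> \<Longrightarrow> \<mu> g h \<in> Units k"
  and mu_cocycle: "\<lbrakk>g \<in> carrier G; h \<in> carrier G; l \<in> carrier G\<rbrakk> \<Longrightarrow>
    \<mu> g h \<otimes>\<^bsub>k\<^esub> \<mu> (g \<otimes> h) l = \<mu> g (h \<otimes> l) \<otimes>\<^bsub>k\<^esub> \<mu> h l"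
  and mu_one: "g \<in> carrier G \<Longrightarrow> \<mu> \<one> g = \<one>\<^bsub>k\<^esub>" "g \<in> carrier G \<Longrightarrow> \<mu> g \<one> = \<one>\<^bsub>k\<^esub>"
  using cocycle by (auto simp: normalised_2cocycle_def)

lemma mu_closed: "\<lbrakk>g \<in> carrier G; h \<in> carrier G\<rbrakk> \<Longrightarrow> \<mu> g h \<in> carrier k"
  using mu_Units by auto

lemma twist_mult:
  assumes "a \<in> carrier A" "b \<in> carrier A"
  shows "a \<otimes>\<^bsub>B\<^esub> b = (\<Oplus>\<^bsub>A\<^esub>g\<in>carrier G. \<Oplus>\<^bsub>A\<^esub>h\<in>carrier G. \<mu> g h \<odot>\<^bsub>A\<^esub> (proj g a \<otimes>\<^bsub>A\<^esub> proj h b))"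
proof -
  have "a \<otimes>\<^bsub>B\<^esub> b = (\<Oplus>\<^bsub>A\<^esub>g\<in>carrier G. \<Oplus>\<^bsub>A\<^esub>h\<in>carrier G.
      \<mu> g h \<odot>\<^bsub>A\<^esub> (components A G \<phi> \<chi> a g \<otimes>\<^bsub>A\<^esub> components A G \<phi> \<chi> b h))"
    by (simp add: cocycle_twist_def)
  also have "\<dots> = (\<Oplus>\<^bsub>A\<^esub>g\<in>carrier G. \<Oplus>\<^bsub>A\<^esub>h\<in>carrier G. \<mu> g h \<odot>\<^bsub>A\<^esub> (proj g a \<otimes>\<^bsub>A\<^esub> proj h b))"
    using assms by (intro A.finsum_cong') (auto simp: components_eq proj_closed mu_closed intro!: A.finsum_closed A.finsum_cong')
  finally show ?thesis .
qed

lemma twist_closed: "\<lbrakk>a \<in> carrier A; b \<in> carrier A\<rbrakk> \<Longrightarrow> a \<otimes>\<^bsub>B\<^esub> b \<in> carrier A"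
  unfolding twist_mult by (intro A.finsum_closed Pi_I V.smult_closed mu_closed A.m_closed proj_closed)

lemma twist_l_distr:
  assumes "a \<in> carrier A" "b \<in> carrier A" "c \<in> carrier A"
  shows "(a \<oplus>\<^bsub>A\<^esub> b) \<otimes>\<^bsub>B\<^esub> c = a \<otimes>\<^bsub>B\<^esub> c \<oplus>\<^bsub>A\<^esub> b \<otimes>\<^bsub>B\<^esub> c"
proof -
  let ?f = "\<lambda>a g h. \<mu> g h \<odot>\<^bsub>A\<^esub> (proj g a \<otimes>\<^bsub>A\<^esub> proj h c)"
  have cl: "?f a g h \<in> carrier A" if "a \<in> carrier A" "g \<in> carrier G" "h \<in> carrier G" for a g h
    using that assms(3) by (simp add: mu_closed proj_closed)
  have "(\<Oplus>\<^bsub>A\<^esub>h\<in>carrier G. ?f (a \<oplus>\<^bsub>A\<^esub> b) g h) = (\<Oplus>\<^bsub>A\<^esub>h\<in>carrier G. ?f a g h) \<oplus>\<^bsub>A\<^esub> (\<Oplus>\<^bsub>A\<^esub>h\<in>carrier G. ?f b g h)"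
    if g: "g \<in> carrier G" for g
  proof -
    have "(\<Oplus>\<^bsub>A\<^esub>h\<in>carrier G. ?f (a \<oplus>\<^bsub>A\<^esub> b) g h) = (\<Oplus>\<^bsub>A\<^esub>h\<in>carrier G. ?f a g h \<oplus>\<^bsub>A\<^esub> ?f b g h)"
      using assms g by (intro A.finsum_cong') (auto simp: proj_add proj_closed mu_closed A.l_distr V.smult_r_distr)
    also have "\<dots> = (\<Oplus>\<^bsub>A\<^esub>h\<in>carrier G. ?f a g h) \<oplus>\<^bsub>A\<^esub> (\<Oplus>\<^bsub>A\<^esub>h\<in>carrier G. ?f b g h)"
      using assms g cl by (intro A.finsum_addf) auto
    finally show ?thesis .
  qed
  then have "(\<Oplus>\<^bsub>A\<^esub>g\<in>carrier G. \<Oplus>\<^bsub>A\<^esub>h\<in>carrier G. ?f (a \<oplus>\<^bsub>A\<^esub> b) g h) =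
      (\<Oplus>\<^bsub>A\<^esub>g\<in>carrier G. (\<Oplus>\<^bsub>A\<^esub>h\<in>carrier G. ?f a g h) \<oplus>\<^bsub>A\<^esub> (\<Oplus>\<^bsub>A\<^esub>h\<in>carrier G. ?f b g h))"
    using assms cl by (intro A.finsum_cong') (auto intro!: A.finsum_closed A.a_closed)
  also have "\<dots> = (\<Oplus>\<^bsub>A\<^esub>g\<in>carrier G. \<Oplus>\<^bsub>A\<^esub>h\<in>carrier G. ?f a g h) \<oplus>\<^bsub>A\<^esub> (\<Oplus>\<^bsub>A\<^esub>g\<in>carrier G. \<Oplus>\<^bsub>A\<^esub>h\<in>carrier G. ?f b g h)"
    using assms cl by (intro A.finsum_addf) (auto intro!: A.finsum_closed)
  finally show ?thesis using assms by (simp add: twist_mult)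
qed

lemma twist_r_distr:
  assumes "a \<in> carrier A" "b \<in> carrier A" "c \<in> carrier A"
  shows "c \<otimes>\<^bsub>B\<^esub> (a \<oplus>\<^bsub>A\<^esub> b) = c \<otimes>\<^bsub>B\<^esub> a \<oplus>\<^bsub>A\<^esub> c \<otimes>\<^bsub>B\<^esub> b"
proof -
  let ?f = "\<lambda>a g h. \<mu> g h \<odot>\<^bsub>A\<^esub> (proj g c \<otimes>\<^bsub>A\<^esub> proj h a)"
  have cl: "?f a g h \<in> carrier A" if "a \<in> carrier A" "g \<in> carrier G" "h \<in> carrier G" for a g h
    using that assms(3) by (simp add: mu_closed proj_closed)
  have "(\<Oplus>\<^bsub>A\<^esub>h\<in>carrier G. ?f (a \<oplus>\<^bsub>A\<^esub> b) g h) = (\<Oplus>\<^bsub>A\<^esub>h\<in>carrier G. ?f a g h) \<oplus>\<^bsub>A\<^esub> (\<Oplus>\<^bsub>A\<^esub>h\<in>carrier G. ?f b g h)"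
    if g: "g \<in> carrier G" for g
  proof -
    have "(\<Oplus>\<^bsub>A\<^esub>h\<in>carrier G. ?f (a \<oplus>\<^bsub>A\<^esub> b) g h) = (\<Oplus>\<^bsub>A\<^esub>h\<in>carrier G. ?f a g h \<oplus>\<^bsub>A\<^esub> ?f b g h)"
      using assms g by (intro A.finsum_cong') (auto simp: proj_add proj_closed mu_closed A.r_distr V.smult_r_distr)
    also have "\<dots> = (\<Oplus>\<^bsub>A\<^esub>h\<in>carrier G. ?f a g h) \<oplus>\<^bsub>A\<^esub> (\<Oplus>\<^bsub>A\<^esub>h\<in>carrier G. ?f b g h)"
      using assms g cl by (intro A.finsum_addf) auto
    finally show ?thesis .
  qed
  then have "(\<Oplus>\<^bsub>A\<^esub>g\<in>carrier G. \<Oplus>\<^bsub>A\<^esub>h\<in>carrier G. ?f (a \<oplus>\<^bsub>A\<^esub> b) g h) =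
      (\<Oplus>\<^bsub>A\<^esub>g\<in>carrier G. (\<Oplus>\<^bsub>A\<^esub>h\<in>carrier G. ?f a g h) \<oplus>\<^bsub>A\<^esub> (\<Oplus>\<^bsub>A\<^esub>h\<in>carrier G. ?f b g h))"
    using assms cl by (intro A.finsum_cong') (auto intro!: A.finsum_closed A.a_closed)
  also have "\<dots> = (\<Oplus>\<^bsub>A\<^esub>g\<in>carrier G. \<Oplus>\<^bsub>A\<^esub>h\<in>carrier G. ?f a g h) \<oplus>\<^bsub>A\<^esub> (\<Oplus>\<^bsub>A\<^esub>g\<in>carrier G. \<Oplus>\<^bsub>A\<^esub>h\<in>carrier G. ?f b g h)"
    using assms cl by (intro A.finsum_addf) (auto intro!: A.finsum_closed)
  finally show ?thesis using assms by (simp add: twist_mult)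
qed

text \<open>The bilinear extension collapses to its single nonzero term, so from here on only the
  defining rule on homogeneous elements is used.\<close>

lemma twist_homogeneous:
  assumes g: "g \<in> carrier G" and h: "h \<in> carrier G" and a: "a \<in> gr.part g" and b: "b \<in> gr.part h"
  shows "a \<otimes>\<^bsub>B\<^esub> b = \<mu> g h \<odot>\<^bsub>A\<^esub> (a \<otimes>\<^bsub>A\<^esub> b)"
proof -
  note cl = gr.part_carrier[OF a] gr.part_carrier[OF b]
  have inner: "(\<Oplus>\<^bsub>A\<^esub>t\<in>carrier G. \<mu> s t \<odot>\<^bsub>A\<^esub> (proj s a \<otimes>\<^bsub>A\<^esub> proj t b)) = (if g = s then \<mu> s h \<odot>\<^bsub>A\<^esub> (a \<otimes>\<^bsub>A\<^esub> b) else \<zero>\<^bsub>A\<^esub>)"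
    if s: "s \<in> carrier G" for s
  proof -
    have "(\<Oplus>\<^bsub>A\<^esub>t\<in>carrier G. \<mu> s t \<odot>\<^bsub>A\<^esub> (proj s a \<otimes>\<^bsub>A\<^esub> proj t b)) =
        (\<Oplus>\<^bsub>A\<^esub>t\<in>carrier G. if h = t then \<mu> s t \<odot>\<^bsub>A\<^esub> (proj s a \<otimes>\<^bsub>A\<^esub> b) else \<zero>\<^bsub>A\<^esub>)"
      using s h cl b by (intro A.finsum_cong') (auto simp: gr.comp_part mu_closed proj_closed)
    also have "\<dots> = \<mu> s h \<odot>\<^bsub>A\<^esub> (proj s a \<otimes>\<^bsub>A\<^esub> b)"
      using s h cl finite_G by (intro A.finsum_singleton) (auto simp: mu_closed proj_closed)
    finally show ?thesis using s g h a cl by (auto simp: gr.comp_part mu_closed)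
  qed
  have "a \<otimes>\<^bsub>B\<^esub> b = (\<Oplus>\<^bsub>A\<^esub>s\<in>carrier G. if g = s then \<mu> s h \<odot>\<^bsub>A\<^esub> (a \<otimes>\<^bsub>A\<^esub> b) else \<zero>\<^bsub>A\<^esub>)"
    unfolding twist_mult[OF cl] using h cl by (intro A.finsum_cong') (auto simp: inner mu_closed)
  also have "\<dots> = \<mu> g h \<odot>\<^bsub>A\<^esub> (a \<otimes>\<^bsub>A\<^esub> b)"
    using g h cl finite_G by (intro A.finsum_singleton) (auto simp: mu_closed)
  finally show ?thesis .
qed

lemma part_smult:
  assumes g: "g \<in> carrier G" and a: "a \<in> gr.part g" and c: "c \<in> carrier k"
  shows "c \<odot>\<^bsub>A\<^esub> a \<in> gr.part g"
proof -
  note aA = gr.part_carrier[OF a]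
  have "a \<in> graded_part A G \<phi> \<chi> g" using gr.part_comp[OF a] proj_in_graded_part[OF g aA] by simp
  then have "c \<odot>\<^bsub>A\<^esub> a \<in> graded_part A G \<phi> \<chi> g"
    using c g by (auto simp: graded_part_def act.action_smult chi.chi_closed K.m_comm simp flip: V.smult_assoc1)
  then show ?thesis using proj_graded_part[OF g g] aA c by (simp add: gr.part_def)
qed

text \<open>The two bracketings differ only in their scalars, which are the two sides of the cocycle
  identity.\<close>

lemma twist_assoc_homogeneous:
  assumes g: "g \<in> carrier G" "h \<in> carrier G" "l \<in> carrier G"
    and a: "a \<in> gr.part g" "b \<in> gr.part h" "c \<in> gr.part l"
  shows "(a \<otimes>\<^bsub>B\<^esub> b) \<otimes>\<^bsub>B\<^esub> c = a \<otimes>\<^bsub>B\<^esub> (b \<otimes>\<^bsub>B\<^esub> c)"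
proof -
  note cl = gr.part_carrier[OF a(1)] gr.part_carrier[OF a(2)] gr.part_carrier[OF a(3)]
  have ab: "a \<otimes>\<^bsub>B\<^esub> b = \<mu> g h \<odot>\<^bsub>A\<^esub> (a \<otimes>\<^bsub>A\<^esub> b)" "\<mu> g h \<odot>\<^bsub>A\<^esub> (a \<otimes>\<^bsub>A\<^esub> b) \<in> gr.part (g \<otimes> h)"
    using g a by (auto simp: twist_homogeneous mu_closed intro: part_smult gr.part_mult)
  have bc: "b \<otimes>\<^bsub>B\<^esub> c = \<mu> h l \<odot>\<^bsub>A\<^esub> (b \<otimes>\<^bsub>A\<^esub> c)" "\<mu> h l \<odot>\<^bsub>A\<^esub> (b \<otimes>\<^bsub>A\<^esub> c) \<in> gr.part (h \<otimes> l)"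
    using g a by (auto simp: twist_homogeneous mu_closed intro: part_smult gr.part_mult)
  have "(a \<otimes>\<^bsub>B\<^esub> b) \<otimes>\<^bsub>B\<^esub> c = (\<mu> (g \<otimes> h) l \<otimes>\<^bsub>k\<^esub> \<mu> g h) \<odot>\<^bsub>A\<^esub> (a \<otimes>\<^bsub>A\<^esub> b \<otimes>\<^bsub>A\<^esub> c)"
    unfolding ab(1) using g cl twist_homogeneous[OF _ g(3) ab(2) a(3)]
    by (simp add: mu_closed act.smult_mult_left V.smult_assoc1)
  also have "\<mu> (g \<otimes> h) l \<otimes>\<^bsub>k\<^esub> \<mu> g h = \<mu> g (h \<otimes> l) \<otimes>\<^bsub>k\<^esub> \<mu> h l"
    using g K.m_comm[of "\<mu> (g \<otimes> h) l" "\<mu> g h"] by (simp add: mu_closed mu_cocycle)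
  also have "\<dots> \<odot>\<^bsub>A\<^esub> (a \<otimes>\<^bsub>A\<^esub> b \<otimes>\<^bsub>A\<^esub> c) = a \<otimes>\<^bsub>B\<^esub> (b \<otimes>\<^bsub>B\<^esub> c)"
    unfolding bc(1) using g cl twist_homogeneous[OF g(1) _ a(1) bc(2)]
    by (simp add: mu_closed act.smult_mult_right V.smult_assoc1 A.m_assoc)
  finally show ?thesis .
qed

text \<open>Extends the homogeneous case by additivity in one argument at a time, starting with the
  last.\<close>

lemma twist_assoc:
  assumes "a \<in> carrier A" "b \<in> carrier A" "c \<in> carrier A"
  shows "(a \<otimes>\<^bsub>B\<^esub> b) \<otimes>\<^bsub>B\<^esub> c = a \<otimes>\<^bsub>B\<^esub> (b \<otimes>\<^bsub>B\<^esub> c)"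
proof -
  note distr = hom_def twist_closed twist_l_distr twist_r_distr
  have 1: "(a \<otimes>\<^bsub>B\<^esub> b) \<otimes>\<^bsub>B\<^esub> c = a \<otimes>\<^bsub>B\<^esub> (b \<otimes>\<^bsub>B\<^esub> c)"
    if "g \<in> carrier G" "h \<in> carrier G" "a \<in> gr.part g" "b \<in> gr.part h" "c \<in> carrier A" for g h a b c
  proof (rule gr.additive_eqI[OF A.is_abelian_group, where f = "\<lambda>c. (a \<otimes>\<^bsub>B\<^esub> b) \<otimes>\<^bsub>B\<^esub> c" and f' = "\<lambda>c. a \<otimes>\<^bsub>B\<^esub> (b \<otimes>\<^bsub>B\<^esub> c)"])
    fix l c assume "l \<in> carrier G" "c \<in> gr.part l"
    with that show "(a \<otimes>\<^bsub>B\<^esub> b) \<otimes>\<^bsub>B\<^esub> c = a \<otimes>\<^bsub>B\<^esub> (b \<otimes>\<^bsub>B\<^esub> c)" by (rule_tac twist_assoc_homogeneous)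
  qed (use that gr.part_carrier[OF that(3)] gr.part_carrier[OF that(4)] in \<open>auto simp: distr\<close>)
  have 2: "(a \<otimes>\<^bsub>B\<^esub> b) \<otimes>\<^bsub>B\<^esub> c = a \<otimes>\<^bsub>B\<^esub> (b \<otimes>\<^bsub>B\<^esub> c)"
    if "g \<in> carrier G" "a \<in> gr.part g" "b \<in> carrier A" "c \<in> carrier A" for g a b c
  proof (rule gr.additive_eqI[OF A.is_abelian_group, where f = "\<lambda>b. (a \<otimes>\<^bsub>B\<^esub> b) \<otimes>\<^bsub>B\<^esub> c" and f' = "\<lambda>b. a \<otimes>\<^bsub>B\<^esub> (b \<otimes>\<^bsub>B\<^esub> c)"])
    fix l b assume "l \<in> carrier G" "b \<in> gr.part l"
    with that show "(a \<otimes>\<^bsub>B\<^esub> b) \<otimes>\<^bsub>B\<^esub> c = a \<otimes>\<^bsub>B\<^esub> (b \<otimes>\<^bsub>B\<^esub> c)" by (rule_tac 1)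
  qed (use that gr.part_carrier[OF that(2)] in \<open>auto simp: distr\<close>)
  show ?thesis
  proof (rule gr.additive_eqI[OF A.is_abelian_group, where f = "\<lambda>a. (a \<otimes>\<^bsub>B\<^esub> b) \<otimes>\<^bsub>B\<^esub> c" and f' = "\<lambda>a. a \<otimes>\<^bsub>B\<^esub> (b \<otimes>\<^bsub>B\<^esub> c)"])
    fix l a assume "l \<in> carrier G" "a \<in> gr.part l"
    with assms show "(a \<otimes>\<^bsub>B\<^esub> b) \<otimes>\<^bsub>B\<^esub> c = a \<otimes>\<^bsub>B\<^esub> (b \<otimes>\<^bsub>B\<^esub> c)" by (rule_tac 2)
  qed (use assms in \<open>auto simp: distr\<close>)
qed

lemma twist_one:
  assumes a: "a \<in> carrier A"
  shows "\<one>\<^bsub>A\<^esub> \<otimes>\<^bsub>B\<^esub> a = a" "a \<otimes>\<^bsub>B\<^esub> \<one>\<^bsub>A\<^esub> = a"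
proof -
  note distr = hom_def twist_closed twist_l_distr twist_r_distr
  show "\<one>\<^bsub>A\<^esub> \<otimes>\<^bsub>B\<^esub> a = a"
  proof (rule gr.additive_eqI[OF A.is_abelian_group, where f = "\<lambda>a. \<one>\<^bsub>A\<^esub> \<otimes>\<^bsub>B\<^esub> a" and f' = "\<lambda>a. a"])
    fix g b assume "g \<in> carrier G" "b \<in> gr.part g"
    then show "\<one>\<^bsub>A\<^esub> \<otimes>\<^bsub>B\<^esub> b = b"
      using twist_homogeneous[OF G.one_closed _ gr.one_part] gr.part_carrier by (simp add: mu_one)
  qed (use a in \<open>auto simp: distr\<close>)
  show "a \<otimes>\<^bsub>B\<^esub> \<one>\<^bsub>A\<^esub> = a"
  proof (rule gr.additive_eqI[OF A.is_abelian_group, where f = "\<lambda>a. a \<otimes>\<^bsub>B\<^esub> \<one>\<^bsub>A\<^esub>" and f' = "\<lambda>a. a"])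
    fix g b assume "g \<in> carrier G" "b \<in> gr.part g"
    then show "b \<otimes>\<^bsub>B\<^esub> \<one>\<^bsub>A\<^esub> = b"
      using twist_homogeneous[OF _ G.one_closed _ gr.one_part] gr.part_carrier by (simp add: mu_one)
  qed (use a in \<open>auto simp: distr\<close>)
qed

lemma ring_twist: "ring B"
proof (intro ringI abelian_groupI monoidI)
  fix x assume "x \<in> carrier B"
  then show "\<exists>y\<in>carrier B. y \<oplus>\<^bsub>B\<^esub> x = \<zero>\<^bsub>B\<^esub>"
    by (intro bexI[of _ "\<ominus>\<^bsub>A\<^esub> x"]) (auto simp: A.l_neg)
qed (auto simp: A.a_ac twist_closed twist_l_distr twist_r_distr twist_assoc twist_one)

text \<open>Moves the base field into the ring, because \<open>twist_pair\<close> expects the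
  cocycle values and 1/|G| as ring elements.\<close>

definition scal :: "'c \<Rightarrow> 'a" where "scal c = c \<odot>\<^bsub>A\<^esub> \<one>\<^bsub>A\<^esub>"

lemma scal_closed: "c \<in> carrier k \<Longrightarrow> scal c \<in> carrier A"
  by (simp add: scal_def)

lemma scal_part: "c \<in> carrier k \<Longrightarrow> scal c \<in> gr.part \<one>"
  unfolding scal_def using gr.one_part by (intro part_smult) auto

lemma scal_mult:
  assumes "c \<in> carrier k" "a \<in> carrier A"
  shows "scal c \<otimes>\<^bsub>A\<^esub> a = c \<odot>\<^bsub>A\<^esub> a" "a \<otimes>\<^bsub>A\<^esub> scal c = c \<odot>\<^bsub>A\<^esub> a"
  using assms by (simp_all add: scal_def act.smult_mult_left act.smult_mult_right)

lemma scal_scal: "c \<in> carrier k \<Longrightarrow> d \<in> carrier k \<Longrightarrow> scal c \<otimes>\<^bsub>A\<^esub> scal d = scal (c \<otimes>\<^bsub>k\<^esub> d)"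
  by (simp add: scal_def smult_mult_smult)

lemma scal_one: "scal \<one>\<^bsub>k\<^esub> = \<one>\<^bsub>A\<^esub>"
  by (simp add: scal_def)

lemma twist_pair_B: "twist_pair A B G proj (\<lambda>g h. scal (\<mu> g h)) (\<lambda>g h. scal (inv\<^bsub>k\<^esub> \<mu> g h)) (scal (inv\<^bsub>k\<^esub> chi.N))"
proof -
  interpret B: ring B by (rule ring_twist)
  show ?thesis
  proof
    fix g h a b assume *: "g \<in> carrier G" "h \<in> carrier G" "a \<in> carrier A" "b \<in> carrier A" "proj g a = a" "proj h b = b"
    then show "a \<otimes>\<^bsub>B\<^esub> b = scal (\<mu> g h) \<otimes>\<^bsub>A\<^esub> (a \<otimes>\<^bsub>A\<^esub> b)"
      using twist_homogeneous[of g h a b] by (simp add: gr.part_def scal_mult mu_closed)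
  next
    have "(\<Oplus>\<^bsub>A\<^esub>g\<in>carrier G. scal (inv\<^bsub>k\<^esub> chi.N)) = inv\<^bsub>k\<^esub> chi.N \<odot>\<^bsub>A\<^esub> (\<Oplus>\<^bsub>A\<^esub>g\<in>carrier G. \<one>\<^bsub>k\<^esub> \<odot>\<^bsub>A\<^esub> \<one>\<^bsub>A\<^esub>)"
      using finite_G invN_closed by (subst smult_sum) (auto simp: scal_def)
    also have "(\<Oplus>\<^bsub>A\<^esub>g\<in>carrier G. \<one>\<^bsub>k\<^esub> \<odot>\<^bsub>A\<^esub> \<one>\<^bsub>A\<^esub>) = chi.N \<odot>\<^bsub>A\<^esub> \<one>\<^bsub>A\<^esub>"
      unfolding chi.N_def using finite_G by (intro sum_smult[symmetric]) auto
    finally show "(\<Oplus>\<^bsub>A\<^esub>g\<in>carrier G. scal (inv\<^bsub>k\<^esub> chi.N)) = \<one>\<^bsub>A\<^esub>" by (simp add: invN_smult)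
  next
    fix g h assume "g \<in> carrier G" "h \<in> carrier G"
    then show "scal (\<mu> g h) \<otimes>\<^bsub>A\<^esub> scal (inv\<^bsub>k\<^esub> \<mu> g h) = \<one>\<^bsub>A\<^esub>"
      using mu_Units[of g h] by (simp add: scal_scal scal_one K.Units_closed)
  next
    fix g h l assume "g \<in> carrier G" "h \<in> carrier G" "l \<in> carrier G"
    then show "scal (\<mu> g h) \<otimes>\<^bsub>A\<^esub> scal (\<mu> (g \<otimes> h) l) = scal (\<mu> g (h \<otimes> l)) \<otimes>\<^bsub>A\<^esub> scal (\<mu> h l)"
      by (simp add: scal_scal mu_closed mu_cocycle)
  qed (auto simp: scal_closed mu_closed mu_Units invN_closed scal_mult mu_one scal_one
      gr.part_comp[OF scal_part])
qed

section \<open>Comparison of dimensions in each universe\<close>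

lemma lgldim_twist_infinite_universe:
  assumes "infinite (UNIV :: 'm set)"
  shows "lgldim TYPE('m) A = lgldim TYPE('m) B"
    "lgldim TYPE('m) (opposite_ring A) = lgldim TYPE('m) (opposite_ring B)"
proof -
  obtain dec :: "'m \<Rightarrow> 'g \<Rightarrow> 'm" and enc where "\<forall>f. \<forall>g\<in>carrier G. dec (enc f) g = f g"
    "\<forall>x y. (\<forall>g\<in>carrier G. dec x g = dec y g) \<longrightarrow> x = y"
    by (rule infinite_encoding[OF assms finite_G G.carrier_not_empty])
  then have code: "coded_twist_pair_axioms G dec enc"
    by (intro coded_twist_pair_axioms.intro) blast+
  show "lgldim TYPE('m) A = lgldim TYPE('m) B"
    using twist_pair_B code by (intro coded_twist_pair.lgldim_eq coded_twist_pair.intro)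
  show "lgldim TYPE('m) (opposite_ring A) = lgldim TYPE('m) (opposite_ring B)"
    using twist_pair.twist_pair_opposite[OF twist_pair_B] code
    by (intro coded_twist_pair.lgldim_eq coded_twist_pair.intro)
qed

text \<open>The difference of distinct scalars is a unit of \<open>k\<close>, and scalars have
  trivial degree, so the twist does not affect their products. Both orders of both products are
  recorded in order to serve \<open>A\<close>, \<open>B\<close> and their opposites.\<close>

lemma scal_diff:
  assumes "c \<in> carrier k" "c' \<in> carrier k" "c \<noteq> c'"
  shows "\<exists>y\<in>carrier A. \<exists>z\<in>carrier A. scal c = scal c' \<oplus>\<^bsub>A\<^esub> z \<and> y \<otimes>\<^bsub>A\<^esub> z = \<one>\<^bsub>A\<^esub> \<and> z \<otimes>\<^bsub>A\<^esub> y = \<one>\<^bsub>A\<^esub> \<and>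
    y \<otimes>\<^bsub>B\<^esub> z = \<one>\<^bsub>A\<^esub> \<and> z \<otimes>\<^bsub>B\<^esub> y = \<one>\<^bsub>A\<^esub>"
proof -
  interpret B: twist_pair A B G proj "\<lambda>g h. scal (\<mu> g h)" "\<lambda>g h. scal (inv\<^bsub>k\<^esub> \<mu> g h)" "scal (inv\<^bsub>k\<^esub> chi.N)"
    by (rule twist_pair_B)
  let ?d = "c \<ominus>\<^bsub>k\<^esub> c'"
  have d: "?d \<in> Units k" using assms by (simp add: K.field_Units K.r_right_minus_eq)
  note dcl = K.Units_closed[OF d] K.Units_inv_closed[OF d]
  have "c' \<oplus>\<^bsub>k\<^esub> ?d = c" using assms by (simp add: a_minus_def K.a_lcomm K.r_neg)
  then have "scal c = scal c' \<oplus>\<^bsub>A\<^esub> scal ?d"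
    using assms V.smult_l_distr[of c' ?d "\<one>\<^bsub>A\<^esub>"] by (simp add: scal_def)
  moreover have "scal (inv\<^bsub>k\<^esub> ?d) \<otimes>\<^bsub>A\<^esub> scal ?d = \<one>\<^bsub>A\<^esub>" "scal ?d \<otimes>\<^bsub>A\<^esub> scal (inv\<^bsub>k\<^esub> ?d) = \<one>\<^bsub>A\<^esub>"
    using d by (simp_all only: scal_scal[OF dcl] scal_scal[OF dcl(2,1)] K.Units_l_inv K.Units_r_inv scal_one)
  ultimately show ?thesis
    using scal_closed[OF dcl(1)] scal_closed[OF dcl(2)] scal_part[OF dcl(2)]
    by (intro bexI[of _ "scal (inv\<^bsub>k\<^esub> ?d)"] bexI[of _ "scal ?d"])
      (simp_all add: B.twist_one_left B.twist_one_right)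
qed

lemma lgldim_twist_finite_universe:
  assumes fin: "finite (UNIV :: 'm set)"
  shows "lgldim TYPE('m) A = lgldim TYPE('m) B"
    "lgldim TYPE('m) (opposite_ring A) = lgldim TYPE('m) (opposite_ring B)"
proof -
  note zero = lgldim_eq_0_if_finite_universe[OF fin K.infinite_carrier, where \<iota> = scal]
  have "lgldim TYPE('m) A = 0"
    by (rule zero) (simp add: scal_closed, use scal_diff in blast)
  moreover have "lgldim TYPE('m) (opposite_ring A) = 0"
    by (rule zero) (simp add: scal_closed, use scal_diff in simp, blast)
  moreover have "lgldim TYPE('m) B = 0"
    by (rule zero) (simp add: scal_closed, use scal_diff in simp, blast)
  moreover have "lgldim TYPE('m) (opposite_ring B) = 0"
    by (rule zero) (simp add: scal_closed, use scal_diff in simp, blast)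
  ultimately show "lgldim TYPE('m) A = lgldim TYPE('m) B"
    "lgldim TYPE('m) (opposite_ring A) = lgldim TYPE('m) (opposite_ring B)" by simp_all
qed

end

theorem proposition3p2p18:
  fixes k :: "('c, 'r) ring_scheme"
    and A :: "('c, 'a) module"
    and G :: "('g, 'x) monoid_scheme"
    and \<phi> :: "'g \<Rightarrow> 'a \<Rightarrow> 'a"
    and \<chi> \<mu> :: "'g \<Rightarrow> 'g \<Rightarrow> 'c"
  assumes "algebraically_closed k"
    and "assoc_algebra k A"
    and "finitely_generated_algebra k A"
    and "comm_group G"
    and "finite (carrier G)"
    and "\<not> characteristic k dvd order G"
    and "algebra_action k A G \<phi>"
    and "\<chi> \<in> iso G (dual_group G k)"
    and "normalised_2cocycle G k \<mu>"
  shows "rgldim TYPE('m) A = rgldim TYPE('m) (cocycle_twist A G \<phi> \<chi> \<mu>) \<and>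
         lgldim TYPE('m) A = lgldim TYPE('m) (cocycle_twist A G \<phi> \<chi> \<mu>)"
proof -
  interpret twisted_algebra k A G \<phi> \<chi> \<mu>
    using assms by (intro twisted_algebra.intro twisted_algebra_axioms.intro) (auto simp: assoc_algebra_def)
  show ?thesis unfolding rgldim_def
    using lgldim_twist_infinite_universe lgldim_twist_finite_universe by blast
qed

end
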